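(* Let $\mathbb{F}$ be an algebraically closed field of characteristic $2$. Let $x_6,y_6\in \mathrm{GL}_6(\mathbb{F})$ be such that $H_6=\langle x_6,y_6\rangle$ is an irreducible subgroup of $\mathrm{SL}_6(\mathbb{F})$ and $(x_6,y_6,x_6y_6)$ is a non-rigid $(2,3,7)$-triple, i.e. a triple with the following similarity invariants: $$x_6:\ t^2+1,\ t^2+1,\ t^2+1;\qquad y_6:\ t^3-1,\ t^3-1;\qquad x_6y_6:\ t^6+t^5+t^4+t^3+t^2+t+1.$$ Then $H_6$ is a subgroup of $G_2(\mathbb{F})$.
   Context: The similarity invariants of a square matrix are its non-constant invariant factors (each dividing the next, with product the characteristic polynomial). A triple $(x,y,xy)\in\mathrm{GL}_n(\mathbb{F})^3$ is irreducible if $\langle x,y\rangle$ acts irreducibly on $\mathbb{F}^n$; it is a $(2,3,7)$-triple if the images of $x,y,xy$ in $\mathrm{PGL}_n(\mathbb{F})$ have orders $2,3,7$ respectively. For $H=\langle x,y\rangle$ acting linearly on a finite-dimensional space $V$ via $\Phi$, and $A\subseteq H$, let $d_V^A$ be the dimension of the space of vectors fixed by all $\Phi(a)$, $a\in A$, and $\hat d_V^A$ the dimension of the space of vectors fixed by all $\Phi(a)^T$, $a\in A$; $d_V^a=d_V^{\{a\}}$. Scott's formula states $d_V^x+d_V^y+d_V^{xy}\le \dim V+d_V^H+\hat d_V^H$. An irreducible triple is rigid if equality holds for the conjugation action on $V=\mathrm{Mat}_n(\mathbb{F})$; otherwise it is non-rigid. As is known, up to multiplication of the matrices by scalars, the irreducible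 non-rigid $(2,3,7)$-triples for $n=6$ are those with the displayed similarity invariants; the hypothesis is that the triple has exactly these invariants. A Dickson form on $\mathbb{F}^7$ is an alternating trilinear form which, for some basis $v_0,v_1,v_2,v_3,v_{-1},v_{-2},v_{-3}$ with dual basis $v_i^*$, equals $$v_0^*\wedge v_1^*\wedge v_{-1}^*+v_0^*\wedge v_2^*\wedge v_{-2}^*+v_0^*\wedge v_3^*\wedge v_{-3}^*+v_1^*\wedge v_2^*\wedge v_{-3}^*+v_{-1}^*\wedge v_{-2}^*\wedge v_3^*.$$ $G_2(\mathbb{F})$ is defined as the subgroup of $\mathrm{GL}_7(\mathbb{F})$ fixing a Dickson form. In characteristic $2$ it stabilizes the line $\langle v_0\rangle$ and lies in $\mathrm{Sp}_6(\mathbb{F})$ through its action on the $6$-dimensional space $\mathbb{F}^7/\langle v_0\rangle$; containment of a subgroup of $\mathrm{SL}_6(\mathbb{F})$ in $G_2(\mathbb{F})$ is understood with respect to this $6$-dimensional embedding, up to conjugation in $\mathrm{GL}_6(\mathbb{F})$. *)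

theory Defs
  imports
    "HOL-Algebra.Generated_Groups"
    "Jordan_Normal_Form.VS_Connect"
    "Jordan_Normal_Form.Char_Poly"
begin

section \<open>Matrix groups\<close>

definition GL :: "'a::field itself \<Rightarrow> nat \<Rightarrow> 'a mat monoid" where
  "GL ty n = units_of (ring_mat ty n ())"

definition SL :: "'a::field itself \<Rightarrow> nat \<Rightarrow> 'a mat set" where
  "SL ty n = {A \<in> carrier (GL ty n). det A = 1}"

definition acts_irreducibly :: "nat \<Rightarrow> 'a::field mat set \<Rightarrow> bool" where
  "acts_irreducibly n H \<longleftrightarrow>
     carrier_vec n \<noteq> {0\<^sub>v n :: 'a vec} \<and>
     (\<forall>W. VectorSpace.subspace class_ring W (module_vec TYPE('a) n) \<and>
          (\<forall>h\<in>H. \<forall>w\<in>W. h *\<^sub>v w \<in> W) \<longrightarrow>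
          W = {0\<^sub>v n} \<or> W = carrier_vec n)"

section \<open>Similarity invariants\<close>

text \<open>
  The invariant factors of an \<open>n \<times> n\<close> matrix \<open>A\<close> are the diagonal entries of the Smith normal
  form of the characteristic matrix \<open>t I - A\<close> over the polynomial ring, normalised to be monic;
  the similarity invariants are those that are not constant, each dividing the next. They determine
  the Smith form \<open>diag(1, \<dots>, 1, f\<^sub>1, \<dots>, f\<^sub>r)\<close>, and are determined by \<open>A\<close>. Note that
  \<open>invertible_mat\<close> below means invertible over the polynomial ring.
\<close>

definition similarity_invariants :: "'a::field mat \<Rightarrow> 'a poly list \<Rightarrow> bool" where
  "similarity_invariants A fs \<longleftrightarrow>
     square_mat A \<and> length fs \<le> dim_row A \<and>
     (\<forall>f\<in>set fs. lead_coeff f = 1 \<and> degree f > 0) \<and>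
     sorted_wrt (dvd) fs \<and>
     (let n = dim_row A in
      \<exists>P Q. P \<in> carrier_mat n n \<and> Q \<in> carrier_mat n n \<and> invertible_mat P \<and> invertible_mat Q \<and>
        P * char_poly_matrix A * Q =
          mat n n (\<lambda>(i, j). if i = j then (replicate (n - length fs) 1 @ fs) ! i else 0))"

section \<open>Dickson forms and \<open>G\<^sub>2\<close>\<close>

text \<open>Linear functionals are given by their coefficient vectors, so \<open>a\<close> sends \<open>u\<close> to \<open>a \<bullet> u\<close>.
  The wedge product of three functionals carries no factor \<open>1/3!\<close>, hence makes sense in every
  characteristic.\<close>

definition wedge3 :: "'a::field vec \<Rightarrow> 'a vec \<Rightarrow> 'a vec \<Rightarrow> 'a vec \<Rightarrow> 'a vec \<Rightarrow> 'a vec \<Rightarrow> 'a" where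
  "wedge3 a b c u v w = det (mat_of_rows_list 3
     [[a \<bullet> u, a \<bullet> v, a \<bullet> w],
      [b \<bullet> u, b \<bullet> v, b \<bullet> w],
      [c \<bullet> u, c \<bullet> v, c \<bullet> w]])"

definition dual_bases7 :: "(int \<Rightarrow> 'a::field vec) \<Rightarrow> (int \<Rightarrow> 'a vec) \<Rightarrow> bool" where
  "dual_bases7 v d \<longleftrightarrow>
     vectorspace.basis class_ring (module_vec TYPE('a) 7) (v ` {-3..3}) \<and>
     (\<forall>i\<in>{-3..3}. d i \<in> carrier_vec 7) \<and>
     (\<forall>i\<in>{-3..3}. \<forall>j\<in>{-3..3}. d i \<bullet> v j = (if i = j then 1 else 0))"

definition dickson_basis ::
  "('a::field vec \<Rightarrow> 'a vec \<Rightarrow> 'a vec \<Rightarrow> 'a) \<Rightarrow> (int \<Rightarrow> 'a vec) \<Rightarrow> (int \<Rightarrow> 'a vec) \<Rightarrow> bool" where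
  "dickson_basis D v d \<longleftrightarrow> dual_bases7 v d \<and>
     (\<forall>x\<in>carrier_vec 7. \<forall>y\<in>carrier_vec 7. \<forall>z\<in>carrier_vec 7.
        D x y z = wedge3 (d 0) (d 1) (d (-1)) x y z + wedge3 (d 0) (d 2) (d (-2)) x y z
                + wedge3 (d 0) (d 3) (d (-3)) x y z + wedge3 (d 1) (d 2) (d (-3)) x y z
                + wedge3 (d (-1)) (d (-2)) (d 3) x y z)"

definition G2 :: "('a::field vec \<Rightarrow> 'a vec \<Rightarrow> 'a vec \<Rightarrow> 'a) \<Rightarrow> 'a mat set" where
  "G2 D = {g \<in> carrier (GL TYPE('a) 7).
     \<forall>x\<in>carrier_vec 7. \<forall>y\<in>carrier_vec 7. \<forall>z\<in>carrier_vec 7.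
       D (g *\<^sub>v x) (g *\<^sub>v y) (g *\<^sub>v z) = D x y z}"

text \<open>
  The \<open>6 \<times> 7\<close> matrix with rows \<open>d 1, d 2, d 3, d (-1), d (-2), d (-3)\<close> is the projection of the
  7-dimensional space onto its quotient by the line through \<open>v 0\<close>, in the coordinates given by the
  images of the other six basis vectors. For \<open>g\<close> stabilising that line, \<open>h * p = p * g\<close> says that
  \<open>h\<close> is the matrix of the action of \<open>g\<close> on the quotient; in characteristic 2 every \<open>g \<in> G2 D\<close>
  stabilises it.
\<close>

definition quotient_projection :: "(int \<Rightarrow> 'a::field vec) \<Rightarrow> 'a mat" where
  "quotient_projection d = mat_of_rows 7 [d 1, d 2, d 3, d (-1), d (-2), d (-3)]"

definition G2_dim6 ::
  "('a::field vec \<Rightarrow> 'a vec \<Rightarrow> 'a vec \<Rightarrow> 'a) \<Rightarrow> (int \<Rightarrow> 'a vec) \<Rightarrow> 'a mat set" where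
  "G2_dim6 D d = {h \<in> carrier (GL TYPE('a) 6).
     \<exists>g\<in>G2 D. h * quotient_projection d = quotient_projection d * g}"

text \<open>Only meant for characteristic 2. All Dickson forms are equivalent under the general linear
  group, so the choice of form and of Dickson basis is immaterial up to conjugation.\<close>

definition contained_in_G2_dim6 :: "'a::field mat set \<Rightarrow> bool" where
  "contained_in_G2_dim6 H \<longleftrightarrow>
     (\<exists>D v d. dickson_basis D v d \<and>
        (\<exists>c\<in>carrier (GL TYPE('a) 6).
           (\<lambda>h. c * h * inv\<^bsub>GL TYPE('a) 6\<^esub> c) ` H \<subseteq> G2_dim6 D d))"

end

(*
  Conjugate so that z = xy is diagonal, with eigenvalues t, t^2, t^3, t^6, t^5, t^4 for a primitive
  seventh root of unity t.  The dimension count behind Scott's formula is then used twice.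

  On the 15-dimensional space of alternating bilinear forms x, y and z fix subspaces of dimension
  9, 5 and 3.  Since 9 + 5 + 3 > 15 + 1, there is either an invariant form or an invariant
  degenerate bivector; irreducibility excludes the latter and makes the form nondegenerate.  Being
  invariant under z, it is antidiagonal, and a diagonal change of basis turns it into omega.

  The classes of trivectors killed by contraction with omega, modulo multiples of omega, form the
  8-dimensional spin module of Sp_6.  There x, y and z fix subspaces of dimension at least 4, 4 and
  2, so there is a common fixed vector.  Being fixed by z, it is the class of
  a e_3* e_4* e_2* + b e_0* e_1* e_5* (indices from 0).  If a or b were 0, then x would stabilise a
  maximal isotropic coordinate subspace.  So a and b are nonzero, and rescaling makes them equal.

  The Dickson form is v_0* omega + tau with tau = e_0* e_1* e_5* + e_3* e_4* e_2*.  If h preserves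
  omega and moves tau by a multiple r omega of omega, then the matrix [[h, 0], [r, 1]] preserves
  the Dickson form and induces h on the quotient by v_0.
*)

theory Submission
  imports Defs
begin

section \<open>Characteristic two and three by three minors\<close>

text \<open>The counts 9, 5, 3 have these origins. The involution permutes the fifteen pairs of
  indices with three fixed pairs {i, i+3} and six orbits of length two. Among the eigenvalues 1, 1,
  w, w, w^2, w^2 of y, one pair 1, 1 and four pairs w, w^2 have product 1. The eigenvalues of z form
  three inverse pairs. In the spin module the 4 for y comes from trivectors with eigenvalues 1, w,
  w^2. Scott's formula is not invoked: each count is made effective by a square matrix with an
  explicit kernel vector, and a dependency among its rows is the relation sought. The spin module is
  not built as a quotient. Its elements enter through isotropic triples, which are seen only by
  their Gram determinants with other isotropic triples; eight minors then serve as coordinates. In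
  characteristic 2 the involution x is not diagonalisable, so its normal form is a permutation of
  six vectors. It is found, like the eigenvectors of y and z, by evaluating the transformation to
  Smith form at an eigenvalue.\<close>

locale char_two =
  fixes ty :: "'a::field itself"
  assumes char_two: "CHAR('a) = 2"
begin

lemma add_self: "(a::'a) + a = 0"
proof -
  have "(2::'a) = 0" using of_nat_CHAR[where 'a='a] char_two by simp
  thus ?thesis by (metis mult_2 mult_zero_left)
qed

lemma add_self_left: "(a::'a) + (a + b) = b"
  by (metis add.assoc add_0 add_self)

lemma minus_eq: "- (a::'a) = a"
  by (metis add_self minus_unique)

lemma diff_eq: "(a::'a) - b = a + b"
  by (metis diff_conv_add_uminus minus_eq)

lemma add_eq_zero_iff: "(a::'a) + b = 0 \<longleftrightarrow> a = b"
  by (metis add.right_neutral add_self add_self_left)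

lemmas two_simps = add_self add_self_left minus_eq diff_eq

end

lemma det_3:
  assumes "A \<in> carrier_mat 3 3"
  shows "det (A::'a::comm_ring_1 mat) =
    A $$ (0,0) * (A $$ (1,1) * A $$ (2,2) - A $$ (1,2) * A $$ (2,1))
  - A $$ (0,1) * (A $$ (1,0) * A $$ (2,2) - A $$ (1,2) * A $$ (2,0))
  + A $$ (0,2) * (A $$ (1,0) * A $$ (2,1) - A $$ (1,1) * A $$ (2,0))"
  using assms
  by (simp add: laplace_expansion_row[OF assms, of 0] cofactor_def mat_delete_def numeral_3_eq_3 numeral_2_eq_2 laplace_expansion_row[of _ 2 0] laplace_expansion_row[of _ "Suc (Suc 0)" 0] det_single algebra_simps)

context char_two begin

text \<open>Signs do not matter in characteristic 2, so the minors are written as permanents.\<close>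

definition minor :: "(nat \<Rightarrow> 'a) \<Rightarrow> (nat \<Rightarrow> 'a) \<Rightarrow> (nat \<Rightarrow> 'a) \<Rightarrow> nat \<Rightarrow> nat \<Rightarrow> nat \<Rightarrow> 'a" where
  "minor f g h i j k = f i * (g j * h k + g k * h j) + f j * (g i * h k + g k * h i) + f k * (g i * h j + g j * h i)"

definition dot :: "(nat \<Rightarrow> 'a) \<Rightarrow> (nat \<Rightarrow> 'a) \<Rightarrow> 'a" where
  "dot f u = f 0 * u 0 + f 1 * u 1 + f 2 * u 2 + f 3 * u 3 + f 4 * u 4 + f 5 * u 5"

lemma minor_eq: "minor f g h i i k = 0" "minor f g h i k k = 0" "minor f g h k i k = 0"
  unfolding minor_def by (simp_all add: algebra_simps two_simps)

lemma minor_sort: "i < j \<Longrightarrow> minor f g h j i k = minor f g h i j k" "j < k \<Longrightarrow> minor f g h i k j = minor f g h i j k"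
  unfolding minor_def by (simp_all add: algebra_simps)

text \<open>Cauchy-Binet for two by two minors: signs may be dropped, and the diagonal products
  \<open>f i * g i * u i * v i\<close> occur twice and cancel.\<close>

lemma dot_minor2:
  "dot f u * dot g v + dot f v * dot g u =
    (f 0 * g 1 + f 1 * g 0) * (u 0 * v 1 + u 1 * v 0) + (f 0 * g 2 + f 2 * g 0) * (u 0 * v 2 + u 2 * v 0)
  + (f 0 * g 3 + f 3 * g 0) * (u 0 * v 3 + u 3 * v 0) + (f 0 * g 4 + f 4 * g 0) * (u 0 * v 4 + u 4 * v 0)
  + (f 0 * g 5 + f 5 * g 0) * (u 0 * v 5 + u 5 * v 0) + (f 1 * g 2 + f 2 * g 1) * (u 1 * v 2 + u 2 * v 1)
  + (f 1 * g 3 + f 3 * g 1) * (u 1 * v 3 + u 3 * v 1) + (f 1 * g 4 + f 4 * g 1) * (u 1 * v 4 + u 4 * v 1)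
  + (f 1 * g 5 + f 5 * g 1) * (u 1 * v 5 + u 5 * v 1) + (f 2 * g 3 + f 3 * g 2) * (u 2 * v 3 + u 3 * v 2)
  + (f 2 * g 4 + f 4 * g 2) * (u 2 * v 4 + u 4 * v 2) + (f 2 * g 5 + f 5 * g 2) * (u 2 * v 5 + u 5 * v 2)
  + (f 3 * g 4 + f 4 * g 3) * (u 3 * v 4 + u 4 * v 3) + (f 3 * g 5 + f 5 * g 3) * (u 3 * v 5 + u 5 * v 3)
  + (f 4 * g 5 + f 5 * g 4) * (u 4 * v 5 + u 5 * v 4)"
  unfolding dot_def by (simp add: algebra_simps two_simps)

text \<open>Laplace expansion in \<open>w\<close> reduces this to \<open>dot_minor2\<close> and
  avoids a full expansion. The sum runs over an index \<open>k\<close> and a pair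
  \<open>i < j\<close>: terms with \<open>k\<close> in the pair carry a minor with a repeated index,
  and the three ways to split a triple add up to the minor of \<open>u\<close>, \<open>v\<close>,
  \<open>w\<close>.\<close>

lemma cauchy_binet:
  "dot f u * (dot g v * dot h w + dot g w * dot h v) + dot f v * (dot g u * dot h w + dot g w * dot h u)
   + dot f w * (dot g u * dot h v + dot g v * dot h u) =
    minor f g h 0 1 2 * minor u v w 0 1 2 + minor f g h 0 1 3 * minor u v w 0 1 3
  + minor f g h 0 1 4 * minor u v w 0 1 4 + minor f g h 0 1 5 * minor u v w 0 1 5
  + minor f g h 0 2 3 * minor u v w 0 2 3 + minor f g h 0 2 4 * minor u v w 0 2 4
  + minor f g h 0 2 5 * minor u v w 0 2 5 + minor f g h 0 3 4 * minor u v w 0 3 4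
  + minor f g h 0 3 5 * minor u v w 0 3 5 + minor f g h 0 4 5 * minor u v w 0 4 5
  + minor f g h 1 2 3 * minor u v w 1 2 3 + minor f g h 1 2 4 * minor u v w 1 2 4
  + minor f g h 1 2 5 * minor u v w 1 2 5 + minor f g h 1 3 4 * minor u v w 1 3 4
  + minor f g h 1 3 5 * minor u v w 1 3 5 + minor f g h 1 4 5 * minor u v w 1 4 5
  + minor f g h 2 3 4 * minor u v w 2 3 4 + minor f g h 2 3 5 * minor u v w 2 3 5
  + minor f g h 2 4 5 * minor u v w 2 4 5 + minor f g h 3 4 5 * minor u v w 3 4 5"
proof -
  define q where "q i j = u i * v j + u j * v i" for i j
  define A where "A i j = f i * g j + f j * g i" for i j
  define B where "B i j = f i * h j + f j * h i" for i j
  define C where "C i j = g i * h j + g j * h i" for i j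
  have m: "minor u v w i j k = w i * q j k + w j * q i k + w k * q i j" for i j k
    unfolding minor_def q_def by (simp add: algebra_simps)
  have T: "h k * A i j + g k * B i j + f k * C i j = minor f g h i j k" for i j k
    unfolding minor_def A_def B_def C_def by (simp add: algebra_simps)
  have sum6: "(\<Sum>i<6. t i) = t 0 + t 1 + t 2 + t 3 + t 4 + t 5" for t :: "nat \<Rightarrow> 'a"
    by (simp add: eval_nat_numeral)
  let ?P = "{(0,1),(0,2),(0,3),(0,4),(0,5),(1,2),(1,3),(1,4),(1,5),(2,3),(2,4),(2,5),(3,4),(3,5),(4,5::nat)} :: (nat \<times> nat) set"
  have A: "dot f u * dot g v + dot f v * dot g u = (\<Sum>(i,j)\<in>?P. A i j * q i j)"
    unfolding dot_minor2 A_def q_def by (simp add: add.assoc)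
  have B: "dot f u * dot h v + dot f v * dot h u = (\<Sum>(i,j)\<in>?P. B i j * q i j)"
    unfolding dot_minor2 B_def q_def by (simp add: add.assoc)
  have C: "dot g u * dot h v + dot g v * dot h u = (\<Sum>(i,j)\<in>?P. C i j * q i j)"
    unfolding dot_minor2 C_def q_def by (simp add: add.assoc)
  have d: "dot f w = (\<Sum>k<6. f k * w k)" for f unfolding dot_def sum6 ..
  have "dot f u * (dot g v * dot h w + dot g w * dot h v) + dot f v * (dot g u * dot h w + dot g w * dot h u)
   + dot f w * (dot g u * dot h v + dot g v * dot h u) = dot h w * (dot f u * dot g v + dot f v * dot g u)
   + dot g w * (dot f u * dot h v + dot f v * dot h u) + dot f w * (dot g u * dot h v + dot g v * dot h u)"
    by (simp add: algebra_simps)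
  also have "\<dots> = (\<Sum>k<6. \<Sum>(i,j)\<in>?P. (h k * A i j + g k * B i j + f k * C i j) * (w k * q i j))"
    unfolding A B C d sum_product sum.distrib[symmetric]
    by (intro sum.cong refl) (auto simp: algebra_simps)
  also have "\<dots> = (\<Sum>k<6. \<Sum>(i,j)\<in>?P. minor f g h i j k * (w k * q i j))"
    unfolding T ..
  finally show ?thesis unfolding m sum6
    by (simp add: distrib_left mult.assoc minor_eq minor_sort mult.left_commute add_ac)
qed


section \<open>The symplectic form, contraction and Gram determinants\<close>

definition omega :: "(nat \<Rightarrow> 'a) \<Rightarrow> (nat \<Rightarrow> 'a) \<Rightarrow> 'a" where
  "omega u v = u 0 * v 3 + u 3 * v 0 + u 1 * v 4 + u 4 * v 1 + u 2 * v 5 + u 5 * v 2"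

text \<open>These are the coordinates of the contraction of the trivector of \<open>f\<close>,
  \<open>g\<close>, \<open>h\<close> with \<open>omega\<close>: the coordinate at m collects the
  minors formed by m and a pair {i, i+3} avoiding m.\<close>

lemma contraction_identity:
  "minor f g h 0 2 5 + minor f g h 0 1 4 = f 0 * omega g h + g 0 * omega f h + h 0 * omega f g"
  "minor f g h 1 2 5 + minor f g h 0 1 3 = f 1 * omega g h + g 1 * omega f h + h 1 * omega f g"
  "minor f g h 1 2 4 + minor f g h 0 2 3 = f 2 * omega g h + g 2 * omega f h + h 2 * omega f g"
  "minor f g h 2 3 5 + minor f g h 1 3 4 = f 3 * omega g h + g 3 * omega f h + h 3 * omega f g"
  "minor f g h 2 4 5 + minor f g h 0 3 4 = f 4 * omega g h + g 4 * omega f h + h 4 * omega f g"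
  "minor f g h 1 4 5 + minor f g h 0 3 5 = f 5 * omega g h + g 5 * omega f h + h 5 * omega f g"
  by (simp_all add: minor_def omega_def algebra_simps two_simps)

text \<open>Twelve of the twenty minors contain a pair {i, i+3}, and isotropy identifies them two by
  two. The eight others choose one index from each pair; they are the coordinates in the spin
  module.\<close>

lemma contraction:
  assumes "omega f g = 0" "omega f h = 0" "omega g h = 0"
  shows "minor f g h 0 2 5 = minor f g h 0 1 4" "minor f g h 2 3 5 = minor f g h 1 3 4"
    "minor f g h 1 2 5 = minor f g h 0 1 3" "minor f g h 2 4 5 = minor f g h 0 3 4"
    "minor f g h 1 2 4 = minor f g h 0 2 3" "minor f g h 1 4 5 = minor f g h 0 3 5"
  using contraction_identity[of f g h] assms by (simp_all add: add_eq_zero_iff)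

definition gram :: "(nat \<Rightarrow> 'a) \<Rightarrow> (nat \<Rightarrow> 'a) \<Rightarrow> (nat \<Rightarrow> 'a) \<Rightarrow> (nat \<Rightarrow> 'a) \<Rightarrow> (nat \<Rightarrow> 'a) \<Rightarrow> (nat \<Rightarrow> 'a) \<Rightarrow> 'a" where
  "gram f g h u v w = omega f u * (omega g v * omega h w + omega g w * omega h v)
     + omega f v * (omega g u * omega h w + omega g w * omega h u)
     + omega f w * (omega g u * omega h v + omega g v * omega h u)"

text \<open>The shift \<open>sw\<close> turns \<open>omega\<close> into \<open>dot\<close>, so
  Cauchy-Binet applies. By \<open>contraction\<close> the twelve terms with a pair {i, i+3} agree
  two by two and cancel; the others match each choice of one index per pair with the complementary
  choice.\<close>

lemma gram_isotropic:
  assumes "omega f g = 0" "omega f h = 0" "omega g h = 0" "omega u v = 0" "omega u w = 0" "omega v w = 0"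
  shows "gram f g h u v w =
     minor f g h 0 1 2 * minor u v w 3 4 5 + minor f g h 0 1 5 * minor u v w 2 3 4
   + minor f g h 0 2 4 * minor u v w 1 3 5 + minor f g h 1 2 3 * minor u v w 0 4 5
   + minor f g h 0 4 5 * minor u v w 1 2 3 + minor f g h 1 3 5 * minor u v w 0 2 4
   + minor f g h 2 3 4 * minor u v w 0 1 5 + minor f g h 3 4 5 * minor u v w 0 1 2"
proof -
  define sw where "sw u i = (if i < 3 then u (i + 3) else u (i - 3 :: nat))" for u :: "nat \<Rightarrow> 'a" and i
  have o: "omega f u = dot f (sw u)" for f u
    unfolding omega_def dot_def sw_def by (simp add: add_ac)
  have m: "minor (sw u) (sw v) (sw w) i j k = minor u v w (if i < 3 then i + 3 else i - 3)
    (if j < 3 then j + 3 else j - 3) (if k < 3 then k + 3 else k - 3)" for i j k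
    unfolding minor_def sw_def by simp
  note c = contraction[OF assms(1-3), simplified] contraction[OF assms(4-6), simplified]
  show ?thesis unfolding gram_def o cauchy_binet m
    by (simp add: minor_sort c two_simps add_ac)
qed

end

section \<open>Isotropic triples in the spin module\<close>

lemmas assoc_mult_square_mat = assoc_mult_mat[where n\<^sub>1 = n and n\<^sub>2 = n and n\<^sub>3 = n and n\<^sub>4 = n for n]

lemmas mult6_assoc = assoc_mult_square_mat[where n = 6]

lemmas mult6_carrier = mult_carrier_mat[where nr = 6 and n = 6 and nc = 6]

text \<open>A singular square matrix has a singular transpose. This turns a vector orthogonal to all
  rows into a dependency among the rows, the form in which both dimension counts are used.\<close>

lemma left_dependency:
  fixes M :: "nat \<Rightarrow> nat \<Rightarrow> 'a::field"
  assumes "\<And>i. i < n \<Longrightarrow> (\<Sum>j<n. M i j * t j) = 0" and "j0 < n" and "t j0 \<noteq> 0"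
  obtains c where "\<exists>i<n. c i \<noteq> 0" "\<And>j. j < n \<Longrightarrow> (\<Sum>i<n. c i * M i j) = 0"
proof -
  define A where "A = mat n n (\<lambda>(i,j). M i j)"
  have A: "A \<in> carrier_mat n n" by (simp add: A_def)
  have "A *\<^sub>v vec n t = 0\<^sub>v n"
    by (intro eq_vecI) (simp_all add: A_def scalar_prod_def assms(1) lessThan_atLeast0[symmetric])
  moreover have "vec n t \<noteq> 0\<^sub>v n" using assms(2,3) by (metis index_vec index_zero_vec(1))
  ultimately have "det A = 0" using det_0_iff_vec_prod_zero_field[OF A] by (metis vec_carrier)
  hence "det (A\<^sup>T) = 0" by (simp add: det_transpose[OF A])
  then obtain v where v: "v \<in> carrier_vec n" "v \<noteq> 0\<^sub>v n" "A\<^sup>T *\<^sub>v v = 0\<^sub>v n"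
    using det_0_iff_vec_prod_zero_field[of "A\<^sup>T" n] A by auto
  show thesis
  proof (rule that[of "\<lambda>i. v $ i"])
    show "\<exists>i<n. v $ i \<noteq> 0" using v(1,2) by (metis carrier_vecD eq_vecI index_zero_vec)
    fix j assume j: "j < n"
    have "(A\<^sup>T *\<^sub>v v) $ j = (\<Sum>i<n. M i j * v $ i)"
      using j v(1) by (auto simp: A_def scalar_prod_def lessThan_atLeast0 intro!: sum.cong)
    thus "(\<Sum>i<n. v $ i * M i j) = 0" using v(3) j by (simp add: mult.commute)
  qed
qed

context char_two begin

abbreviation om :: "'a vec \<Rightarrow> 'a vec \<Rightarrow> 'a" where "om u v \<equiv> omega (vec_index u) (vec_index v)"

text \<open>
  An isotropic triple \<open>(f, g, h)\<close> represents the class of \<open>f \<and> g \<and> h\<close> in the spin module; \<open>pairing\<close>,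
  the determinant of the Gram matrix, is the invariant bilinear form of that module. In \<open>lagr k\<close>
  bit \<open>i\<close> of \<open>k\<close> chooses between the unit vectors \<open>i\<close> and \<open>i + 3\<close>, so the classes of
  \<open>lagr 0, \<dots>, lagr 7\<close> are a basis in which \<open>lagr k\<close> is paired with \<open>lagr (7 - k)\<close> only.
\<close>

definition isotropic :: "'a vec \<times> 'a vec \<times> 'a vec \<Rightarrow> bool" where
  "isotropic F \<longleftrightarrow> (case F of (f,g,h) \<Rightarrow> f \<in> carrier_vec 6 \<and> g \<in> carrier_vec 6 \<and> h \<in> carrier_vec 6 \<and>
     om f g = 0 \<and> om f h = 0 \<and> om g h = 0)"

definition pairing :: "'a vec \<times> 'a vec \<times> 'a vec \<Rightarrow> 'a vec \<times> 'a vec \<times> 'a vec \<Rightarrow> 'a" where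
  "pairing F P = (case F of (f,g,h) \<Rightarrow> case P of (u,v,w) \<Rightarrow>
    gram (vec_index f) (vec_index g) (vec_index h) (vec_index u) (vec_index v) (vec_index w))"

definition act_triple :: "'a mat \<Rightarrow> 'a vec \<times> 'a vec \<times> 'a vec \<Rightarrow> 'a vec \<times> 'a vec \<times> 'a vec" where
  "act_triple A F = (case F of (f,g,h) \<Rightarrow> (A *\<^sub>v f, A *\<^sub>v g, A *\<^sub>v h))"

definition symplectic :: "'a mat \<Rightarrow> bool" where
  "symplectic A \<longleftrightarrow> A \<in> carrier_mat 6 6 \<and> (\<forall>u\<in>carrier_vec 6. \<forall>v\<in>carrier_vec 6. om (A *\<^sub>v u) (A *\<^sub>v v) = om u v)"

definition lagr :: "nat \<Rightarrow> 'a vec \<times> 'a vec \<times> 'a vec" where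
  "lagr k = (unit_vec 6 (if even k then 0 else 3), unit_vec 6 (if even (k div 2) then 1 else 4),
     unit_vec 6 (if k < 4 then 2 else 5))"

lemma isotropic_act: "symplectic A \<Longrightarrow> isotropic F \<Longrightarrow> isotropic (act_triple A F)"
  by (auto simp: isotropic_def act_triple_def symplectic_def split: prod.splits)

lemma pairing_act: "symplectic A \<Longrightarrow> isotropic F \<Longrightarrow> isotropic P \<Longrightarrow> pairing (act_triple A F) (act_triple A P) = pairing F P"
  by (auto simp: isotropic_def act_triple_def symplectic_def pairing_def gram_def split: prod.splits)

lemma act_triple_mult: "A \<in> carrier_mat 6 6 \<Longrightarrow> B \<in> carrier_mat 6 6 \<Longrightarrow> isotropic F \<Longrightarrow> act_triple (A * B) F = act_triple A (act_triple B F)"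
  by (auto simp: isotropic_def act_triple_def split: prod.splits)

lemma act_triple_one: "isotropic F \<Longrightarrow> act_triple (1\<^sub>m 6) F = F"
  by (auto simp: isotropic_def act_triple_def split: prod.splits)

lemma isotropic_lagr: "k < 8 \<Longrightarrow> isotropic (lagr k)"
  by (auto simp: isotropic_def lagr_def omega_def)

lemma sum8: "(\<Sum>k<8. t k) = t 0 + t 1 + t 2 + t 3 + t 4 + t 5 + t 6 + t (7::nat)" for t :: "nat \<Rightarrow> 'b::comm_monoid_add"
  by (simp add: eval_nat_numeral add.assoc)

lemma omega_unit:
  "omega f (vec_index (unit_vec 6 0)) = f 3" "omega f (vec_index (unit_vec 6 1)) = f 4"
  "omega f (vec_index (unit_vec 6 2)) = f 5" "omega f (vec_index (unit_vec 6 3)) = f 0"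
  "omega f (vec_index (unit_vec 6 4)) = f 1" "omega f (vec_index (unit_vec 6 5)) = f 2"
  by (simp_all add: omega_def)

lemma lagr_simps:
  "lagr 0 = (unit_vec 6 0, unit_vec 6 1, unit_vec 6 2)" "lagr 1 = (unit_vec 6 3, unit_vec 6 1, unit_vec 6 2)"
  "lagr 2 = (unit_vec 6 0, unit_vec 6 4, unit_vec 6 2)" "lagr 3 = (unit_vec 6 3, unit_vec 6 4, unit_vec 6 2)"
  "lagr 4 = (unit_vec 6 0, unit_vec 6 1, unit_vec 6 5)" "lagr 5 = (unit_vec 6 3, unit_vec 6 1, unit_vec 6 5)"
  "lagr 6 = (unit_vec 6 0, unit_vec 6 4, unit_vec 6 5)" "lagr 7 = (unit_vec 6 3, unit_vec 6 4, unit_vec 6 5)"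
  by (simp_all add: lagr_def)

lemma pairing_lagr:
  "pairing (f,g,h) (lagr 0) = minor (vec_index f) (vec_index g) (vec_index h) 3 4 5"
  "pairing (f,g,h) (lagr 1) = minor (vec_index f) (vec_index g) (vec_index h) 0 4 5"
  "pairing (f,g,h) (lagr 2) = minor (vec_index f) (vec_index g) (vec_index h) 1 3 5"
  "pairing (f,g,h) (lagr 3) = minor (vec_index f) (vec_index g) (vec_index h) 0 1 5"
  "pairing (f,g,h) (lagr 4) = minor (vec_index f) (vec_index g) (vec_index h) 2 3 4"
  "pairing (f,g,h) (lagr 5) = minor (vec_index f) (vec_index g) (vec_index h) 0 2 4"
  "pairing (f,g,h) (lagr 6) = minor (vec_index f) (vec_index g) (vec_index h) 1 2 3"
  "pairing (f,g,h) (lagr 7) = minor (vec_index f) (vec_index g) (vec_index h) 0 1 2"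
  unfolding pairing_def lagr_simps gram_def prod.case omega_unit minor_def by (simp_all add: algebra_simps)

text \<open>Two isotropic triples see each other only through the eight minors of
  \<open>gram_isotropic\<close>, and these minors are the pairings with the
  \<open>lagr k\<close>.\<close>

lemma pairing_expand:
  assumes "isotropic F" "isotropic P"
  shows "pairing F P = (\<Sum>k<8. pairing F (lagr k) * pairing P (lagr (7 - k)))"
proof -
  obtain f g h u v w where F: "F = (f,g,h)" and P: "P = (u,v,w)" by (metis prod_cases3)
  have d: "7 - 0 = (7::nat)" "7 - 1 = (6::nat)" "7 - 2 = (5::nat)" "7 - 3 = (4::nat)"
    "7 - 4 = (3::nat)" "7 - 5 = (2::nat)" "7 - 6 = (1::nat)" "7 - 7 = (0::nat)" by simp_all
  have o: "om f g = 0" "om f h = 0" "om g h = 0" "om u v = 0" "om u w = 0" "om v w = 0"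
    using assms by (simp_all add: F P isotropic_def)
  have "pairing F P = gram (vec_index f) (vec_index g) (vec_index h) (vec_index u) (vec_index v) (vec_index w)"
    by (simp add: pairing_def F P)
  also have "\<dots> = (\<Sum>k<8. pairing F (lagr k) * pairing P (lagr (7 - k)))"
    unfolding gram_isotropic[OF o] sum8 d F P pairing_lagr by (simp only: ac_simps)
  finally show ?thesis .
qed

lemma omega_sym: "omega u v = omega v u"
  by (simp add: omega_def mult.commute add_ac)

lemma gram_sym: "gram f g h u v w = gram u v w f g h"
  unfolding gram_def omega_sym[of u] omega_sym[of v] omega_sym[of w]
  by (simp add: algebra_simps)

lemma pairing_sym: "pairing F P = pairing P F"
  unfolding pairing_def by (auto simp: gram_sym split: prod.splits)


lemma pairing_adjoint:
  assumes A: "symplectic A" "symplectic B" and AB: "A * B = 1\<^sub>m 6" and "isotropic F" "isotropic P"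
  shows "pairing (act_triple A F) P = pairing F (act_triple B P)"
proof -
  have "pairing (act_triple A F) (act_triple A (act_triple B P)) = pairing F (act_triple B P)"
    using assms by (intro pairing_act isotropic_act) auto
  moreover have "act_triple A (act_triple B P) = P"
    using assms act_triple_mult[of A B P] act_triple_one[of P] by (simp add: symplectic_def)
  ultimately show ?thesis by simp
qed

text \<open>
  The classes of the four \<open>F k\<close> are fixed by \<open>Y\<close>; together with their images under \<open>X\<close> they are eight
  vectors of an 8-dimensional space. If they are dependent, some combination of them is fixed by \<open>X\<close>
  and \<open>Y\<close>. Otherwise they span, and as \<open>act_triple X (lagr 4) - lagr 4\<close> is orthogonal to all of
  them, \<open>lagr 4\<close> is fixed by \<open>X\<close>.
\<close>

lemma spin_fixed:
  fixes X Y Z :: "'a mat" and F :: "nat \<Rightarrow> 'a vec \<times> 'a vec \<times> 'a vec" and z :: "nat \<Rightarrow> 'a"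
  assumes X: "symplectic X" and XX: "X * X = 1\<^sub>m 6"
    and Y: "symplectic Y" and Z: "symplectic Z" and YXZ: "Y = X * Z"
    and F: "\<And>k. k < 4 \<Longrightarrow> isotropic (F k)"
    and FY: "\<And>k P. k < 4 \<Longrightarrow> pairing (act_triple Y (F k)) P = pairing (F k) P"
    and dual: "\<And>k. k < 4 \<Longrightarrow> pairing (F k) (F (3 - k)) \<noteq> 0"
      "\<And>k l. k < 4 \<Longrightarrow> l < 4 \<Longrightarrow> l \<noteq> 3 - k \<Longrightarrow> pairing (F k) (F l) = 0"
    and Zlagr: "\<And>k P. k < 8 \<Longrightarrow> pairing (act_triple Z (lagr k)) P = z k * pairing (lagr k) P"
    and z: "z 3 = 1" "z 4 = 1" "\<And>k. k < 8 \<Longrightarrow> k \<noteq> 3 \<Longrightarrow> k \<noteq> 4 \<Longrightarrow> z k \<noteq> 1"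
  shows "\<exists>a b. (a \<noteq> 0 \<or> b \<noteq> 0) \<and>
    (\<forall>P. isotropic P \<longrightarrow> a * pairing (lagr 4) (act_triple X P) + b * pairing (lagr 3) (act_triple X P) = a * pairing (lagr 4) P + b * pairing (lagr 3) P)"
proof -
  have X6: "X \<in> carrier_mat 6 6" and Y6: "Y \<in> carrier_mat 6 6" and Z6: "Z \<in> carrier_mat 6 6"
    using X Y Z by (auto simp: symplectic_def)
  have ZXY: "Z = X * Y" using XX X6 Z6 unfolding YXZ by (metis assoc_mult_mat left_mult_one_mat)
  have FY': "pairing (F k) (act_triple Y P) = pairing (F k) P" if "k < 4" "isotropic P" for k P
  proof -
    have "pairing (F k) (act_triple Y P) = pairing (act_triple Y (F k)) (act_triple Y P)" using FY[OF that(1)] by simp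
    also have "\<dots> = pairing (F k) P" using Y that F by (simp add: pairing_act)
    finally show ?thesis .
  qed
  have lin: "(\<Sum>k<4. c k * pairing (F k) P) = (\<Sum>m<8. (\<Sum>k<4. c k * pairing (F k) (lagr m)) * pairing P (lagr (7 - m)))"
    if "isotropic P" for c P
  proof -
    have "(\<Sum>k<4. c k * pairing (F k) P) = (\<Sum>k<4. \<Sum>m<8. c k * pairing (F k) (lagr m) * pairing P (lagr (7 - m)))"
      using pairing_expand[OF F that] by (intro sum.cong) (simp_all add: sum_distrib_left mult.assoc)
    also have "\<dots> = (\<Sum>m<8. \<Sum>k<4. c k * pairing (F k) (lagr m) * pairing P (lagr (7 - m)))" by (rule sum.swap)
    finally show ?thesis by (simp add: sum_distrib_right)
  qed
  define \<phi> where "\<phi> c P = (\<Sum>k<4. c k * pairing (F k) P)" for c P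
  \<comment> \<open>A combination fixed by \<open>X\<close> is fixed by \<open>Z = X * Y\<close>
    too, so it vanishes at every \<open>lagr k\<close> whose eigenvalue under \<open>Z\<close> is
    not 1. The values at \<open>lagr 3\<close> and \<open>lagr 4\<close> remain, and they appear
    crossed over because \<open>lagr k\<close> is dual to \<open>lagr (7 - k)\<close>.\<close>
  have fixed: ?thesis if c: "\<exists>k<4. c k \<noteq> 0" and inv: "\<And>P. isotropic P \<Longrightarrow> \<phi> c (act_triple X P) = \<phi> c P" for c
  proof -
    have phiY: "\<phi> c (act_triple Y P) = \<phi> c P" if "isotropic P" for P
      unfolding \<phi>_def using FY'[OF _ that] by simp
    have phiZ: "\<phi> c (act_triple Z P) = \<phi> c P" if "isotropic P" for P
      using that inv[of "act_triple Y P"] phiY[OF that] act_triple_mult[OF X6 Y6 that] Y isotropic_act by (simp add: ZXY)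
    have zero: "\<phi> c (lagr k) = 0" if "k < 8" "k \<noteq> 3" "k \<noteq> 4" for k
    proof -
      have "\<phi> c (act_triple Z (lagr k)) = z k * \<phi> c (lagr k)"
        unfolding \<phi>_def pairing_sym[of "F _"] Zlagr[OF that(1)] by (simp add: sum_distrib_left mult.left_commute)
      hence "z k * \<phi> c (lagr k) = \<phi> c (lagr k)" using phiZ[OF isotropic_lagr[OF that(1)]] by simp
      thus ?thesis using z(3)[OF that] by (metis mult_cancel_right1)
    qed
    have *: "\<phi> c P = \<phi> c (lagr 3) * pairing (lagr 4) P + \<phi> c (lagr 4) * pairing (lagr 3) P" if "isotropic P" for P
      using lin[OF that, of c] unfolding \<phi>_def[symmetric] sum8 by (simp add: zero pairing_sym[of P])
    obtain k where k: "k < 4" "c k \<noteq> 0" using c by auto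
    \<comment> \<open>Pairing with the dual triple isolates \<open>c k\<close>, so the functional is
      not zero.\<close>
    have "\<phi> c (F (3 - k)) = (\<Sum>l<4. if l = k then c k * pairing (F k) (F (3 - k)) else 0)"
      unfolding \<phi>_def by (intro sum.cong) (use dual(2) k in auto)
    also have "\<dots> \<noteq> 0" using k dual(1)[of k] by simp
    finally have "\<phi> c (lagr 3) \<noteq> 0 \<or> \<phi> c (lagr 4) \<noteq> 0" using *[OF F[of "3 - k"]] by auto
    moreover have "\<phi> c (lagr 3) * pairing (lagr 4) (act_triple X P) + \<phi> c (lagr 4) * pairing (lagr 3) (act_triple X P) =
      \<phi> c (lagr 3) * pairing (lagr 4) P + \<phi> c (lagr 4) * pairing (lagr 3) P" if "isotropic P" for P
      using inv[OF that] *[OF that] *[OF isotropic_act[OF X that]] by simp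
    ultimately show ?thesis by blast
  qed
  \<comment> \<open>Rows 0 to 3 hold the coordinates of the \<open>F i\<close>, rows 4 to 7 those of
    their images under \<open>X\<close>. The vector \<open>t\<close> holds the coordinates of the
    difference between \<open>lagr 4\<close> and its image under \<open>X\<close>, reversed to match
    the duality.\<close>
  define M where "M i j = (if i < 4 then pairing (F i) (lagr j) else pairing (act_triple X (F (i - 4))) (lagr j))" for i j :: nat
  define t where "t j = pairing (act_triple X (lagr 4)) (lagr (7 - j)) + pairing (lagr 4) (lagr (7 - j))" for j
  have isoX: "isotropic (act_triple X P)" if "isotropic P" for P using X that by (rule isotropic_act)
  have adjX: "pairing (act_triple X P) Q = pairing P (act_triple X Q)" if "isotropic P" "isotropic Q" for P Q
    using pairing_adjoint[OF X X XX that] .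
  have XX': "act_triple X (act_triple X P) = P" if "isotropic P" for P using act_triple_mult[OF X6 X6 that] act_triple_one[OF that] XX by simp
  have l4: "isotropic (lagr 4)" by (rule isotropic_lagr) simp
  show ?thesis
  proof (cases "\<exists>j<8. t j \<noteq> 0")
    case False
    have "pairing (act_triple X (lagr 4)) (lagr j) = pairing (lagr 4) (lagr j)" if "j < 8" for j
    proof -
      have "t (7 - j) = 0" using False that by simp
      moreover have "7 - (7 - j) = j" using that by simp
      ultimately have "pairing (act_triple X (lagr 4)) (lagr j) + pairing (lagr 4) (lagr j) = 0" unfolding t_def by simp
      thus ?thesis by (metis add.right_neutral add_self_left)
    qed
    hence "pairing (act_triple X (lagr 4)) P = pairing (lagr 4) P" if "isotropic P" for P
      unfolding pairing_expand[OF isoX[OF l4] that] pairing_expand[OF l4 that] by (intro sum.cong) auto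
    hence "pairing (lagr 4) (act_triple X P) = pairing (lagr 4) P" if "isotropic P" for P using adjX[OF l4 that] that by simp
    thus ?thesis by (intro exI[of _ 1] exI[of _ 0]) simp
  next
    case True
    then obtain j0 where j0: "j0 < 8" "t j0 \<noteq> 0" by auto
    \<comment> \<open>Write \<open>lagr 4\<close> as its own image under \<open>Z = X * Y\<close>:
      the factor \<open>X\<close> cancels by invariance of the pairing, and the factor
      \<open>Y\<close> because the class of \<open>F k\<close> is fixed by it.\<close>
    have e: "pairing (act_triple X (lagr 4)) (F k) = pairing (lagr 4) (F k)" if "k < 4" for k
    proof -
      have "pairing (act_triple X (lagr 4)) (F k) = pairing (lagr 4) (act_triple X (F k))" using adjX[OF l4 F[OF that]] .
      also have "\<dots> = pairing (act_triple Z (lagr 4)) (act_triple X (F k))" using Zlagr[of 4] z(2) by simp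
      also have "\<dots> = pairing (act_triple X (act_triple Y (lagr 4))) (act_triple X (F k))"
        unfolding ZXY using act_triple_mult[OF X6 Y6 l4] by simp
      also have "\<dots> = pairing (act_triple Y (lagr 4)) (F k)"
        using pairing_act[OF X] F[OF that] isotropic_act[OF Y l4] by simp
      also have "\<dots> = pairing (act_triple Y (lagr 4)) (act_triple Y (F k))"
        using FY[OF that, of "act_triple Y (lagr 4)"] by (simp add: pairing_sym)
      also have "\<dots> = pairing (lagr 4) (F k)" using pairing_act[OF Y l4 F[OF that]] .
      finally show ?thesis .
    qed
    have s: "(\<Sum>j<8. pairing P (lagr j) * t j) = pairing (act_triple X (lagr 4)) P + pairing (lagr 4) P" if "isotropic P" for P
    proof -
      have "(\<Sum>j<8. pairing P (lagr j) * t j) = pairing P (act_triple X (lagr 4)) + pairing P (lagr 4)"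
        unfolding pairing_expand[OF that isoX[OF l4]] pairing_expand[OF that l4] t_def
        by (simp add: distrib_left sum.distrib)
      thus ?thesis by (simp add: pairing_sym)
    qed
    have Mt: "(\<Sum>j<8. M i j * t j) = 0" if "i < 8" for i
    proof (cases "i < 4")
      case True
      thus ?thesis using s[OF F[OF True]] e[OF True] by (simp add: M_def add_self)
    next
      case False
      hence i: "i - 4 < 4" using that by simp
      have "pairing (act_triple X (lagr 4)) (act_triple X (F (i - 4))) = pairing (lagr 4) (F (i - 4))"
        using pairing_act[OF X l4 F[OF i]] .
      moreover have "pairing (lagr 4) (act_triple X (F (i - 4))) = pairing (lagr 4) (F (i - 4))"
        using adjX[OF l4 F[OF i]] e[OF i] by simp
      ultimately show ?thesis using s[OF isoX[OF F[OF i]]] False by (simp add: M_def add_self)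
    qed
    obtain c where c: "\<exists>i<8. c i \<noteq> 0" and c0: "\<And>j. j < 8 \<Longrightarrow> (\<Sum>i<8. c i * M i j) = 0"
      using left_dependency[where M = M and t = t and n = 8, OF Mt j0] by blast
    define c' where "c' k = c (k + 4)" for k
    have split8: "(\<Sum>i<8. u i) = (\<Sum>i<4. u i) + (\<Sum>i<4. u (i + 4))" for u :: "nat \<Rightarrow> 'a"
      by (simp add: eval_nat_numeral add.assoc)
    have rel: "\<phi> c P + \<phi> c' (act_triple X P) = 0" if P: "isotropic P" for P
    proof -
      have "\<phi> c P + \<phi> c' (act_triple X P) = (\<Sum>k<4. c k * pairing (F k) P) + (\<Sum>k<4. c' k * pairing (act_triple X (F k)) P)"
        unfolding \<phi>_def using adjX[OF F P] by simp
      also have "\<dots> = (\<Sum>m<8. ((\<Sum>k<4. c k * pairing (F k) (lagr m)) + (\<Sum>k<4. c' k * pairing (act_triple X (F k)) (lagr m))) * pairing P (lagr (7 - m)))"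
      proof -
        have "(\<Sum>k<4. c' k * pairing (act_triple X (F k)) P) = (\<Sum>k<4. \<Sum>m<8. c' k * pairing (act_triple X (F k)) (lagr m) * pairing P (lagr (7 - m)))"
          using pairing_expand[OF isoX[OF F] P] by (intro sum.cong) (simp_all add: sum_distrib_left mult.assoc)
        also have "\<dots> = (\<Sum>m<8. \<Sum>k<4. c' k * pairing (act_triple X (F k)) (lagr m) * pairing P (lagr (7 - m)))" by (rule sum.swap)
        finally show ?thesis unfolding lin[OF P] distrib_right sum.distrib by (simp add: sum_distrib_right)
      qed
      also have "\<dots> = (\<Sum>m<8. (\<Sum>i<8. c i * M i m) * pairing P (lagr (7 - m)))"
        unfolding split8[of "\<lambda>i. c i * M i _"] by (simp add: M_def c'_def)
      finally show ?thesis using c0 by simp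
    qed
    \<comment> \<open>Thus \<open>X\<close> exchanges the functionals of \<open>c\<close> and
      \<open>c'\<close>, and their sum is fixed. If all coefficients of the sum vanish, then
      \<open>c\<close> and \<open>c'\<close> agree and the functional of \<open>c\<close> is fixed
      by itself.\<close>
    have rel': "\<phi> c' P = \<phi> c (act_triple X P)" if "isotropic P" for P
      using rel[OF isoX[OF that]] XX'[OF that] by (metis add.right_neutral add_self_left)
    have sum: "\<phi> (\<lambda>k. c k + c' k) P = \<phi> c P + \<phi> c' P" for P
      by (simp add: \<phi>_def distrib_right sum.distrib)
    show ?thesis
    proof (cases "\<exists>k<4. c k + c' k \<noteq> 0")
      case True
      show ?thesis
      proof (rule fixed[OF True])
        fix P assume P: "isotropic P"
        show "\<phi> (\<lambda>k. c k + c' k) (act_triple X P) = \<phi> (\<lambda>k. c k + c' k) P"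
          unfolding sum rel'[OF P] rel'[OF isoX[OF P]] XX'[OF P] by (rule add.commute)
      qed
    next
      case False
      hence cc: "c k = c' k" if "k < 4" for k using that by (metis add.right_neutral add_self_left)
      have "\<phi> c' P = \<phi> c P" for P unfolding \<phi>_def using cc by simp
      moreover have "\<exists>k<4. c k \<noteq> 0"
      proof -
        obtain i where i: "i < 8" "c i \<noteq> 0" using c by auto
        show ?thesis
        proof (cases "i < 4")
          case False
          hence "c (i - 4) = c i" using cc[of "i - 4"] i by (simp add: c'_def)
          thus ?thesis using i False by (intro exI[of _ "i - 4"]) auto
        qed (use i in auto)
      qed
      ultimately show ?thesis using fixed[of c] rel' by metis
    qed
  qed
qed

end

section \<open>Irreducible pairs\<close>

text \<open>\<open>n\<close> independent rows of length \<open>n + 1\<close> are annihilated by a line only.\<close>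

lemma annihilator_pair:
  fixes M :: "nat \<Rightarrow> nat \<Rightarrow> 'a::field"
  assumes g: "\<And>i. i < n \<Longrightarrow> (\<Sum>j<Suc n. M i j * g j) = 0"
    and h: "\<And>i. i < n \<Longrightarrow> (\<Sum>j<Suc n. M i j * h j) = 0"
  obtains (rows) c where "\<exists>i<n. c i \<noteq> 0" "\<And>j. j < Suc n \<Longrightarrow> (\<Sum>i<n. c i * M i j) = 0"
  | (columns) a b where "a \<noteq> 0 \<or> b \<noteq> 0" "\<And>j. j < Suc n \<Longrightarrow> a * g j + b * h j = 0"
proof (cases "\<exists>k<Suc n. g k \<noteq> 0")
  case False
  thus ?thesis by (intro columns[of 1 0]) auto
next
  case True
  then obtain k where k: "k < Suc n" "g k \<noteq> 0" by auto
  define \<mu> where "\<mu> = h k / g k"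
  define t where "t j = h j - \<mu> * g j" for j
  show ?thesis
  proof (cases "\<exists>j<Suc n. t j \<noteq> 0")
    case False
    thus ?thesis by (intro columns[of "-\<mu>" 1]) (auto simp: t_def)
  next
    case True
    then obtain j0 where j0: "j0 < Suc n" "t j0 \<noteq> 0" by auto
    \<comment> \<open>The unit row at \<open>k\<close> makes the system square. It annihilates
      \<open>t\<close>, since \<open>\<mu>\<close> was chosen to give \<open>t k = 0\<close>, but it
      does not annihilate \<open>g\<close>.\<close>
    define M' where "M' i j = (if i < n then M i j else if j = k then 1 else 0)" for i j
    have M't: "(\<Sum>j<Suc n. M' i j * t j) = 0" if "i < Suc n" for i
    proof (cases "i < n")
      case True
      have "(\<Sum>j<Suc n. M i j * t j) = (\<Sum>j<Suc n. M i j * h j) - \<mu> * (\<Sum>j<Suc n. M i j * g j)"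
        unfolding t_def right_diff_distrib sum_subtractf by (simp add: sum_distrib_left mult.left_commute algebra_simps)
      thus ?thesis using True g h by (simp add: M'_def)
    next
      case False
      have "(\<Sum>j<Suc n. M' i j * t j) = (\<Sum>j<Suc n. if j = k then t k else 0)"
        using False by (intro sum.cong) (auto simp: M'_def)
      also have "\<dots> = t k" using k(1) by (subst sum.delta) auto
      also have "\<dots> = 0" using k(2) by (simp add: t_def \<mu>_def)
      finally show ?thesis .
    qed
    obtain c where c: "\<exists>i<Suc n. c i \<noteq> 0" and c0: "\<And>j. j < Suc n \<Longrightarrow> (\<Sum>i<Suc n. c i * M' i j) = 0"
      using left_dependency[where M = M' and t = t and n = "Suc n", OF M't j0] by blast
    \<comment> \<open>Testing the dependency against \<open>g\<close>, which the first
      \<open>n\<close> rows annihilate, leaves \<open>c n * g k\<close>; so the added row does not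
      take part.\<close>
    have "0 = (\<Sum>j<Suc n. (\<Sum>i<Suc n. c i * M' i j) * g j)" using c0 by simp
    also have "\<dots> = (\<Sum>i<Suc n. c i * (\<Sum>j<Suc n. M' i j * g j))"
      unfolding sum_distrib_left sum_distrib_right mult.assoc by (rule sum.swap)
    also have "\<dots> = c n * (\<Sum>j<Suc n. M' n j * g j)"
    proof -
      have "(\<Sum>i<n. c i * (\<Sum>j<Suc n. M' i j * g j)) = 0"
        using g by (intro sum.neutral) (auto simp: M'_def)
      thus ?thesis by simp
    qed
    also have "(\<Sum>j<Suc n. M' n j * g j) = (\<Sum>j<Suc n. if j = k then g k else 0)"
      by (intro sum.cong) (auto simp: M'_def)
    also have "\<dots> = g k" using k(1) by (subst sum.delta) auto
    finally have cn: "c n = 0" using k(2) by simp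
    show ?thesis
    proof (rule rows[of c])
      show "\<exists>i<n. c i \<noteq> 0" using c cn less_Suc_eq by metis
      fix j assume "j < Suc n"
      from c0[OF this] cn show "(\<Sum>i<n. c i * M i j) = 0" by (simp add: M'_def)
    qed
  qed
qed

lemma zero_mat_of_mult_vec:
  fixes K :: "'a::comm_ring_1 mat"
  assumes "K \<in> carrier_mat m n" and "\<And>u. u \<in> carrier_vec n \<Longrightarrow> K *\<^sub>v u = 0\<^sub>v m"
  shows "K = 0\<^sub>m m n"
proof (rule eq_matI)
  fix i j assume "i < dim_row (0\<^sub>m m n :: 'a mat)" "j < dim_col (0\<^sub>m m n :: 'a mat)"
  hence ij: "i < m" "j < n" by auto
  have "K $$ (i,j) = (K *\<^sub>v unit_vec n j) $ i" using assms(1) ij by (auto simp: scalar_prod_right_unit)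
  thus "K $$ (i,j) = 0\<^sub>m m n $$ (i,j)" using assms(2)[of "unit_vec n j"] ij by simp
qed (use assms(1) in auto)

text \<open>Only the involution and the product of the triple occur: the product is the matrix that
  becomes diagonal, and elementary closure conditions are easy to check for images, kernels and
  coordinate subspaces.\<close>

definition irreducible_pair :: "'a::field mat \<Rightarrow> 'a mat \<Rightarrow> bool" where
  "irreducible_pair X Z \<longleftrightarrow> (\<forall>W \<subseteq> carrier_vec 6. 0\<^sub>v 6 \<in> W \<longrightarrow> (\<forall>u\<in>W. \<forall>v\<in>W. u + v \<in> W) \<longrightarrow>
     (\<forall>c. \<forall>u\<in>W. c \<cdot>\<^sub>v u \<in> W) \<longrightarrow> (\<forall>u\<in>W. X *\<^sub>v u \<in> W \<and> Z *\<^sub>v u \<in> W) \<longrightarrow> W = {0\<^sub>v 6} \<or> W = carrier_vec 6)"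

text \<open>Schur's argument: the image of the nonzero intertwiner \<open>K\<close> is stable under
  \<open>X\<close> and \<open>Z\<close>, hence the whole space.\<close>

lemma irreducible_pair_image:
  assumes irr: "irreducible_pair X Z" and "X \<in> carrier_mat 6 6" "Z \<in> carrier_mat 6 6"
    and "X' \<in> carrier_mat 6 6" "Z' \<in> carrier_mat 6 6" and K: "K \<in> carrier_mat 6 6" "K \<noteq> 0\<^sub>m 6 6"
    and "X * K = K * X'" "Z * K = K * Z'" and v: "v \<in> carrier_vec 6"
  shows "\<exists>u\<in>carrier_vec 6. v = K *\<^sub>v u"
proof -
  define W where "W = (\<lambda>u. K *\<^sub>v u) ` carrier_vec 6"
  have XW: "X *\<^sub>v (K *\<^sub>v u) = K *\<^sub>v (X' *\<^sub>v u)" "Z *\<^sub>v (K *\<^sub>v u) = K *\<^sub>v (Z' *\<^sub>v u)" if "u \<in> carrier_vec 6" for u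
    using assms that by (metis assoc_mult_mat_vec)+
  have "W = {0\<^sub>v 6} \<or> W = carrier_vec 6"
  proof (rule irr[unfolded irreducible_pair_def, rule_format])
    show "W \<subseteq> carrier_vec 6" using K by (auto simp: W_def)
    show "0\<^sub>v 6 \<in> W" using K unfolding W_def by (intro image_eqI[of _ _ "0\<^sub>v 6"]) auto
    show "u + v \<in> W" if "u \<in> W" "v \<in> W" for u v
      using that K unfolding W_def by (auto simp: mult_add_distrib_mat_vec[symmetric])
    show "c \<cdot>\<^sub>v u \<in> W" if "u \<in> W" for c u
      using that K unfolding W_def by (auto simp: mult_mat_vec[symmetric])
    show "X *\<^sub>v u \<in> W \<and> Z *\<^sub>v u \<in> W" if "u \<in> W" for u
      using that assms(4,5) XW unfolding W_def by auto
  qed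
  moreover have "W \<noteq> {0\<^sub>v 6}"
  proof
    assume W: "W = {0\<^sub>v 6}"
    have "K *\<^sub>v u = 0\<^sub>v 6" if "u \<in> carrier_vec 6" for u using W that unfolding W_def by blast
    hence "K = 0\<^sub>m 6 6" using zero_mat_of_mult_vec[OF K(1)] by blast
    thus False using K(2) by simp
  qed
  ultimately have "v \<in> W" using v by simp
  thus ?thesis by (auto simp: W_def)
qed

text \<open>Schur's argument for kernels: the kernel of the nonzero intertwiner \<open>B\<close> is
  stable and proper.\<close>

lemma irreducible_pair_kernel:
  assumes irr: "irreducible_pair X Z" and "X \<in> carrier_mat 6 6" "Z \<in> carrier_mat 6 6"
    and "X' \<in> carrier_mat 6 6" "Z' \<in> carrier_mat 6 6" and B: "B \<in> carrier_mat 6 6" "B \<noteq> 0\<^sub>m 6 6"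
    and "B * X = X' * B" "B * Z = Z' * B" and v: "v \<in> carrier_vec 6" "B *\<^sub>v v = 0\<^sub>v 6"
  shows "v = 0\<^sub>v 6"
proof -
  define W where "W = {u \<in> carrier_vec 6. B *\<^sub>v u = 0\<^sub>v 6}"
  have XW: "B *\<^sub>v (X *\<^sub>v u) = X' *\<^sub>v (B *\<^sub>v u)" "B *\<^sub>v (Z *\<^sub>v u) = Z' *\<^sub>v (B *\<^sub>v u)" if "u \<in> carrier_vec 6" for u
    using assms that by (metis assoc_mult_mat_vec)+
  have "W = {0\<^sub>v 6} \<or> W = carrier_vec 6"
  proof (rule irr[unfolded irreducible_pair_def, rule_format])
    show "W \<subseteq> carrier_vec 6" by (auto simp: W_def)
    show "0\<^sub>v 6 \<in> W" using B unfolding W_def by auto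
    show "u + v \<in> W" if "u \<in> W" "v \<in> W" for u v
      using that B unfolding W_def by (auto simp: mult_add_distrib_mat_vec)
    show "c \<cdot>\<^sub>v u \<in> W" if "u \<in> W" for c u
      using that B unfolding W_def by (auto simp: mult_mat_vec)
    show "X *\<^sub>v u \<in> W \<and> Z *\<^sub>v u \<in> W" if "u \<in> W" for u
      using that assms XW unfolding W_def by auto
  qed
  moreover have "W \<noteq> carrier_vec 6"
  proof
    assume W: "W = carrier_vec 6"
    hence "B = 0\<^sub>m 6 6" using zero_mat_of_mult_vec[OF B(1)] unfolding W_def by blast
    thus False using B(2) by simp
  qed
  ultimately have "W = {0\<^sub>v 6}" by blast
  moreover have "v \<in> W" using v by (simp add: W_def)
  ultimately show ?thesis by blast
qed

section \<open>The invariant alternating form\<close>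

text \<open>One matrix in two roles: the normal form of the involution, which swaps three pairs of
  basis vectors, and the Gram matrix of \<open>omega\<close>.\<close>

definition J6 :: "'a::field mat" where
  "J6 = mat 6 6 (\<lambda>(i,j). if j = (i + 3) mod 6 then 1 else 0)"

text \<open>
  \<open>idx_x\<close> numbers the nine alternating matrices that are constant on the orbits of \<open>i \<mapsto> i + 3\<close>, and
  \<open>idx_y\<close> the five elementary ones at places \<open>(a, b)\<close> where the eigenvalues \<open>1, 1, w, w, w\<^sup>2, w\<^sup>2\<close>
  of \<open>y\<close> have product 1. The entry 14 marks a zero.
\<close>

definition idx_x :: "nat \<Rightarrow> nat \<Rightarrow> nat" where
  "idx_x a b = [[14,3,4,0,6,7], [3,14,5,6,1,8], [4,5,14,7,8,2],
    [0,6,7,14,3,4], [6,1,8,3,14,5], [7,8,2,4,5,14]] ! a ! b"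

definition idx_y :: "nat \<Rightarrow> nat \<Rightarrow> nat" where
  "idx_y a b = [[14,9,14,14,14,14], [9,14,14,14,14,14], [14,14,14,14,10,11],
    [14,14,14,14,12,13], [14,14,10,12,14,14], [14,14,11,13,14,14]] ! a ! b"

text \<open>\<open>idx_x\<close> takes the values 0 to 8 and \<open>idx_y\<close> the values 9 to 13
  besides the marker 14. So one coefficient sequence describes a form of each family, and a single
  index below 14 runs through both bases.\<close>

definition form_mat :: "(nat \<Rightarrow> nat \<Rightarrow> nat) \<Rightarrow> (nat \<Rightarrow> 'a::field) \<Rightarrow> 'a mat" where
  "form_mat idx c = mat 6 6 (\<lambda>(a,b). if idx a b < 14 then c (idx a b) else 0)"

definition pair15 :: "nat \<Rightarrow> nat \<times> nat" where
  "pair15 k = [(0,1),(0,2),(0,3),(0,4),(0,5),(1,2),(1,3),(1,4),(1,5),(2,3),(2,4),(2,5),(3,4),(3,5),(4,5)] ! k"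

lemma less6: "i < 6 \<longleftrightarrow> i = 0 \<or> i = 1 \<or> i = 2 \<or> i = 3 \<or> i = 4 \<or> i = (5::nat)" by auto

lemma sum6: "(\<Sum>i<6. t i) = t 0 + t 1 + t 2 + t 3 + t 4 + t (5::nat)" for t :: "nat \<Rightarrow> 'b::comm_monoid_add"
  by (simp add: eval_nat_numeral add.assoc)

lemma sum15: "(\<Sum>k<15. t k) = t 0 + t 1 + t 2 + t 3 + t 4 + t 5 + t 6 + t 7 + t 8 + t 9 + t 10
    + t 11 + t 12 + t 13 + t (14::nat)" for t :: "nat \<Rightarrow> 'b::comm_monoid_add"
  by (simp add: eval_nat_numeral add.assoc)

lemma pair15_simps:
  "pair15 0 = (0,1)" "pair15 1 = (0,2)" "pair15 2 = (0,3)" "pair15 3 = (0,4)" "pair15 4 = (0,5)"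
  "pair15 5 = (1,2)" "pair15 6 = (1,3)" "pair15 7 = (1,4)" "pair15 8 = (1,5)" "pair15 9 = (2,3)"
  "pair15 10 = (2,4)" "pair15 11 = (2,5)" "pair15 12 = (3,4)" "pair15 13 = (3,5)" "pair15 14 = (4,5)"
  by (simp_all add: pair15_def)

lemma pair15_cover:
  assumes "i < j" "j < 6" shows "\<exists>k<15. pair15 k = (i,j)"
proof -
  let ?L = "[(0,1),(0,2),(0,3),(0,4),(0,5),(1,2),(1,3),(1,4),(1,5),(2,3),(2,4),(2,5),(3,4),(3,5),(4,5)] :: (nat \<times> nat) list"
  have "i < 5" using assms by simp
  hence "i = 0 \<or> i = 1 \<or> i = 2 \<or> i = 3 \<or> i = 4" by auto
  hence "(i,j) \<in> set ?L" using assms unfolding less6 by (elim disjE) simp_all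
  then obtain k where "k < length ?L" "?L ! k = (i,j)" by (auto simp only: in_set_conv_nth)
  moreover have "length ?L = 15" by simp
  ultimately show ?thesis unfolding pair15_def by metis
qed

lemma congruence_index:
  fixes R :: "'a::comm_ring_1 mat"
  assumes "R \<in> carrier_mat 6 6" "N \<in> carrier_mat 6 6" "i < 6" "j < 6"
  shows "(R\<^sup>T * N * R) $$ (i,j) = (\<Sum>a<6. \<Sum>b<6. R $$ (a,i) * N $$ (a,b) * R $$ (b,j))"
proof -
  have "(R\<^sup>T * N * R) $$ (i,j) = (\<Sum>a<6. R $$ (a,i) * (\<Sum>b<6. N $$ (a,b) * R $$ (b,j)))"
    using assms by (simp add: scalar_prod_def lessThan_atLeast0)
  thus ?thesis by (simp add: sum_distrib_left mult.assoc)
qed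

lemma idx_x_props:
  assumes "a < 6" "b < 6"
  shows "idx_x a b = idx_x b a" "idx_x a a = 14" "idx_x ((a + 3) mod 6) ((b + 3) mod 6) = idx_x a b"
  using assms unfolding less6 idx_x_def by (elim disjE; simp)+

lemma idx_y_props:
  assumes "a < 6" "b < 6"
  shows "idx_y a b = idx_y b a" "idx_y a a = 14"
  using assms unfolding less6 idx_y_def by (elim disjE; simp)+

lemma idx_surj:
  assumes "r < 14"
  shows "(\<exists>a<6. \<exists>b<6. idx_x a b = r) \<or> (\<exists>a<6. \<exists>b<6. idx_y a b = r)"
proof -
  have "r = 0 \<or> r = 1 \<or> r = 2 \<or> r = 3 \<or> r = 4 \<or> r = 5 \<or> r = 6 \<or> r = 7 \<or> r = 8 \<or> r = 9 \<or> r = 10 \<or> r = 11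
    \<or> r = 12 \<or> r = 13" using assms by presburger
  moreover have "idx_x 0 3 = 0" "idx_x 1 4 = 1" "idx_x 2 5 = 2" "idx_x 0 1 = 3" "idx_x 0 2 = 4" "idx_x 1 2 = 5"
    "idx_x 0 4 = 6" "idx_x 0 5 = 7" "idx_x 1 5 = 8" "idx_y 0 1 = 9" "idx_y 2 4 = 10" "idx_y 2 5 = 11"
    "idx_y 3 4 = 12" "idx_y 3 5 = 13" by (simp_all add: idx_x_def idx_y_def)
  moreover have "0 < (6::nat)" "1 < (6::nat)" "2 < (6::nat)" "3 < (6::nat)" "4 < (6::nat)" "5 < (6::nat)" by simp_all
  ultimately show ?thesis by blast
qed

definition alternating_mat :: "'a::field mat \<Rightarrow> bool" where
  "alternating_mat B \<longleftrightarrow> B \<in> carrier_mat 6 6 \<and> (\<forall>i<6. \<forall>j<6. B $$ (i,j) = B $$ (j,i)) \<and> (\<forall>i<6. B $$ (i,i) = 0)"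

context char_two begin

text \<open>The second factor on the left is the coordinate vector of the bivector of
  \<open>p\<close> and \<open>q\<close>, so evaluating an alternating form becomes a scalar product
  in dimension 15.\<close>

lemma pair15_sum:
  fixes B :: "'a mat"
  assumes "alternating_mat B"
  shows "(\<Sum>k<15. B $$ pair15 k * (case pair15 k of (i,j) \<Rightarrow> p i * q j + p j * q i))
    = (\<Sum>i<6. \<Sum>j<6. p i * B $$ (i,j) * q j)"
proof -
  have s: "B $$ (1,0) = B $$ (0,1)" "B $$ (2,0) = B $$ (0,2)" "B $$ (3,0) = B $$ (0,3)" "B $$ (4,0) = B $$ (0,4)"
    "B $$ (5,0) = B $$ (0,5)" "B $$ (2,1) = B $$ (1,2)" "B $$ (3,1) = B $$ (1,3)" "B $$ (4,1) = B $$ (1,4)"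
    "B $$ (5,1) = B $$ (1,5)" "B $$ (3,2) = B $$ (2,3)" "B $$ (4,2) = B $$ (2,4)" "B $$ (5,2) = B $$ (2,5)"
    "B $$ (4,3) = B $$ (3,4)" "B $$ (5,3) = B $$ (3,5)" "B $$ (5,4) = B $$ (4,5)"
    "B $$ (0,0) = 0" "B $$ (1,1) = 0" "B $$ (2,2) = 0" "B $$ (3,3) = 0" "B $$ (4,4) = 0" "B $$ (5,5) = 0"
    using assms unfolding alternating_mat_def by simp_all
  show ?thesis unfolding sum15 sum6 pair15_simps prod.case s by (simp add: algebra_simps)
qed

lemma alternating_congruence:
  fixes N :: "'a mat"
  assumes "alternating_mat N" "R \<in> carrier_mat 6 6"
  shows "alternating_mat (R\<^sup>T * N * R)"
proof -
  have N: "N \<in> carrier_mat 6 6" and sym: "\<And>a b. a < 6 \<Longrightarrow> b < 6 \<Longrightarrow> N $$ (a,b) = N $$ (b,a)"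
    using assms by (auto simp: alternating_mat_def)
  have "(R\<^sup>T * N * R) $$ (i,j) = (R\<^sup>T * N * R) $$ (j,i)" if "i < 6" "j < 6" for i j
    unfolding congruence_index[OF assms(2) N that] congruence_index[OF assms(2) N that(2,1)]
    by (subst sum.swap) (auto intro!: sum.cong simp: sym mult_ac)
  \<comment> \<open>For equal arguments the bivector coordinates
    \<open>p i * p j + p j * p i\<close> vanish.\<close>
  moreover have "(R\<^sup>T * N * R) $$ (i,i) = 0" if "i < 6" for i
    unfolding congruence_index[OF assms(2) N that that] pair15_sum[OF assms(1), symmetric]
    by (simp add: two_simps mult.commute split_beta)
  ultimately show ?thesis using assms N by (simp add: alternating_mat_def)
qed

lemma alternating_form_mat:
  "alternating_mat (form_mat idx_x c :: 'a mat)" "alternating_mat (form_mat idx_y c :: 'a mat)"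
  using idx_x_props idx_y_props by (auto simp: alternating_mat_def form_mat_def)

end

text \<open>As \<open>R\<close> intertwines \<open>X\<close> with \<open>S\<close>, a form fixed by
  \<open>S\<close> pulls back along \<open>R\<close> to one fixed by \<open>X\<close>. This carries
  the fixed forms of the normal forms of x and y into the basis in which z is diagonal.\<close>

lemma congruence_conj:
  fixes R :: "'a::comm_ring_1 mat"
  assumes "R \<in> carrier_mat n n" "S \<in> carrier_mat n n" "X \<in> carrier_mat n n" "N \<in> carrier_mat n n"
    and "R * X = S * R"
  shows "X\<^sup>T * (R\<^sup>T * N * R) * X = R\<^sup>T * (S\<^sup>T * N * S) * R"
proof -
  have "X\<^sup>T * (R\<^sup>T * N * R) * X = (X\<^sup>T * R\<^sup>T) * N * (R * X)"
    using assms by (simp add: assoc_mult_square_mat)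
  also have "X\<^sup>T * R\<^sup>T = R\<^sup>T * S\<^sup>T"
    using assms by (metis transpose_mult)
  finally show ?thesis
    using assms by (simp add: assoc_mult_square_mat)
qed

lemma J6_sum: "i < 6 \<Longrightarrow> (\<Sum>a<6. J6 $$ (a,i) * f a) = (f ((i + 3) mod 6) :: 'a::field)"
  unfolding less6 sum6 J6_def by (elim disjE) simp_all

lemma J6_carrier: "J6 \<in> carrier_mat 6 6" by (simp add: J6_def)

lemma form_mat_carrier: "form_mat idx c \<in> carrier_mat 6 6" by (simp add: form_mat_def)

lemma J6_form_mat: "(J6 :: 'a::field mat)\<^sup>T * form_mat idx_x c * J6 = form_mat idx_x c"
proof (rule eq_matI)
  fix i j assume "i < dim_row (form_mat idx_x c :: 'a mat)" "j < dim_col (form_mat idx_x c :: 'a mat)"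
  hence ij: "i < 6" "j < 6" by (auto simp: form_mat_def)
  have "((J6 :: 'a mat)\<^sup>T * form_mat idx_x c * J6) $$ (i,j) =
    (\<Sum>a<6. J6 $$ (a,i) * (\<Sum>b<6. J6 $$ (b,j) * form_mat idx_x c $$ (a,b)))"
    unfolding congruence_index[OF J6_carrier form_mat_carrier ij]
    by (simp add: sum_distrib_left mult_ac)
  also have "\<dots> = form_mat idx_x c $$ ((i + 3) mod 6, (j + 3) mod 6)"
    by (simp only: J6_sum[OF ij(1)] J6_sum[OF ij(2)])
  also have "\<dots> = form_mat idx_x c $$ (i,j)"
    using idx_x_props(3)[OF ij] ij by (simp add: form_mat_def)
  finally show "((J6 :: 'a mat)\<^sup>T * form_mat idx_x c * J6) $$ (i,j) = form_mat idx_x c $$ (i,j)" .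
qed (auto simp: form_mat_def J6_def)

definition diag6 :: "(nat \<Rightarrow> 'a::field) \<Rightarrow> 'a mat" where
  "diag6 z = mat 6 6 (\<lambda>(i,j). if i = j then z i else 0)"

lemma diag6_carrier: "diag6 z \<in> carrier_mat 6 6" by (simp add: diag6_def)

lemma diag6_left: "B \<in> carrier_mat 6 n \<Longrightarrow> diag6 z * B = mat 6 n (\<lambda>(i,j). z i * B $$ (i,j))"
  by (intro eq_matI) (auto simp: diag6_def scalar_prod_def if_distrib[of "\<lambda>x. x * _"] sum.delta cong: if_cong)

lemma diag6_right: "B \<in> carrier_mat n 6 \<Longrightarrow> B * diag6 z = mat n 6 (\<lambda>(i,j). B $$ (i,j) * z j)"
  by (intro eq_matI) (auto simp: diag6_def scalar_prod_def if_distrib[of "\<lambda>x. _ * x"] sum.delta cong: if_cong)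

lemma diag6_mult_vec:
  assumes "i < 6" "u \<in> carrier_vec 6"
  shows "(diag6 f *\<^sub>v u) $ i = f i * u $ i"
proof -
  have "(diag6 f *\<^sub>v u) $ i = (\<Sum>k\<in>{0..<6}. (if i = k then f i else 0) * u $ k)"
    using assms unfolding diag6_def by (simp add: scalar_prod_def)
  also have "\<dots> = (\<Sum>k\<in>{0..<6}. if k = i then f i * u $ k else 0)" by (intro sum.cong) auto
  finally show ?thesis using assms(1) by simp
qed

lemma diag6_transpose: "(diag6 z)\<^sup>T = diag6 z"
  by (intro eq_matI) (auto simp: diag6_def)

lemma diag6_congruence:
  assumes "B \<in> carrier_mat 6 6"
  shows "(diag6 z)\<^sup>T * B * diag6 z = mat 6 6 (\<lambda>(i,j). z i * B $$ (i,j) * z j)"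
  unfolding diag6_transpose diag6_left[OF assms]
  by (subst diag6_right[of _ 6]) (auto intro!: eq_matI)

lemma diag6_form_mat:
  assumes "\<And>a b. a < 6 \<Longrightarrow> b < 6 \<Longrightarrow> idx a b < 14 \<Longrightarrow> z a * z b = (1::'a::field)"
  shows "(diag6 z)\<^sup>T * form_mat idx c * diag6 z = form_mat idx c"
  unfolding diag6_congruence[OF form_mat_carrier]
  by (rule eq_matI) (auto simp: form_mat_def assms mult_ac)

lemma congruence_eq_zero:
  fixes R :: "'a::field mat"
  assumes "R \<in> carrier_mat n n" "R' \<in> carrier_mat n n" "R * R' = 1\<^sub>m n" "N \<in> carrier_mat n n"
    and "R\<^sup>T * N * R = 0\<^sub>m n n"
  shows "N = 0\<^sub>m n n"
proof -
  have "R'\<^sup>T * (R\<^sup>T * N * R) * R' = (R * R')\<^sup>T * N * (R * R')"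
    using assms(1,2,4) by (simp add: transpose_mult[of R n n R' n]
      assoc_mult_square_mat)
  thus ?thesis using assms by simp
qed

lemma form_mat_linear:
  fixes R :: "'a::field mat"
  assumes R: "R \<in> carrier_mat 6 6" and ij: "i < 6" "j < 6"
  shows "(\<Sum>r<14. c r * (R\<^sup>T * form_mat idx (\<lambda>k. if k = r then 1 else 0) * R) $$ (i,j))
    = (R\<^sup>T * form_mat idx c * R) $$ (i,j)"
proof -
  have l: "(\<Sum>r<14. c r * form_mat idx (\<lambda>k. if k = r then 1 else 0) $$ (a,b)) = form_mat idx c $$ (a,b)"
    if "a < 6" "b < 6" for a b
    using that by (auto simp: form_mat_def if_distrib[of "\<lambda>x. _ * x"] sum.delta cong: if_cong)
  have "(\<Sum>r<14. c r * (\<Sum>a<6. \<Sum>b<6. R $$ (a,i) * form_mat idx (\<lambda>k. if k = r then 1 else 0) $$ (a,b) * R $$ (b,j)))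
    = (\<Sum>a<6. \<Sum>b<6. \<Sum>r<14. R $$ (a,i) * (c r * form_mat idx (\<lambda>k. if k = r then 1 else 0) $$ (a,b)) * R $$ (b,j))"
    by (simp add: sum_distrib_left sum.swap[of _ _ "{..<14}"] mult_ac)
  also have "\<dots> = (\<Sum>a<6. \<Sum>b<6. R $$ (a,i) * form_mat idx c $$ (a,b) * R $$ (b,j))"
    by (simp add: l sum_distrib_left[symmetric] sum_distrib_right[symmetric])
  finally show ?thesis unfolding congruence_index[OF R form_mat_carrier ij] .
qed

context char_two begin

text \<open>
  The functional \<open>B \<mapsto> B $$ (s, s + 3)\<close> is fixed by \<open>z\<close>, so its difference with its translate
  under \<open>X\<close> kills all forms fixed by \<open>X\<close> or by \<open>Y\<close>; \<open>g s\<close> is the coordinate vector of this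
  difference. If a combination of \<open>g 0\<close> and \<open>g 1\<close> vanishes, the matrix \<open>K\<close> of the corresponding
  bivector is invariant, but its third row is zero.
\<close>

lemma invariant_form:
  fixes X Y :: "'a mat"
  assumes X: "X \<in> carrier_mat 6 6" and Y: "Y \<in> carrier_mat 6 6" and XX: "X * X = 1\<^sub>m 6"
    and XY: "X * Y = diag6 z" and z: "\<And>i. i < 3 \<Longrightarrow> z i * z (i + 3) = 1"
    and R: "R \<in> carrier_mat 6 6" "R' \<in> carrier_mat 6 6" "R * R' = 1\<^sub>m 6" and RX: "R * X = J6 * R"
    and U: "U \<in> carrier_mat 6 6" "U' \<in> carrier_mat 6 6" "U * U' = 1\<^sub>m 6" and UY: "U * Y = diag6 l * U"
    and l: "\<And>a b. a < 6 \<Longrightarrow> b < 6 \<Longrightarrow> idx_y a b < 14 \<Longrightarrow> l a * l b = 1"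
    and irr: "irreducible_pair X (diag6 z)"
  shows "\<exists>B. alternating_mat B \<and> B \<noteq> 0\<^sub>m 6 6 \<and> X\<^sup>T * B * X = B \<and> Y\<^sup>T * B * Y = B"
proof -
  let ?Z = "diag6 z"
  have Z: "?Z \<in> carrier_mat 6 6" by (rule diag6_carrier)
  have YXZ: "Y = X * ?Z" using XX X Y unfolding XY[symmetric] by (metis assoc_mult_mat left_mult_one_mat)
  define FR where "FR c = R\<^sup>T * form_mat idx_x c * R" for c
  define FU where "FU c = U\<^sup>T * form_mat idx_y c * U" for c
  have FRc: "FR c \<in> carrier_mat 6 6" and FUc: "FU c \<in> carrier_mat 6 6" for c
    using R U form_mat_carrier[of _ c] by (auto simp: FR_def FU_def)
  have altR: "alternating_mat (FR c)" and altU: "alternating_mat (FU c)" for c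
    using alternating_congruence[OF alternating_form_mat(1) R(1)] alternating_congruence[OF alternating_form_mat(2) U(1)]
    by (auto simp: FR_def FU_def)
  have XFR: "X\<^sup>T * FR c * X = FR c" for c
    unfolding FR_def congruence_conj[OF R(1) J6_carrier X form_mat_carrier RX] J6_form_mat ..
  have lF: "(diag6 l)\<^sup>T * form_mat idx_y c * diag6 l = form_mat idx_y c" for c
    by (rule diag6_form_mat) (rule l)
  have YFU: "Y\<^sup>T * FU c * Y = FU c" for c
    unfolding FU_def congruence_conj[OF U(1) diag6_carrier Y form_mat_carrier UY] lF ..
  \<comment> \<open>Since \<open>Y = X * Z\<close> fixes \<open>FU c\<close>, translating by
    \<open>X\<close> and then by \<open>Z\<close> returns \<open>FU c\<close>, and the translation
    by \<open>Z\<close> leaves the entry at \<open>(s, s + 3)\<close> unchanged.\<close>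
  have XFU: "(X\<^sup>T * FU c * X) $$ (s, s + 3) = FU c $$ (s, s + 3)" if s: "s < 3" for c s
  proof -
    have B: "X\<^sup>T * FU c * X \<in> carrier_mat 6 6" using X FUc[of c] by auto
    have "FU c = (X * ?Z)\<^sup>T * FU c * (X * ?Z)" using YFU[of c] YXZ by simp
    also have "\<dots> = ?Z\<^sup>T * (X\<^sup>T * FU c * X) * ?Z"
      using X Z FUc[of c] by (simp add: transpose_mult[of X 6 6 ?Z 6]
        mult6_assoc)
    also have "\<dots> $$ (s, s + 3) = z s * (X\<^sup>T * FU c * X) $$ (s, s + 3) * z (s + 3)"
      unfolding diag6_congruence[OF B] using s by simp
    also have "\<dots> = (z s * z (s + 3)) * (X\<^sup>T * FU c * X) $$ (s, s + 3)" by (simp add: mult_ac)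
    finally show ?thesis using z[OF s] by simp
  qed
  define \<delta> :: "nat \<Rightarrow> nat \<Rightarrow> 'a" where "\<delta> r = (\<lambda>k. if k = r then 1 else 0)" for r
  define M where "M r k = FR (\<delta> r) $$ pair15 k + FU (\<delta> r) $$ pair15 k" for r k
  define g where "g s k = (case pair15 k of (i,j) \<Rightarrow>
      X $$ (i,s) * X $$ (j,s + 3) + X $$ (j,s) * X $$ (i,s + 3) + (if i = s \<and> j = s + 3 then 1 else 0))" for s k
  have orth: "(\<Sum>k<15. B $$ pair15 k * g s k) = 0"
    if B: "alternating_mat B" and s: "s < 3" and inv: "(X\<^sup>T * B * X) $$ (s, s + 3) = B $$ (s, s + 3)" for B s
  proof -
    have Bc: "B \<in> carrier_mat 6 6" using B by (simp add: alternating_mat_def)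
    have s6: "s < 6" "s + 3 < 6" using s by auto
    have "(\<Sum>k<15. B $$ pair15 k * g s k) = (\<Sum>k<15. B $$ pair15 k * (case pair15 k of (i,j) \<Rightarrow>
        X $$ (i,s) * X $$ (j,s + 3) + X $$ (j,s) * X $$ (i,s + 3)))
      + (\<Sum>k<15. B $$ pair15 k * (case pair15 k of (i,j) \<Rightarrow> if i = s \<and> j = s + 3 then 1 else 0))"
      by (simp add: g_def split_beta distrib_left sum.distrib)
    also have "(\<Sum>k<15. B $$ pair15 k * (case pair15 k of (i,j) \<Rightarrow> if i = s \<and> j = s + 3 then 1 else 0)) = B $$ (s, s + 3)"
    proof -
      have "s = 0 \<or> s = 1 \<or> s = 2" using s by auto
      thus ?thesis unfolding sum15 pair15_simps by (elim disjE) simp_all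
    qed
    also have "(\<Sum>k<15. B $$ pair15 k * (case pair15 k of (i,j) \<Rightarrow>
        X $$ (i,s) * X $$ (j,s + 3) + X $$ (j,s) * X $$ (i,s + 3))) = (X\<^sup>T * B * X) $$ (s, s + 3)"
      unfolding pair15_sum[OF B] congruence_index[OF X Bc s6] ..
    finally show ?thesis by (simp add: inv add_self)
  qed
  have Mg: "(\<Sum>k<Suc 14. M r k * g s k) = 0" if "s < 3" for r s
  proof -
    have "(\<Sum>k<15. M r k * g s k) = 0"
      unfolding M_def distrib_right sum.distrib
      using orth[OF altR that] orth[OF altU that] XFR XFU[OF that] by simp
    thus ?thesis by simp
  qed
  show ?thesis
  \<comment> \<open>Fourteen rows, nine from forms fixed by \<open>X\<close> and five from forms
    fixed by \<open>Y\<close>, are orthogonal to \<open>g 0\<close> and \<open>g 1\<close> in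
    dimension 15. Hence the rows are dependent or the two vectors are.\<close>
  proof (rule annihilator_pair[where M = M and g = "g 0" and h = "g 1" and n = 14])
    show "(\<Sum>j<Suc 14. M i j * g 0 j) = 0" "(\<Sum>j<Suc 14. M i j * g 1 j) = 0" for i by (rule Mg; simp)+
  next
    fix c assume c: "\<exists>i<14. c i \<noteq> 0" and c0: "\<And>j. j < Suc 14 \<Longrightarrow> (\<Sum>i<14. c i * M i j) = 0"
    \<comment> \<open>A relation among the rows says \<open>FR c + FU c = 0\<close>, which in
      characteristic 2 equates a form fixed by \<open>X\<close> with one fixed by
      \<open>Y\<close>.\<close>
    have pe: "FR c $$ (i,j) = FU c $$ (i,j)" if ij: "i < j" "j < 6" for i j
    proof -
      obtain k where k: "k < 15" "pair15 k = (i,j)" using pair15_cover[OF ij] by auto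
      have "(\<Sum>r<14. c r * M r k) = FR c $$ (i,j) + FU c $$ (i,j)"
        unfolding M_def k(2) distrib_left sum.distrib FR_def FU_def \<delta>_def
        by (simp only: form_mat_linear[OF R(1) less_trans[OF ij] ij(2)] form_mat_linear[OF U(1) less_trans[OF ij] ij(2)])
      thus ?thesis using c0[of k] k(1) by (simp add: add_eq_zero_iff)
    qed
    have e: "FR c = FU c"
    proof (rule eq_matI)
      fix i j assume "i < dim_row (FU c)" "j < dim_col (FU c)"
      hence ij: "i < 6" "j < 6" using FUc[of c] by auto
      consider "i < j" | "i = j" | "j < i" by linarith
      thus "FR c $$ (i,j) = FU c $$ (i,j)"
        by cases (use ij pe altR[of c] altU[of c] in \<open>auto simp: alternating_mat_def\<close>)
    qed (use FRc[of c] FUc[of c] in auto)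
    \<comment> \<open>If the common form vanished, both parameter matrices would vanish because
      \<open>R\<close> and \<open>U\<close> are invertible, and every coefficient occurs in one of
      them.\<close>
    have "FR c \<noteq> 0\<^sub>m 6 6"
    proof
      assume "FR c = 0\<^sub>m 6 6"
      hence z: "form_mat idx_x c = (0\<^sub>m 6 6 :: 'a mat)" "form_mat idx_y c = (0\<^sub>m 6 6 :: 'a mat)"
        using congruence_eq_zero[OF R form_mat_carrier] congruence_eq_zero[OF U form_mat_carrier] e
        unfolding FR_def FU_def by metis+
      have "c (idx_x a b) = 0" if "a < 6" "b < 6" "idx_x a b < 14" for a b
        using arg_cong[OF z(1), of "\<lambda>M. M $$ (a,b)"] that by (simp add: form_mat_def)
      moreover have "c (idx_y a b) = 0" if "a < 6" "b < 6" "idx_y a b < 14" for a b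
        using arg_cong[OF z(2), of "\<lambda>M. M $$ (a,b)"] that by (simp add: form_mat_def)
      ultimately have "c r = 0" if "r < 14" for r using idx_surj[OF that] that by auto
      thus False using c by auto
    qed
    thus ?thesis using altR XFR YFU e by metis
  next
    fix a b assume ab: "a \<noteq> 0 \<or> b \<noteq> 0" and g0: "\<And>j. j < Suc 14 \<Longrightarrow> a * g 0 j + b * g 1 j = 0"
    \<comment> \<open>Bivectors at only two of the three hyperbolic pairs are combined, so that
      \<open>K\<close> is degenerate.\<close>
    define K where "K = mat 6 6 (\<lambda>(i,j). if (i,j) \<in> {(0,3),(3,0)} then a else if (i,j) \<in> {(1,4),(4,1)} then b else 0)"
    have K: "K \<in> carrier_mat 6 6" by (simp add: K_def)
    have Kt: "K $$ (i,j) = K $$ (j,i)" if "i < 6" "j < 6" for i j using that by (auto simp: K_def)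
    \<comment> \<open>These are the entries of the bivector moved by \<open>X\<close>; the relation
      between \<open>g 0\<close> and \<open>g 1\<close> says that it does not move.\<close>
    define q where "q i j = a * (X $$ (i,0) * X $$ (j,3) + X $$ (j,0) * X $$ (i,3))
      + b * (X $$ (i,1) * X $$ (j,4) + X $$ (j,1) * X $$ (i,4))" for i j
    have XKX: "(X * K * X\<^sup>T) $$ (i,j) = q i j" if "i < 6" "j < 6" for i j
    proof -
      have "(X * K * X\<^sup>T) $$ (i,j) = (X\<^sup>T\<^sup>T * K * X\<^sup>T) $$ (i,j)" by simp
      also have "\<dots> = (\<Sum>r<6. \<Sum>s<6. X\<^sup>T $$ (r,i) * K $$ (r,s) * X\<^sup>T $$ (s,j))"
        using that X K by (intro congruence_index) auto
      also have "\<dots> = q i j" using that X by (simp add: sum6 K_def q_def algebra_simps)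
      finally show ?thesis .
    qed
    have ql: "q i j = K $$ (i,j)" if ij: "i < j" "j < 6" for i j
    proof -
      obtain k where k: "k < 15" "pair15 k = (i,j)" using pair15_cover[OF ij] by auto
      have "a * g 0 k + b * g 1 k = q i j + K $$ (i,j)"
        using ij by (auto simp: g_def k(2) q_def K_def algebra_simps)
      thus ?thesis using g0[of k] k(1) by (simp add: add_eq_zero_iff)
    qed
    have qK: "q i j = K $$ (i,j)" if "i < 6" "j < 6" for i j
    proof -
      consider "i < j" | "i = j" | "j < i" by linarith
      thus ?thesis
      proof cases
        case 2
        thus ?thesis using that by (auto simp: q_def K_def two_simps mult.commute)
      next
        case 3
        have "q i j = q j i" by (simp add: q_def algebra_simps)
        thus ?thesis using ql[OF 3] that Kt by simp
      qed (use that ql in auto)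
    qed
    have XKXK: "X * K * X\<^sup>T = K"
    proof (rule eq_matI)
      fix i j assume "i < dim_row K" "j < dim_col K"
      hence ij: "i < 6" "j < 6" using K by auto
      show "(X * K * X\<^sup>T) $$ (i,j) = K $$ (i,j)" by (simp only: XKX[OF ij] qK[OF ij])
    qed (use X K in auto)
    have "X\<^sup>T * X\<^sup>T = 1\<^sub>m 6" using XX X by (metis transpose_mult transpose_one)
    hence "X * K = X * K * (X\<^sup>T * X\<^sup>T)" using X K by simp
    also have "\<dots> = X * K * X\<^sup>T * X\<^sup>T"
      using X K by (intro assoc_mult_mat[symmetric, where n\<^sub>1 = 6 and n\<^sub>2 = 6 and n\<^sub>3 = 6 and n\<^sub>4 = 6]) auto
    finally have XK: "X * K = K * X\<^sup>T" unfolding XKXK .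
    have ZK: "?Z * K = K * diag6 (\<lambda>i. z ((i + 3) mod 6))"
      unfolding diag6_left[OF K] diag6_right[OF K] by (rule eq_matI) (auto simp: K_def)
    have "K \<noteq> 0\<^sub>m 6 6"
    proof
      assume "K = 0\<^sub>m 6 6"
      hence "K $$ (0,3) = 0" "K $$ (1,4) = 0" by simp_all
      thus False using ab by (simp add: K_def)
    qed
    then obtain u where u: "u \<in> carrier_vec 6" "unit_vec 6 2 = K *\<^sub>v u"
      using irreducible_pair_image[OF irr X Z _ diag6_carrier K _ XK ZK, of "unit_vec 6 2"] X by auto
    have "(K *\<^sub>v u) $ 2 = (\<Sum>i = 0..<6. K $$ (2,i) * u $ i)"
      using K u(1) by (auto simp: scalar_prod_def)
    also have "\<dots> = 0" by (intro sum.neutral) (auto simp: K_def)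
    finally have "unit_vec 6 2 $ 2 = (0::'a)" using u(2) by simp
    thus ?thesis by simp
  qed
qed

end

section \<open>Fixed vectors of the spin module\<close>

context char_two begin

lemma mult_mat_regroup:
  assumes "A \<in> carrier_mat n n" "B \<in> carrier_mat n n" "C \<in> carrier_mat n n" "D \<in> carrier_mat n n"
    "E \<in> carrier_mat n n" "F \<in> carrier_mat n n"
  shows "A * B * C * (D * E * F) = A * (B * (C * D) * E) * F"
  using assms by (simp add: assoc_mult_square_mat)

lemma om_congruence:
  assumes "V \<in> carrier_mat 6 6" "a < 6" "b < 6"
  shows "((V::'a mat)\<^sup>T * J6 * V) $$ (a,b) = om (col V a) (col V b)"
proof -
  have "(V\<^sup>T * J6 * V) $$ (a,b) = (\<Sum>i<6. \<Sum>j<6. V $$ (i,a) * J6 $$ (i,j) * V $$ (j,b))"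
    by (rule congruence_index[OF assms(1) J6_carrier assms(2,3)])
  also have "\<dots> = om (col V a) (col V b)"
    using assms by (simp add: sum6 J6_def omega_def)
  finally show ?thesis .
qed

lemma J6_J6: "(J6 :: 'a mat) * J6 = 1\<^sub>m 6"
proof (rule eq_matI)
  fix i j assume "i < dim_row (1\<^sub>m 6 :: 'a mat)" "j < dim_col (1\<^sub>m 6 :: 'a mat)"
  hence ij: "i < 6" "j < 6" by auto
  have "((J6 :: 'a mat) * J6) $$ (i,j) = (\<Sum>k<6. J6 $$ (i,k) * J6 $$ (k,j))"
    using ij by (simp add: J6_def scalar_prod_def lessThan_atLeast0)
  also have "\<dots> = 1\<^sub>m 6 $$ (i,j)"
    using ij unfolding less6 sum6 J6_def by (elim disjE) simp_all
  finally show "((J6 :: 'a mat) * J6) $$ (i,j) = 1\<^sub>m 6 $$ (i,j)" .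
qed (auto simp: J6_def)

lemma om_add: "u \<in> carrier_vec 6 \<Longrightarrow> v \<in> carrier_vec 6 \<Longrightarrow> omega f (vec_index (u + v)) = omega f (vec_index u) + omega f (vec_index v)"
  by (simp add: omega_def algebra_simps)

lemma om_smult: "u \<in> carrier_vec 6 \<Longrightarrow> omega f (vec_index (c \<cdot>\<^sub>v u)) = c * omega f (vec_index u)"
  by (simp add: omega_def algebra_simps)

lemma om_add': "u \<in> carrier_vec 6 \<Longrightarrow> v \<in> carrier_vec 6 \<Longrightarrow> omega (vec_index (u + v)) f = omega (vec_index u) f + omega (vec_index v) f"
  by (simp add: omega_def algebra_simps)

lemma om_smult': "u \<in> carrier_vec 6 \<Longrightarrow> omega (vec_index (c \<cdot>\<^sub>v u)) f = c * omega (vec_index u) f"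
  by (simp add: omega_def algebra_simps)

lemma omega_same: "omega f f = 0"
  by (simp add: omega_def mult.commute two_simps)

text \<open>The four triples for \<open>spin_fixed\<close> consist of eigenvectors of
  \<open>Y\<close> with eigenvalues 1, \<open>w\<close> and \<open>w^2\<close>, whose product is 1;
  the third vector is adjusted to make the triple isotropic.\<close>

lemma spin_fixed_eigen:
  fixes X Y :: "'a mat"
  assumes X: "symplectic X" and XX: "X * X = 1\<^sub>m 6"
    and Z: "symplectic (diag6 z)" and XY: "X * Y = diag6 z" and Y: "Y \<in> carrier_mat 6 6"
    and V: "V \<in> carrier_mat 6 6" "V' \<in> carrier_mat 6 6" "V * V' = 1\<^sub>m 6" "V' * V = 1\<^sub>m 6"
    and YV: "Y * V = V * diag6 (\<lambda>i. [1,1,w,w,w^2,w^2] ! i)" and w: "w^3 = 1" "w \<noteq> 1"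
    and z: "z 0 * z 1 * z 5 = 1" "z 2 * z 3 * z 4 = 1"
      "z 0 * z 1 * z 2 \<noteq> 1" "z 3 * z 1 * z 2 \<noteq> 1" "z 0 * z 4 * z 2 \<noteq> 1"
      "z 3 * z 1 * z 5 \<noteq> 1" "z 0 * z 4 * z 5 \<noteq> 1" "z 3 * z 4 * z 5 \<noteq> 1"
  shows "\<exists>a b. (a \<noteq> 0 \<or> b \<noteq> 0) \<and>
    (\<forall>P. isotropic P \<longrightarrow> a * pairing (lagr 4) (act_triple X P) + b * pairing (lagr 3) (act_triple X P) = a * pairing (lagr 4) P + b * pairing (lagr 3) P)"
proof -
  have X6: "X \<in> carrier_mat 6 6" and Z6: "diag6 z \<in> carrier_mat 6 6"
    using X by (auto simp: symplectic_def diag6_carrier)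
  have YXZ: "Y = X * diag6 z" using XX X6 Y unfolding XY[symmetric] by (metis assoc_mult_mat left_mult_one_mat)
  have Ys: "symplectic Y" unfolding symplectic_def
  proof (intro conjI ballI Y)
    fix u v :: "'a vec" assume uv: "u \<in> carrier_vec 6" "v \<in> carrier_vec 6"
    have "Y *\<^sub>v t = X *\<^sub>v (diag6 z *\<^sub>v t)" if "t \<in> carrier_vec 6" for t
      using that X6 Z6 unfolding YXZ by simp
    moreover have "diag6 z *\<^sub>v u \<in> carrier_vec 6" "diag6 z *\<^sub>v v \<in> carrier_vec 6"
      using uv Z6 mult_mat_vec_carrier by blast+
    ultimately show "om (Y *\<^sub>v u) (Y *\<^sub>v v) = om u v"
      using uv X Z by (simp add: symplectic_def)
  qed
  let ?l = "\<lambda>i::nat. [1,1,w,w,w^2,w^2] ! i"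
  define u where "u a = col V a" for a
  have uc: "u a \<in> carrier_vec 6" if "a < 6" for a using V that by (simp add: u_def)
  have Yu: "Y *\<^sub>v u a = ?l a \<cdot>\<^sub>v u a" if "a < 6" for a
  proof -
    have "Y *\<^sub>v u a = col (Y * V) a" unfolding u_def by (rule col_mult2[OF Y V(1) that, symmetric])
    also have "\<dots> = ?l a \<cdot>\<^sub>v u a" unfolding YV diag6_right[OF V(1)] using that V
      by (intro eq_vecI) (auto simp: u_def)
    finally show ?thesis .
  qed
  have "w^2 * w = w^3" by (simp add: power3_eq_cube power2_eq_square)
  hence w2: "w^2 \<noteq> 1" using w by auto
  have "w^2 * w^2 = w^3 * w" by (simp add: power3_eq_cube power2_eq_square mult.assoc)
  hence "w^2 * w^2 = w" using w(1) by simp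
  hence ww: "w * w \<noteq> 1" "w^2 * w^2 \<noteq> 1" using w(2) w2 by (metis power2_eq_square)+
  define \<Gamma> where "\<Gamma> a b = om (u a) (u b)" for a b
  \<comment> \<open>Eigenvectors are orthogonal unless their eigenvalues are inverse to each other.
    So the Gram matrix splits into a block on 0, 1 and a block between 2, 3 and 4, 5.\<close>
  have G0: "\<Gamma> a b = 0" if "a < 6" "b < 6" "?l a * ?l b \<noteq> 1" for a b
  proof -
    have "\<Gamma> a b = om (Y *\<^sub>v u a) (Y *\<^sub>v u b)" using Ys uc that by (simp add: \<Gamma>_def symplectic_def)
    also have "\<dots> = (?l a * ?l b) * \<Gamma> a b" using that uc by (simp add: Yu om_smult om_smult' \<Gamma>_def)
    finally show ?thesis using that(3) by (metis mult_cancel_right1)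
  qed
  have Gsym: "\<Gamma> a b = \<Gamma> b a" and Gd: "\<Gamma> a a = 0" for a b by (simp_all add: \<Gamma>_def omega_sym[of "vec_index (u a)"] omega_same)
  have z0: "\<Gamma> 0 2 = 0" "\<Gamma> 0 3 = 0" "\<Gamma> 0 4 = 0" "\<Gamma> 0 5 = 0" "\<Gamma> 1 2 = 0" "\<Gamma> 1 3 = 0" "\<Gamma> 1 4 = 0" "\<Gamma> 1 5 = 0"
    "\<Gamma> 2 3 = 0" "\<Gamma> 4 5 = 0"
    using G0[of 0 2] G0[of 0 3] G0[of 0 4] G0[of 0 5] G0[of 1 2] G0[of 1 3] G0[of 1 4] G0[of 1 5] G0[of 2 3] G0[of 4 5]
      w(2) w2 ww by simp_all
  let ?G = "V\<^sup>T * J6 * V" and ?G' = "V' * J6 * V'\<^sup>T"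
  have GG: "?G * ?G' = 1\<^sub>m 6"
  proof -
    have "?G * ?G' = V\<^sup>T * (J6 * (V * V') * J6) * V'\<^sup>T"
      using V J6_carrier by (intro mult_mat_regroup[where n = 6]) auto
    also have "J6 * (V * V') * J6 = (1\<^sub>m 6 :: 'a mat)"
      unfolding V(3) right_mult_one_mat[OF J6_carrier] J6_J6 ..
    also have "V\<^sup>T * 1\<^sub>m 6 * V'\<^sup>T = V\<^sup>T * V'\<^sup>T" using V by simp
    also have "\<dots> = (V' * V)\<^sup>T" by (rule transpose_mult[OF V(2,1), symmetric])
    finally show ?thesis unfolding V(4) transpose_one .
  qed
  define \<Delta> where "\<Delta> a b = ?G' $$ (a,b)" for a b
  have GD: "(\<Sum>k<6. \<Gamma> a k * \<Delta> k b) = (if a = b then 1 else 0)" if "a < 6" "b < 6" for a b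
  proof -
    have "(?G * ?G') $$ (a,b) = (\<Sum>k<6. ?G $$ (a,k) * ?G' $$ (k,b))"
      using that V by (auto simp: scalar_prod_def lessThan_atLeast0 simp del: index_mult_mat(1) assoc_mult_mat
        simp: index_mult_mat(1)[of a ?G b ?G'])
    thus ?thesis using GG that om_congruence[OF V(1)] by (simp add: \<Gamma>_def \<Delta>_def u_def)
  qed
  \<comment> \<open>Row 0 of the invertible Gram matrix has no other entry that can be
    nonzero.\<close>
  have p: "\<Gamma> 0 1 \<noteq> 0"
    using GD[of 0 0] Gd[of 0] by (auto simp: sum6 z0)
  \<comment> \<open>The determinant of the block between 2, 3 and 4, 5. Its product with the
    corresponding minor of the inverse Gram matrix is 1.\<close>
  define n where "n = \<Gamma> 2 4 * \<Gamma> 3 5 + \<Gamma> 2 5 * \<Gamma> 3 4"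
  have zs: "\<Gamma> 2 0 = 0" "\<Gamma> 2 1 = 0" "\<Gamma> 3 0 = 0" "\<Gamma> 3 1 = 0" "\<Gamma> 3 2 = 0" "\<Gamma> 4 0 = 0" "\<Gamma> 4 1 = 0" "\<Gamma> 5 0 = 0" "\<Gamma> 5 1 = 0" "\<Gamma> 5 4 = 0"
    using z0 Gsym by metis+
  note z0 = z0 z0[simplified] and zs = zs zs[simplified]
  have "n * (\<Delta> 4 2 * \<Delta> 5 3 + \<Delta> 4 3 * \<Delta> 5 2) = 1"
  proof -
    have "\<Gamma> 2 4 * \<Delta> 4 2 + \<Gamma> 2 5 * \<Delta> 5 2 = 1" "\<Gamma> 2 4 * \<Delta> 4 3 + \<Gamma> 2 5 * \<Delta> 5 3 = 0"
      "\<Gamma> 3 4 * \<Delta> 4 2 + \<Gamma> 3 5 * \<Delta> 5 2 = 0" "\<Gamma> 3 4 * \<Delta> 4 3 + \<Gamma> 3 5 * \<Delta> 5 3 = 1"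
      using GD[of 2 2] GD[of 2 3] GD[of 3 2] GD[of 3 3] Gd[of 2] Gd[of 3] by (simp_all add: sum6 z0 zs)
    moreover have "n * (\<Delta> 4 2 * \<Delta> 5 3 + \<Delta> 4 3 * \<Delta> 5 2) =
       (\<Gamma> 2 4 * \<Delta> 4 2 + \<Gamma> 2 5 * \<Delta> 5 2) * (\<Gamma> 3 4 * \<Delta> 4 3 + \<Gamma> 3 5 * \<Delta> 5 3)
     + (\<Gamma> 2 4 * \<Delta> 4 3 + \<Gamma> 2 5 * \<Delta> 5 3) * (\<Gamma> 3 4 * \<Delta> 4 2 + \<Gamma> 3 5 * \<Delta> 5 2)"
      unfolding n_def by (simp add: algebra_simps two_simps)
    ultimately show ?thesis by simp
  qed
  hence n: "n \<noteq> 0" by auto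
  \<comment> \<open>Cofactor combinations of \<open>u 4\<close> and \<open>u 5\<close>: up to the
    factor \<open>n\<close>, the vectors \<open>g4\<close> and \<open>g5\<close> are dual to
    \<open>u 2\<close> and \<open>u 3\<close>.\<close>
  define g4 where "g4 = \<Gamma> 3 5 \<cdot>\<^sub>v u 4 + \<Gamma> 3 4 \<cdot>\<^sub>v u 5"
  define g5 where "g5 = \<Gamma> 2 5 \<cdot>\<^sub>v u 4 + \<Gamma> 2 4 \<cdot>\<^sub>v u 5"
  have gc: "g4 \<in> carrier_vec 6" "g5 \<in> carrier_vec 6" using uc by (auto simp: g4_def g5_def)
  have Yg: "Y *\<^sub>v g4 = w^2 \<cdot>\<^sub>v g4" "Y *\<^sub>v g5 = w^2 \<cdot>\<^sub>v g5"
    using uc Y by (simp_all add: g4_def g5_def mult_add_distrib_mat_vec[OF Y] mult_mat_vec[OF Y] Yu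
      smult_add_distrib_vec[where n = 6] smult_smult_assoc mult.commute)
  have og: "omega f (vec_index g4) = \<Gamma> 3 5 * omega f (vec_index (u 4)) + \<Gamma> 3 4 * omega f (vec_index (u 5))"
    "omega f (vec_index g5) = \<Gamma> 2 5 * omega f (vec_index (u 4)) + \<Gamma> 2 4 * omega f (vec_index (u 5))" for f
    unfolding g4_def g5_def using uc[of 4] uc[of 5] by (simp_all add: om_add om_smult)
  have og': "omega (vec_index g4) f = \<Gamma> 3 5 * omega (vec_index (u 4)) f + \<Gamma> 3 4 * omega (vec_index (u 5)) f"
    "omega (vec_index g5) f = \<Gamma> 2 5 * omega (vec_index (u 4)) f + \<Gamma> 2 4 * omega (vec_index (u 5)) f" for f
    using og by (simp_all add: omega_sym[of _ f])
  have e: "om (u 0) g4 = 0" "om (u 0) g5 = 0" "om (u 1) g4 = 0" "om (u 1) g5 = 0" "om (u 2) g5 = 0" "om (u 3) g4 = 0"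
    "om g4 g5 = 0" "om g5 g4 = 0" "om g4 g4 = 0" "om g5 g5 = 0"
    "om g4 (u 0) = 0" "om g5 (u 0) = 0" "om g4 (u 1) = 0" "om g5 (u 1) = 0" "om g5 (u 2) = 0" "om g4 (u 3) = 0"
    "om (u 2) g4 = n" "om (u 3) g5 = n" "om g4 (u 2) = n" "om g5 (u 3) = n"
    unfolding og og' \<Gamma>_def[symmetric] n_def
    by (simp_all add: z0 zs Gd Gsym[of 4 2] Gsym[of 4 3] Gsym[of 5 2] Gsym[of 5 3] two_simps mult.commute add.commute)
  note e = e e[simplified]
  have eu: "om (u a) (u b) = \<Gamma> a b" for a b by (simp add: \<Gamma>_def)
  \<comment> \<open>\<open>F k\<close> and \<open>F (3 - k)\<close> have no vector in common, and
    their Gram determinant is \<open>\<Gamma> 0 1 * n^2\<close>. Any other two share a vector, which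
    is orthogonal to both triples, so that their Gram determinant is 0.\<close>
  define F where "F k = [(u 0, u 2, g5), (u 1, u 2, g5), (u 0, u 3, g4), (u 1, u 3, g4)] ! k" for k
  have F: "F 0 = (u 0, u 2, g5)" "F 1 = (u 1, u 2, g5)" "F 2 = (u 0, u 3, g4)" "F 3 = (u 1, u 3, g4)"
    by (simp_all add: F_def)
  note F = F F[simplified]
  have c4: "k = 0 \<or> k = 1 \<or> k = 2 \<or> k = (3::nat)" if "k < 4" for k using that by auto
  define zz where "zz k = z (if even k then 0 else 3) * z (if even (k div 2) then 1 else 4) * z (if k < 4 then 2 else 5)" for k :: nat
  show ?thesis
  proof (rule spin_fixed[OF X XX Ys Z YXZ, of F zz])
    show "isotropic (F k)" if "k < 4" for k
      using c4[OF that] uc gc by (elim disjE) (simp_all add: F isotropic_def e eu z0)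
    show "pairing (act_triple Y (F k)) P = pairing (F k) P" if "k < 4" for k P
    proof -
      have *: "pairing (Y *\<^sub>v f, Y *\<^sub>v g, Y *\<^sub>v h) P = pairing (f,g,h) P"
        if "f \<in> carrier_vec 6" "g \<in> carrier_vec 6" "h \<in> carrier_vec 6"
          "Y *\<^sub>v f = f" "Y *\<^sub>v g = w \<cdot>\<^sub>v g" "Y *\<^sub>v h = w^2 \<cdot>\<^sub>v h" for f g h
      proof -
        obtain r s t where P: "P = (r,s,t)" by (metis prod_cases3)
        have "pairing (Y *\<^sub>v f, Y *\<^sub>v g, Y *\<^sub>v h) P = w^3 * pairing (f,g,h) P"
          unfolding that(4-6) P pairing_def prod.case gram_def om_smult'[OF that(2)] om_smult'[OF that(3)]
          by (simp add: algebra_simps power2_eq_square power3_eq_cube)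
        thus ?thesis using w by simp
      qed
      have Y0: "Y *\<^sub>v u 0 = u 0" "Y *\<^sub>v u 1 = u 1" "Y *\<^sub>v u 2 = w \<cdot>\<^sub>v u 2" "Y *\<^sub>v u 3 = w \<cdot>\<^sub>v u 3"
        using Yu[of 0] Yu[of 1] Yu[of 2] Yu[of 3] by simp_all
      note Y0 = Y0 Y0[simplified]
      show ?thesis using c4[OF that]
        by (elim disjE; simp only: F act_triple_def prod.case; intro *; simp add: uc gc Y0 Yg)
    qed
    show "pairing (F k) (F (3 - k)) \<noteq> 0" if "k < 4" for k
      using c4[OF that] p n by (elim disjE) (simp_all add: F pairing_def gram_def e eu z0 zs Gd Gsym[of 1 0, simplified])
    show "pairing (F k) (F l) = 0" if "k < 4" "l < 4" "l \<noteq> 3 - k" for k l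
      using c4[OF that(1)] c4[OF that(2)] that(3)
      by (elim disjE) (simp_all add: F pairing_def gram_def e eu z0 zs Gd)
    show "pairing (act_triple (diag6 z) (lagr k)) P = zz k * pairing (lagr k) P" if "k < 8" for k P
    proof -
      have du: "diag6 z *\<^sub>v unit_vec 6 i = z i \<cdot>\<^sub>v unit_vec 6 i" if "i < 6" for i
        using that by (intro eq_vecI) (auto simp: diag6_def)
      obtain r s t where P: "P = (r,s,t)" by (metis prod_cases3)
      have *: "pairing (z i \<cdot>\<^sub>v unit_vec 6 i, z j \<cdot>\<^sub>v unit_vec 6 j, z m \<cdot>\<^sub>v unit_vec 6 m) P
        = z i * z j * z m * pairing (unit_vec 6 i, unit_vec 6 j, unit_vec 6 m) P" for i j m
        unfolding P pairing_def prod.case gram_def om_smult'[OF unit_vec_carrier] by (simp add: algebra_simps)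
      show ?thesis unfolding lagr_def act_triple_def prod.case zz_def by (subst (1 2 3) du) (auto simp: *)
    qed
    show "zz 3 = 1" "zz 4 = 1" using z(1,2) by (simp_all add: zz_def mult_ac)
    fix k :: nat assume "k < 8" "k \<noteq> 3" "k \<noteq> 4"
    hence "k = 0 \<or> k = 1 \<or> k = 2 \<or> k = 5 \<or> k = 6 \<or> k = 7" by auto
    thus "zz k \<noteq> 1" using z(3-) by (elim disjE) (simp_all add: zz_def)
  qed
qed

end

text \<open>A diagonal matrix stabilises every coordinate subspace, so under irreducibility
  \<open>X\<close> must lead out of each proper one.\<close>

lemma irreducible_pair_coordinates:
  fixes X :: "'a::field mat"
  assumes irr: "irreducible_pair X (diag6 z)" and X: "X \<in> carrier_mat 6 6"
    and S: "i \<in> S" "i < 6" "j \<notin> S" "j < 6"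
    and zero: "\<And>r c. r < 6 \<Longrightarrow> c < 6 \<Longrightarrow> r \<notin> S \<Longrightarrow> c \<in> S \<Longrightarrow> X $$ (r,c) = 0"
  shows False
proof -
  define W where "W = {v \<in> carrier_vec 6. \<forall>k<6. k \<notin> S \<longrightarrow> v $ k = (0::'a)}"
  have "W = {0\<^sub>v 6} \<or> W = carrier_vec 6"
  proof (rule irr[unfolded irreducible_pair_def, rule_format])
    show "X *\<^sub>v u \<in> W \<and> diag6 z *\<^sub>v u \<in> W" if u: "u \<in> W" for u
    proof
      have "(X *\<^sub>v u) $ k = 0" if k: "k < 6" "k \<notin> S" for k
      proof -
        have "(X *\<^sub>v u) $ k = (\<Sum>c = 0..<6. X $$ (k,c) * u $ c)"
          using X u k by (auto simp: W_def scalar_prod_def)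
        also have "\<dots> = 0" using u zero k by (intro sum.neutral) (auto simp: W_def)
        finally show ?thesis .
      qed
      thus "X *\<^sub>v u \<in> W" using X u by (auto simp: W_def)
      have "(diag6 z *\<^sub>v u) $ k = 0" if "k < 6" "k \<notin> S" for k
        using u that by (auto simp: W_def diag6_mult_vec)
      thus "diag6 z *\<^sub>v u \<in> W" using u diag6_carrier[of z] by (auto simp: W_def)
    qed
  qed (auto simp: W_def)
  moreover have "unit_vec 6 i \<in> W" using S by (auto simp: W_def)
  moreover have "unit_vec 6 i \<noteq> (0\<^sub>v 6 :: 'a vec)" using S by (metis index_unit_vec(2) index_zero_vec(1) one_neq_zero)
  moreover have "unit_vec 6 j \<notin> W" using S by (auto simp: W_def)
  ultimately show False by (metis singletonD unit_vec_carrier)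
qed

section \<open>Both coefficients of the fixed spin vector are nonzero\<close>

context char_two begin

text \<open>
  Let \<open>G\<close> be the matrix that expresses the columns 0, 1, 5 in terms of the columns 3, 4, 2. By
  isotropy it is symmetric, and by \<open>zero\<close> its principal minors of size 1 and 2 vanish, so \<open>G = 0\<close>.
\<close>

lemma lagrangian_cramer:
  assumes o: "omega p q = 0" "omega p r = 0" "omega q r = 0"
    and one: "minor p q r 2 3 4 \<noteq> 0"
    and zero: "minor p q r 0 2 4 = 0" "minor p q r 1 2 3 = 0" "minor p q r 3 4 5 = 0"
      "minor p q r 0 1 2 = 0" "minor p q r 0 4 5 = 0" "minor p q r 1 3 5 = 0"
    and c: "c \<in> {0,1,5}"
  shows "p c = 0 \<and> q c = 0 \<and> r c = 0"
proof -
  note con = contraction[OF o]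
  \<comment> \<open>Plucker relations, which express the principal minors of size 2 of
    \<open>G\<close>. By \<open>contraction\<close> the products of opposite off-diagonal entries
    are squares.\<close>
  have plucker: "minor p q r 0 2 4 * minor p q r 1 2 3 + minor p q r 0 2 3 * minor p q r 1 2 4 = minor p q r 0 1 2 * minor p q r 2 3 4"
    "minor p q r 0 2 4 * minor p q r 3 4 5 + minor p q r 0 3 4 * minor p q r 2 4 5 = minor p q r 0 4 5 * minor p q r 2 3 4"
    "minor p q r 1 2 3 * minor p q r 3 4 5 + minor p q r 1 3 4 * minor p q r 2 3 5 = minor p q r 1 3 5 * minor p q r 2 3 4"
    unfolding minor_def by (simp_all add: algebra_simps two_simps)
  have "minor p q r 0 2 3 * minor p q r 0 2 3 = 0" "minor p q r 0 3 4 * minor p q r 0 3 4 = 0"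
    "minor p q r 1 3 4 * minor p q r 1 3 4 = 0"
    using plucker unfolding zero con by simp_all
  hence z: "minor p q r 0 2 3 = 0" "minor p q r 0 3 4 = 0" "minor p q r 1 3 4 = 0" by simp_all
  have cramer: "minor p q r 2 3 4 * f 0 = minor p q r 0 2 4 * f 3 + minor p q r 0 2 3 * f 4 + minor p q r 0 3 4 * f 2"
    "minor p q r 2 3 4 * f 1 = minor p q r 1 2 4 * f 3 + minor p q r 1 2 3 * f 4 + minor p q r 1 3 4 * f 2"
    "minor p q r 2 3 4 * f 5 = minor p q r 2 4 5 * f 3 + minor p q r 2 3 5 * f 4 + minor p q r 3 4 5 * f 2"
    if "f = p \<or> f = q \<or> f = r" for f
    using that unfolding minor_def by (elim disjE; simp add: algebra_simps two_simps)+
  have "f 0 = 0" "f 1 = 0" "f 5 = 0" if "f = p \<or> f = q \<or> f = r" for f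
    using cramer[OF that] one unfolding con zero z by simp_all
  thus ?thesis using c by auto
qed

text \<open>An involution preserving \<open>omega\<close> is its own adjoint: this is
  self-adjointness in coordinates.\<close>

lemma symplectic_involution_entries:
  assumes X: "symplectic X" and XX: "X * X = 1\<^sub>m 6" and rc: "r < 6" "c < 6"
  shows "(X::'a mat) $$ (r,c) = X $$ ((c + 3) mod 6, (r + 3) mod 6)"
proof -
  have X6: "X \<in> carrier_mat 6 6" using X by (simp add: symplectic_def)
  have u: "omega f (vec_index (unit_vec 6 i)) = f ((i + 3) mod 6)" if "i < 6" for f :: "nat \<Rightarrow> 'a" and i
    using that unfolding less6 by (elim disjE) (simp_all add: omega_unit omega_unit[simplified])
  let ?r = "(r + 3) mod 6"
  have r: "?r < 6" "(?r + 3) mod 6 = r" using rc(1) unfolding less6 by auto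
  have XXu: "X *\<^sub>v (X *\<^sub>v unit_vec 6 ?r) = unit_vec 6 ?r"
    using X6 XX by (metis assoc_mult_mat_vec one_mult_mat_vec unit_vec_carrier)
  have "om (X *\<^sub>v unit_vec 6 c) (X *\<^sub>v (X *\<^sub>v unit_vec 6 ?r)) = om (unit_vec 6 c) (X *\<^sub>v unit_vec 6 ?r)"
    using X X6 by (simp add: symplectic_def)
  hence "om (X *\<^sub>v unit_vec 6 c) (unit_vec 6 ?r) = om (X *\<^sub>v unit_vec 6 ?r) (unit_vec 6 c)"
    unfolding XXu by (simp only: omega_sym)
  hence "(X *\<^sub>v unit_vec 6 c) $ r = (X *\<^sub>v unit_vec 6 ?r) $ ((c + 3) mod 6)"
    unfolding u[OF r(1)] u[OF rc(2)] r(2) .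
  thus ?thesis using X6 rc r by (simp add: scalar_prod_right_unit)
qed

text \<open>By the symmetry of the entries, the rows of \<open>X\<close> are its columns with both
  indices shifted by 3, so they inherit the orthogonality relations of the columns.\<close>

lemma symplectic_involution_rows:
  assumes X: "symplectic X" and XX: "X * X = 1\<^sub>m 6" and rs: "r < 6" "s < 6" "s \<noteq> (r + 3) mod 6"
  shows "omega (\<lambda>c. (X::'a mat) $$ (r,c)) (\<lambda>c. X $$ (s,c)) = 0"
proof -
  have X6: "X \<in> carrier_mat 6 6" using X by (simp add: symplectic_def)
  let ?r = "(r + 3) mod 6" and ?s = "(s + 3) mod 6"
  have e: "X $$ (t,k) = (X *\<^sub>v unit_vec 6 ((t + 3) mod 6)) $ m" if "t < 6" "k < 6" "(k + 3) mod 6 = m" for t k m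
    using symplectic_involution_entries[OF X XX that(1,2)] X6 that by (auto simp: scalar_prod_right_unit)
  have es: "X $$ (t,0) = (X *\<^sub>v unit_vec 6 ((t + 3) mod 6)) $ 3" "X $$ (t,1) = (X *\<^sub>v unit_vec 6 ((t + 3) mod 6)) $ 4"
    "X $$ (t,2) = (X *\<^sub>v unit_vec 6 ((t + 3) mod 6)) $ 5" "X $$ (t,3) = (X *\<^sub>v unit_vec 6 ((t + 3) mod 6)) $ 0"
    "X $$ (t,4) = (X *\<^sub>v unit_vec 6 ((t + 3) mod 6)) $ 1" "X $$ (t,5) = (X *\<^sub>v unit_vec 6 ((t + 3) mod 6)) $ 2"
    if "t < 6" for t by (rule e; use that in simp)+
  have "omega (\<lambda>c. X $$ (r,c)) (\<lambda>c. X $$ (s,c)) = om (X *\<^sub>v unit_vec 6 ?r) (X *\<^sub>v unit_vec 6 ?s)"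
    unfolding omega_def es[OF rs(1)] es[OF rs(2)] by (simp only: ac_simps)
  also have "\<dots> = om (unit_vec 6 ?r) (unit_vec 6 ?s)" using X by (simp add: symplectic_def)
  also have "\<dots> = 0" using rs unfolding less6 by (elim disjE) (simp_all add: omega_def)
  finally show ?thesis .
qed


text \<open>\<open>three_form 1 1\<close> is the part of the Dickson form that does not involve \<open>v 0\<close>.\<close>

definition three_form :: "'a \<Rightarrow> 'a \<Rightarrow> 'a vec \<Rightarrow> 'a vec \<Rightarrow> 'a vec \<Rightarrow> 'a" where
  "three_form a b u v w = a * minor (vec_index u) (vec_index v) (vec_index w) 2 3 4
    + b * minor (vec_index u) (vec_index v) (vec_index w) 0 1 5"

lemma three_form_pairing: "a * pairing (lagr 4) (u,v,w) + b * pairing (lagr 3) (u,v,w) = three_form a b u v w"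
  unfolding pairing_sym[of "lagr _"] pairing_lagr three_form_def ..

lemma minor_transpose:
  "minor (\<lambda>i. t i a) (\<lambda>i. t i b) (\<lambda>i. t i c) i j k = minor (t i) (t j) (t k) a b c"
  unfolding minor_def by (simp add: algebra_simps)

text \<open>Unit vectors with one index from each pair {i, i+3} form isotropic triples, so
  invariance can be tested on them. It becomes eight equations between minors of the rows 2, 3, 4
  and of the rows 0, 1, 5 of \<open>X\<close>.\<close>

lemma three_form_lagr:
  assumes X: "X \<in> carrier_mat 6 6" and inv: "\<And>P. isotropic P \<Longrightarrow>
      a * pairing (lagr 4) (act_triple X P) + b * pairing (lagr 3) (act_triple X P) = a * pairing (lagr 4) P + b * pairing (lagr 3) P"
    and ijk: "(i,j,k) \<in> {(0,1,2),(3,1,2),(0,4,2),(3,4,2),(0,1,5),(3,1,5),(0,4,5),(3,4,5)}"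
  shows "a * minor (\<lambda>c. X $$ (2,c)) (\<lambda>c. X $$ (3,c)) (\<lambda>c. X $$ (4,c)) i j k
    + b * minor (\<lambda>c. X $$ (0,c)) (\<lambda>c. X $$ (1,c)) (\<lambda>c. X $$ (5,c)) i j k
    = (if (i,j,k) = (3,4,2) then a else if (i,j,k) = (0,1,5) then b else 0)"
proof -
  have ijk6: "i < 6" "j < 6" "k < 6" using ijk by auto
  have "isotropic (unit_vec 6 i, unit_vec 6 j, unit_vec 6 k)"
    using ijk by (auto simp: isotropic_def omega_def)
  from inv[OF this] have "three_form a b (X *\<^sub>v unit_vec 6 i) (X *\<^sub>v unit_vec 6 j) (X *\<^sub>v unit_vec 6 k)
    = three_form a b (unit_vec 6 i) (unit_vec 6 j) (unit_vec 6 k)"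
    unfolding act_triple_def prod.case three_form_pairing .
  moreover have "minor (vec_index (X *\<^sub>v unit_vec 6 i)) (vec_index (X *\<^sub>v unit_vec 6 j)) (vec_index (X *\<^sub>v unit_vec 6 k)) l m n
    = minor (\<lambda>c. X $$ (l,c)) (\<lambda>c. X $$ (m,c)) (\<lambda>c. X $$ (n,c)) i j k" if "l < 6" "m < 6" "n < 6" for l m n
    using X ijk6 that minor_transpose[of "\<lambda>r c. X $$ (r,c)" i j k l m n]
    by (simp add: minor_def scalar_prod_right_unit)
  moreover have "three_form a b (unit_vec 6 i) (unit_vec 6 j) (unit_vec 6 k) =
    (if (i,j,k) = (3,4,2) then a else if (i,j,k) = (0,1,5) then b else 0)"
    using ijk by (auto simp: three_form_def minor_def)
  ultimately show ?thesis by (simp add: three_form_def)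
qed

text \<open>If \<open>b = 0\<close>, the eight equations and \<open>lagrangian_cramer\<close> make
  the rows 2, 3, 4 of \<open>X\<close> vanish in the columns 0, 1, 5, so \<open>X\<close> stabilises
  the span of the unit vectors 0, 1, 5. If \<open>a = 0\<close>, it stabilises the complementary
  span.\<close>

lemma spin_coefficients_nonzero:
  assumes X: "symplectic X" and XX: "X * X = 1\<^sub>m 6" and irr: "irreducible_pair X (diag6 z)"
    and ab: "a \<noteq> 0 \<or> b \<noteq> 0" and inv: "\<And>P. isotropic P \<Longrightarrow>
      a * pairing (lagr 4) (act_triple X P) + b * pairing (lagr 3) (act_triple X P) = a * pairing (lagr 4) P + b * pairing (lagr 3) P"
  shows "a \<noteq> 0" "b \<noteq> 0"
proof -
  have X6: "X \<in> carrier_mat 6 6" using X by (simp add: symplectic_def)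
  note l = three_form_lagr[OF X6 inv]
  note o = symplectic_involution_rows[OF X XX]
  show "b \<noteq> 0"
  proof
    assume b: "b = 0"
    hence a: "a \<noteq> 0" using ab by simp
    let ?p = "\<lambda>c. X $$ (2,c)" and ?q = "\<lambda>c. X $$ (3,c)" and ?r = "\<lambda>c. X $$ (4,c)"
    have m: "minor ?p ?q ?r 2 3 4 \<noteq> 0" "minor ?p ?q ?r 0 2 4 = 0" "minor ?p ?q ?r 1 2 3 = 0" "minor ?p ?q ?r 3 4 5 = 0"
      "minor ?p ?q ?r 0 1 2 = 0" "minor ?p ?q ?r 0 4 5 = 0" "minor ?p ?q ?r 1 3 5 = 0"
      using l[of 3 4 2] l[of 0 4 2] l[of 3 1 2] l[of 3 4 5] l[of 0 1 2] l[of 0 4 5] l[of 3 1 5] a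
      by (auto simp: b minor_sort)
    have "?p c = 0 \<and> ?q c = 0 \<and> ?r c = 0" if "c \<in> {0,1,5}" for c
      by (rule lagrangian_cramer[OF _ _ _ m that]) (rule o; simp)+
    thus False
      by (intro irreducible_pair_coordinates[OF irr X6, of 0 "{0,1,5}" 2]) (auto simp: less6)
  qed
  show "a \<noteq> 0"
  proof
    assume a: "a = 0"
    hence b: "b \<noteq> 0" using ab by simp
    \<comment> \<open>Shifting the columns by 3 preserves \<open>omega\<close> and exchanges the
      index sets {0, 1, 5} and {2, 3, 4}, so the same lemma applies.\<close>
    define t where "t r c = X $$ (r, (c + 3) mod 6)" for r c
    let ?p = "t 0" and ?q = "t 1" and ?r = "t 5"
    have tm: "minor ?p ?q ?r i j k = minor (\<lambda>c. X $$ (0,c)) (\<lambda>c. X $$ (1,c)) (\<lambda>c. X $$ (5,c)) ((i + 3) mod 6) ((j + 3) mod 6) ((k + 3) mod 6)"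
      for i j k by (simp add: minor_def t_def)
    have m: "minor ?p ?q ?r 2 3 4 \<noteq> 0" "minor ?p ?q ?r 0 2 4 = 0" "minor ?p ?q ?r 1 2 3 = 0" "minor ?p ?q ?r 3 4 5 = 0"
      "minor ?p ?q ?r 0 1 2 = 0" "minor ?p ?q ?r 0 4 5 = 0" "minor ?p ?q ?r 1 3 5 = 0"
      unfolding tm using l[of 0 1 5] l[of 3 1 5] l[of 0 4 5] l[of 0 1 2] l[of 3 4 5] l[of 3 1 2] l[of 0 4 2] b
      by (auto simp: a minor_sort)
    have "omega (t r) (t s) = omega (\<lambda>c. X $$ (r,c)) (\<lambda>c. X $$ (s,c))" for r s
    proof -
      have n: "(0 + 3) mod 6 = (3::nat)" "(1 + 3) mod 6 = (4::nat)" "(2 + 3) mod 6 = (5::nat)"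
        "(3 + 3) mod 6 = (0::nat)" "(4 + 3) mod 6 = (1::nat)" "(5 + 3) mod 6 = (2::nat)" by simp_all
      show ?thesis unfolding omega_def t_def n by (simp only: ac_simps)
    qed
    hence o': "omega (t r) (t s) = 0" if "r < 6" "s < 6" "s \<noteq> (r + 3) mod 6" for r s using o that by simp
    have t: "?p c = 0 \<and> ?q c = 0 \<and> ?r c = 0" if "c \<in> {0,1,5}" for c
      by (rule lagrangian_cramer[OF _ _ _ m that]) (rule o'; simp)+
    have "X $$ (r,c) = 0" if "r < 6" "c < 6" "r \<notin> {2,3,4}" "c \<in> {2,3,4}" for r c
      using t[of "(c + 3) mod 6"] that by (auto simp: less6 t_def)
    thus False
      by (intro irreducible_pair_coordinates[OF irr X6, of 2 "{2,3,4}" 0]) auto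
  qed
qed


section \<open>The trivector is preserved up to a multiple of omega\<close>

lemma minor_mult:
  assumes X: "(X::'a mat) \<in> carrier_mat 6 6" and "u \<in> carrier_vec 6" "v \<in> carrier_vec 6" "w \<in> carrier_vec 6"
    and "i < 6" "j < 6" "k < 6"
  shows "minor (vec_index (X *\<^sub>v u)) (vec_index (X *\<^sub>v v)) (vec_index (X *\<^sub>v w)) i j k =
    (let f = (\<lambda>c. X $$ (i,c)); g = (\<lambda>c. X $$ (j,c)); h = (\<lambda>c. X $$ (k,c));
       u = vec_index u; v = vec_index v; w = vec_index w in
     dot f u * (dot g v * dot h w + dot g w * dot h v) + dot f v * (dot g u * dot h w + dot g w * dot h u)
     + dot f w * (dot g u * dot h v + dot g v * dot h u))"
proof -
  have d: "(X *\<^sub>v t) $ r = dot (\<lambda>c. X $$ (r,c)) (vec_index t)" if "r < 6" "t \<in> carrier_vec 6" for r t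
  proof -
    have "(X *\<^sub>v t) $ r = (\<Sum>c<6. X $$ (r,c) * t $ c)"
      using X that by (auto simp: scalar_prod_def lessThan_atLeast0)
    thus ?thesis by (simp add: sum6 dot_def)
  qed
  show ?thesis unfolding minor_def d[OF assms(5) assms(2)] d[OF assms(5) assms(3)] d[OF assms(5) assms(4)]
    d[OF assms(6) assms(2)] d[OF assms(6) assms(3)] d[OF assms(6) assms(4)]
    d[OF assms(7) assms(2)] d[OF assms(7) assms(3)] d[OF assms(7) assms(4)] Let_def
    by (simp add: algebra_simps)
qed

text \<open>The left side is the wedge product of the functional \<open>r\<close> with
  \<open>omega\<close>, and \<open>contraction_identity\<close> expands it in minors.\<close>

lemma dot_contraction:
  "dot r u * omega v w + dot r v * omega u w + dot r w * omega u v =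
    r 0 * (minor u v w 0 2 5 + minor u v w 0 1 4) + r 1 * (minor u v w 1 2 5 + minor u v w 0 1 3)
  + r 2 * (minor u v w 1 2 4 + minor u v w 0 2 3) + r 3 * (minor u v w 2 3 5 + minor u v w 1 3 4)
  + r 4 * (minor u v w 2 4 5 + minor u v w 0 3 4) + r 5 * (minor u v w 1 4 5 + minor u v w 0 3 5)"
  unfolding contraction_identity dot_def by (simp add: distrib_left distrib_right mult.assoc add_ac)

text \<open>The trivector pulled back along \<open>X\<close> agrees with the original at the eight
  coordinates of the spin module. Its other twelve coordinates agree two by two because the rows of
  \<open>X\<close> are isotropic, and a trivector of that kind is a multiple of
  \<open>omega\<close>.\<close>

lemma three_form_shift:
  assumes X: "symplectic X" and XX: "X * X = 1\<^sub>m 6" and inv: "\<And>P. isotropic P \<Longrightarrow>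
      a * pairing (lagr 4) (act_triple X P) + b * pairing (lagr 3) (act_triple X P) = a * pairing (lagr 4) P + b * pairing (lagr 3) P"
  shows "\<exists>r. \<forall>u\<in>carrier_vec 6. \<forall>v\<in>carrier_vec 6. \<forall>w\<in>carrier_vec 6.
    three_form a b (X *\<^sub>v u) (X *\<^sub>v v) (X *\<^sub>v w) = three_form a b u v w
      + (dot r (vec_index u) * om v w + dot r (vec_index v) * om u w + dot r (vec_index w) * om u v)"
proof -
  have X6: "X \<in> carrier_mat 6 6" using X by (simp add: symplectic_def)
  note o = symplectic_involution_rows[OF X XX]
  define A where "A = minor (\<lambda>c. X $$ (2,c)) (\<lambda>c. X $$ (3,c)) (\<lambda>c. X $$ (4,c))"
  define B where "B = minor (\<lambda>c. X $$ (0,c)) (\<lambda>c. X $$ (1,c)) (\<lambda>c. X $$ (5,c))"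
  define e where "e i j k = a * A i j k + b * B i j k" for i j k
  have Ac: "A 0 2 5 = A 0 1 4" "A 2 3 5 = A 1 3 4" "A 1 2 5 = A 0 1 3" "A 2 4 5 = A 0 3 4" "A 1 2 4 = A 0 2 3" "A 1 4 5 = A 0 3 5"
    unfolding A_def by (rule contraction; rule o; simp)+
  have Bc: "B 0 2 5 = B 0 1 4" "B 2 3 5 = B 1 3 4" "B 1 2 5 = B 0 1 3" "B 2 4 5 = B 0 3 4" "B 1 2 4 = B 0 2 3" "B 1 4 5 = B 0 3 5"
    unfolding B_def by (rule contraction; rule o; simp)+
  have ec: "e 0 2 5 = e 0 1 4" "e 2 3 5 = e 1 3 4" "e 1 2 5 = e 0 1 3" "e 2 4 5 = e 0 3 4" "e 1 2 4 = e 0 2 3" "e 1 4 5 = e 0 3 5"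
    unfolding e_def Ac Bc by (rule refl)+
  note l = three_form_lagr[OF X6 inv, folded A_def B_def, folded e_def]
  have As: "i < j \<Longrightarrow> A j i k = A i j k" "j < k \<Longrightarrow> A i k j = A i j k"
    "i < j \<Longrightarrow> B j i k = B i j k" "j < k \<Longrightarrow> B i k j = B i j k" for i j k
    unfolding A_def B_def by (rule minor_sort; assumption)+
  hence es: "i < j \<Longrightarrow> e j i k = e i j k" "j < k \<Longrightarrow> e i k j = e i j k" for i j k
    by (auto simp: e_def)
  have ez: "e 0 1 2 = 0" "e 1 2 3 = 0" "e 0 2 4 = 0" "e 2 3 4 = a" "e 0 1 5 = b" "e 1 3 5 = 0" "e 0 4 5 = 0" "e 3 4 5 = 0"
    using l[of 0 1 2] l[of 3 1 2] l[of 0 4 2] l[of 3 4 2] l[of 0 1 5] l[of 3 1 5] l[of 0 4 5] l[of 3 4 5]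
    by (simp_all add: es)
  \<comment> \<open>One representative of each of the six equalities \<open>ec\<close>, placed at
    the coordinate to which \<open>dot_contraction\<close> assigns it.\<close>
  define r where "r i = [e 0 1 4, e 0 1 3, e 0 2 3, e 1 3 4, e 0 3 4, e 0 3 5] ! i" for i
  have rs: "r 0 = e 0 1 4" "r 1 = e 0 1 3" "r 2 = e 0 2 3" "r 3 = e 1 3 4" "r 4 = e 0 3 4" "r 5 = e 0 3 5"
    by (simp_all add: r_def)
  show ?thesis
  proof (intro exI[of _ r] ballI)
    fix u v w :: "'a vec" assume uvw: "u \<in> carrier_vec 6" "v \<in> carrier_vec 6" "w \<in> carrier_vec 6"
    define m where "m = minor (vec_index u) (vec_index v) (vec_index w)"
    have mm: "minor (vec_index (X *\<^sub>v u)) (vec_index (X *\<^sub>v v)) (vec_index (X *\<^sub>v w)) i j k =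
      (let t = minor (\<lambda>c. X $$ (i,c)) (\<lambda>c. X $$ (j,c)) (\<lambda>c. X $$ (k,c)) in
       t 0 1 2 * m 0 1 2 + t 0 1 3 * m 0 1 3 + t 0 1 4 * m 0 1 4 + t 0 1 5 * m 0 1 5
       + t 0 2 3 * m 0 2 3 + t 0 2 4 * m 0 2 4 + t 0 2 5 * m 0 2 5 + t 0 3 4 * m 0 3 4
       + t 0 3 5 * m 0 3 5 + t 0 4 5 * m 0 4 5 + t 1 2 3 * m 1 2 3 + t 1 2 4 * m 1 2 4
       + t 1 2 5 * m 1 2 5 + t 1 3 4 * m 1 3 4 + t 1 3 5 * m 1 3 5 + t 1 4 5 * m 1 4 5
       + t 2 3 4 * m 2 3 4 + t 2 3 5 * m 2 3 5 + t 2 4 5 * m 2 4 5 + t 3 4 5 * m 3 4 5)"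
      if "i < 6" "j < 6" "k < 6" for i j k
      unfolding minor_mult[OF X6 uvw that] Let_def m_def by (rule cauchy_binet)
    have n: "0 < (6::nat)" "1 < (6::nat)" "2 < (6::nat)" "3 < (6::nat)" "4 < (6::nat)" "5 < (6::nat)" by simp_all
    have "three_form a b (X *\<^sub>v u) (X *\<^sub>v v) (X *\<^sub>v w) =
       e 0 1 2 * m 0 1 2 + e 0 1 3 * m 0 1 3 + e 0 1 4 * m 0 1 4 + e 0 1 5 * m 0 1 5
       + e 0 2 3 * m 0 2 3 + e 0 2 4 * m 0 2 4 + e 0 2 5 * m 0 2 5 + e 0 3 4 * m 0 3 4
       + e 0 3 5 * m 0 3 5 + e 0 4 5 * m 0 4 5 + e 1 2 3 * m 1 2 3 + e 1 2 4 * m 1 2 4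
       + e 1 2 5 * m 1 2 5 + e 1 3 4 * m 1 3 4 + e 1 3 5 * m 1 3 5 + e 1 4 5 * m 1 4 5
       + e 2 3 4 * m 2 3 4 + e 2 3 5 * m 2 3 5 + e 2 4 5 * m 2 4 5 + e 3 4 5 * m 3 4 5"
      unfolding three_form_def
        mm[OF n(3-5), unfolded Let_def, folded A_def] mm[OF n(1,2,6), unfolded Let_def, folded B_def] e_def
      by (simp only: algebra_simps)
    also have "\<dots> = a * m 2 3 4 + b * m 0 1 5
      + (e 0 1 4 * (m 0 2 5 + m 0 1 4) + e 0 1 3 * (m 1 2 5 + m 0 1 3)
       + e 0 2 3 * (m 1 2 4 + m 0 2 3) + e 1 3 4 * (m 2 3 5 + m 1 3 4)
       + e 0 3 4 * (m 2 4 5 + m 0 3 4) + e 0 3 5 * (m 1 4 5 + m 0 3 5))"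
      unfolding ec ez by (simp add: distrib_left add_ac)
    finally show "three_form a b (X *\<^sub>v u) (X *\<^sub>v v) (X *\<^sub>v w) = three_form a b u v w
      + (dot r (vec_index u) * om v w + dot r (vec_index v) * om u w + dot r (vec_index w) * om u v)"
      unfolding dot_contraction rs three_form_def m_def .
  qed
qed

end

section \<open>The standard Dickson form\<close>

lemma GL_carrier_iff: "A \<in> carrier (GL TYPE('a::field) n) \<longleftrightarrow>
    A \<in> carrier_mat n n \<and> (\<exists>B\<in>carrier_mat n n. A * B = 1\<^sub>m n \<and> B * A = 1\<^sub>m n)"
  by (auto simp: GL_def units_of_def Units_def ring_mat_simps)

lemma GL_mult: "A \<otimes>\<^bsub>GL TYPE('a::field) n\<^esub> B = A * B" and GL_one: "\<one>\<^bsub>GL TYPE('a) n\<^esub> = 1\<^sub>m n"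
  by (simp_all add: GL_def units_of_def ring_mat_simps)

lemma GL_group: "group (GL TYPE('a::field) n)"
proof -
  interpret ring "ring_mat TYPE('a) n ()" by (rule ring_mat)
  show ?thesis unfolding GL_def by (rule units_group)
qed

text \<open>The order 1, 2, 3, -1, -2, -3, 0 places opposite vectors three apart, as in
  \<open>omega\<close>, and \<open>v 0\<close> last, as in \<open>cone_mat\<close>.\<close>

definition std_index :: "int \<Rightarrow> nat" where
  "std_index i = (if i = 0 then 6 else if i > 0 then nat i - 1 else nat (- i) + 2)"

definition std_basis :: "int \<Rightarrow> 'a::field vec" where
  "std_basis i = unit_vec 7 (std_index i)"

definition std_dickson :: "'a::field vec \<Rightarrow> 'a vec \<Rightarrow> 'a vec \<Rightarrow> 'a" where
  "std_dickson x y z = (let d = std_basis in wedge3 (d 0) (d 1) (d (-1)) x y z + wedge3 (d 0) (d 2) (d (-2)) x y z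
                + wedge3 (d 0) (d 3) (d (-3)) x y z + wedge3 (d 1) (d 2) (d (-3)) x y z
                + wedge3 (d (-1)) (d (-2)) (d 3) x y z)"

lemma int_interval: "{-3..3::int} = {0,1,2,3,-1,-2,-3}"
  by auto

lemma std_index_image: "std_index ` {-3..3} = {0..<7}"
  unfolding int_interval by (auto simp: std_index_def)

lemma std_index_inj: "i \<in> {-3..3} \<Longrightarrow> j \<in> {-3..3} \<Longrightarrow> std_index i = std_index j \<longleftrightarrow> i = j"
  by (auto simp: std_index_def split: if_splits)

lemma std_basis_simps:
  "std_basis 0 = unit_vec 7 6" "std_basis 1 = unit_vec 7 0" "std_basis 2 = unit_vec 7 1" "std_basis 3 = unit_vec 7 2"
  "std_basis (-1) = unit_vec 7 3" "std_basis (-2) = unit_vec 7 4" "std_basis (-3) = unit_vec 7 5"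
  by (simp_all add: std_basis_def std_index_def eval_nat_numeral)

lemma std_dual_bases: "dual_bases7 (std_basis :: int \<Rightarrow> 'a::field vec) std_basis"
proof -
  interpret vec_space "TYPE('a)" 7 .
  have "(std_basis :: int \<Rightarrow> 'a vec) ` {-3..3} = unit_vec 7 ` (std_index ` {-3..3})"
    unfolding image_image std_basis_def ..
  also have "\<dots> = set (unit_vecs 7)" unfolding std_index_image unit_vecs_def by simp
  finally have "basis ((std_basis :: int \<Rightarrow> 'a vec) ` {-3..3})" using unit_vecs_basis by simp
  moreover have "std_basis i \<bullet> (std_basis j :: 'a vec) = (if i = j then 1 else 0)" if "i \<in> {-3..3}" "j \<in> {-3..3}" for i j
  proof -
    have "std_index i < 7" "std_index j < 7" using that std_index_image by fastforce+
    thus ?thesis using std_index_inj[OF that] by (auto simp: std_basis_def scalar_prod_left_unit)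
  qed
  ultimately show ?thesis by (simp add: dual_bases7_def std_basis_def)
qed

lemma std_dickson_basis: "dickson_basis (std_dickson :: 'a::field vec \<Rightarrow> _) std_basis std_basis"
  unfolding dickson_basis_def using std_dual_bases by (simp add: std_dickson_def Let_def)

text \<open>The matrix \<open>[[h, 0], [r, 1]]\<close>; the last coordinate belongs to \<open>v 0\<close>.\<close>

definition cone_mat :: "'a::field mat \<Rightarrow> (nat \<Rightarrow> 'a) \<Rightarrow> 'a mat" where
  "cone_mat h r = mat 7 7 (\<lambda>(i,j). if j < 6 then (if i < 6 then h $$ (i,j) else r j) else if i = j then 1 else 0)"

lemma sum7: "(\<Sum>k = 0..<7. f k) = (\<Sum>k<6. f k) + f (6::nat)" for f :: "nat \<Rightarrow> 'a::comm_monoid_add"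
proof -
  have "{0..<7} = insert 6 {..<6::nat}" by auto
  thus ?thesis by (simp add: add.commute)
qed

lemma mult_mat_index7:
  fixes A :: "'a::comm_ring_1 mat"
  assumes "A \<in> carrier_mat m 7" "B \<in> carrier_mat 7 n" "i < m" "j < n"
  shows "(A * B) $$ (i,j) = (\<Sum>k<6. A $$ (i,k) * B $$ (k,j)) + A $$ (i,6) * B $$ (6,j)"
  using assms by (simp add: scalar_prod_def sum7)

lemma cone_mat_mult:
  assumes "h \<in> carrier_mat 6 6" "h' \<in> carrier_mat 6 6"
  shows "cone_mat h r * cone_mat h' r' = cone_mat (h * h') (\<lambda>j. (\<Sum>k<6. r k * h' $$ (k,j)) + r' j)"
proof (rule eq_matI)
  fix i j assume "i < dim_row (cone_mat (h * h') (\<lambda>j. (\<Sum>k<6. r k * h' $$ (k,j)) + r' j))"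
    "j < dim_col (cone_mat (h * h') (\<lambda>j. (\<Sum>k<6. r k * h' $$ (k,j)) + r' j))"
  hence ij: "i < 7" "j < 7" by (auto simp: cone_mat_def)
  have "(cone_mat h r * cone_mat h' r') $$ (i,j) =
      (\<Sum>k<6. cone_mat h r $$ (i,k) * cone_mat h' r' $$ (k,j)) + cone_mat h r $$ (i,6) * cone_mat h' r' $$ (6,j)"
    by (rule mult_mat_index7) (use ij in \<open>auto simp: cone_mat_def\<close>)
  also have "\<dots> = cone_mat (h * h') (\<lambda>j. (\<Sum>k<6. r k * h' $$ (k,j)) + r' j) $$ (i,j)"
    using ij assms by (auto simp: cone_mat_def scalar_prod_def lessThan_atLeast0 intro!: sum.cong)
  finally show "(cone_mat h r * cone_mat h' r') $$ (i,j) = cone_mat (h * h') (\<lambda>j. (\<Sum>k<6. r k * h' $$ (k,j)) + r' j) $$ (i,j)" .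
qed (auto simp: cone_mat_def)

lemma cone_mat_one: "cone_mat (1\<^sub>m 6) (\<lambda>_. 0) = 1\<^sub>m 7"
  by (rule eq_matI) (auto simp: cone_mat_def)

lemma cone_mat_cong: "(\<And>j. j < 6 \<Longrightarrow> r j = r' j) \<Longrightarrow> cone_mat h r = cone_mat h r'"
  by (rule eq_matI) (auto simp: cone_mat_def)

lemma cone_mat_GL:
  assumes "h \<in> carrier (GL TYPE('a::field) 6)"
  shows "cone_mat h r \<in> carrier (GL TYPE('a) 7)"
proof -
  obtain k where h: "h \<in> carrier_mat 6 6" and k: "k \<in> carrier_mat 6 6" "h * k = 1\<^sub>m 6" "k * h = 1\<^sub>m 6"
    using assms by (auto simp: GL_carrier_iff)
  \<comment> \<open>The inverse of \<open>[[h, 0], [r, 1]]\<close> has the last row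
    \<open>[- r k, 1]\<close>, with \<open>k\<close> the inverse of \<open>h\<close>.\<close>
  define s where "s j = - (\<Sum>i<6. r i * k $$ (i,j))" for j
  have "(\<Sum>i<6. s i * h $$ (i,j)) = - r j" if "j < 6" for j
  proof -
    have "(\<Sum>i<6. s i * h $$ (i,j)) = - (\<Sum>i<6. \<Sum>l<6. r l * (k $$ (l,i) * h $$ (i,j)))"
      by (simp add: s_def sum_negf sum_distrib_right mult.assoc)
    also have "\<dots> = - (\<Sum>l<6. r l * (k * h) $$ (l,j))"
      using h k(1) that by (subst sum.swap) (simp add: scalar_prod_def lessThan_atLeast0 sum_distrib_left)
    also have "\<dots> = - r j"
      using that by (simp add: k(3) if_distrib[of "\<lambda>x. _ * x"] sum.delta cong: if_cong)
    finally show ?thesis .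
  qed
  hence "cone_mat k s * cone_mat h r = 1\<^sub>m 7" "cone_mat h r * cone_mat k s = 1\<^sub>m 7"
    unfolding cone_mat_mult[OF k(1) h] cone_mat_mult[OF h k(1)] k(2,3) cone_mat_one[symmetric]
    by (auto intro!: cone_mat_cong simp: s_def)
  thus ?thesis by (auto simp: GL_carrier_iff cone_mat_def)
qed

lemma quotient_projection_std:
  "quotient_projection std_basis = (mat 6 7 (\<lambda>(i,j). if i = j then 1 else 0) :: 'a::field mat)"
proof (rule eq_matI)
  fix i j assume "i < dim_row (mat 6 7 (\<lambda>(i,j). if i = j then 1 else 0) :: 'a mat)"
    "j < dim_col (mat 6 7 (\<lambda>(i,j). if i = j then 1 else 0) :: 'a mat)"
  hence ij: "i < 6" "j < 7" by auto
  thus "quotient_projection std_basis $$ (i,j) = (mat 6 7 (\<lambda>(i,j). if i = j then 1 else 0) :: 'a mat) $$ (i,j)"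
    unfolding less6 by (elim disjE) (simp_all add: quotient_projection_def std_basis_def std_index_def mat_of_rows_def)
qed (auto simp: quotient_projection_def)

lemma quotient_projection_cone:
  assumes "h \<in> carrier_mat 6 6"
  shows "h * quotient_projection std_basis = quotient_projection std_basis * cone_mat h r"
proof (rule eq_matI)
  let ?p = "mat 6 7 (\<lambda>(i,j). if i = j then 1 else 0) :: 'a mat"
  fix i j assume "i < dim_row (quotient_projection std_basis * cone_mat h r)" "j < dim_col (quotient_projection std_basis * cone_mat h r)"
  hence ij: "i < 6" "j < 7" by (auto simp: quotient_projection_std cone_mat_def)
  have "(h * ?p) $$ (i,j) = (\<Sum>k<6. h $$ (i,k) * (if k = j then 1 else 0))"
    using assms ij by (simp add: scalar_prod_def lessThan_atLeast0)
  also have "\<dots> = (if j < 6 then h $$ (i,j) else 0)"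
    by (simp add: if_distrib[of "\<lambda>x. _ * x"] sum.delta cong: if_cong)
  also have "\<dots> = (\<Sum>k<6. (if i = k then 1 else 0) * cone_mat h r $$ (k,j)) + (if i = 6 then 1 else 0) * cone_mat h r $$ (6,j)"
    using ij by (simp add: if_distrib[of "\<lambda>x. x * _"] sum.delta cone_mat_def cong: if_cong)
  also have "\<dots> = (?p * cone_mat h r) $$ (i,j)"
    using ij by (subst mult_mat_index7[of _ 6 _ 7]) (auto simp: cone_mat_def intro!: sum.cong)
  finally show "(h * quotient_projection std_basis) $$ (i,j) = (quotient_projection std_basis * cone_mat h r) $$ (i,j)"
    unfolding quotient_projection_std .
qed (use assms in \<open>auto simp: quotient_projection_std cone_mat_def\<close>)

context char_two begin

text \<open>The three summands containing \<open>v 0\<close> assemble to \<open>omega\<close>, and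
  the two others are the minors 0 1 5 and 2 3 4; signs disappear in characteristic 2.\<close>

lemma std_dickson_eq:
  assumes "x \<in> carrier_vec 7" "y \<in> carrier_vec 7" "z \<in> carrier_vec 7"
  shows "std_dickson x y z = x $ 6 * om y z + y $ 6 * om x z + z $ 6 * om x y + three_form 1 1 x y (z :: 'a vec)"
proof -
  have w: "wedge3 (unit_vec 7 i) (unit_vec 7 j) (unit_vec 7 k) x y z = minor (vec_index x) (vec_index y) (vec_index z) i j k"
    if "i < 7" "j < 7" "k < 7" for i j k
  proof -
    have "mat_of_rows_list 3 [[p,q,r],[p',q',r'],[p'',q'',r'']] \<in> carrier_mat 3 3" for p q r p' q' r' p'' q'' r'' :: 'a
      by (simp add: mat_of_rows_list_def numeral_3_eq_3)
    note d = det_3[OF this]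
    show ?thesis unfolding wedge3_def d using that assms
      by (simp add: mat_of_rows_list_def scalar_prod_left_unit minor_def algebra_simps two_simps)
  qed
  have n: "0 < (7::nat)" "1 < (7::nat)" "2 < (7::nat)" "3 < (7::nat)" "4 < (7::nat)" "5 < (7::nat)" "6 < (7::nat)" by simp_all
  show ?thesis
    unfolding std_dickson_def Let_def std_basis_simps w[OF n(7,1,4)] w[OF n(7,2,5)] w[OF n(7,3,6)] w[OF n(1,2,6)] w[OF n(4,5,3)]
    by (simp add: three_form_def minor_def omega_def algebra_simps two_simps)
qed

end

section \<open>Closure properties and reduction to generators\<close>

lemma GL_closed:
  assumes "A \<in> carrier (GL TYPE('a::field) n)" "B \<in> carrier (GL TYPE('a) n)"
  shows "A * B \<in> carrier (GL TYPE('a) n)"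
  using group.subgroup_self[OF GL_group, THEN subgroup.m_closed, OF assms] by (simp add: GL_mult)

lemma G2_mult:
  assumes "g \<in> G2 (D :: 'a::field vec \<Rightarrow> _)" "h \<in> G2 D"
  shows "g * h \<in> G2 D"
proof -
  have c: "g \<in> carrier_mat 7 7" "h \<in> carrier_mat 7 7" using assms by (auto simp: G2_def GL_carrier_iff)
  show ?thesis using assms c GL_closed[of g 7 h] unfolding G2_def by auto
qed

lemma G2_dim6_mult:
  assumes "g \<in> G2_dim6 (D :: 'a::field vec \<Rightarrow> _) d" "h \<in> G2_dim6 D d"
  shows "g * h \<in> G2_dim6 D d"
proof -
  let ?p = "quotient_projection d"
  obtain g' h' where g: "g' \<in> G2 D" "g * ?p = ?p * g'" and h: "h' \<in> G2 D" "h * ?p = ?p * h'"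
    using assms by (auto simp: G2_dim6_def)
  have c: "g \<in> carrier_mat 6 6" "h \<in> carrier_mat 6 6" "g' \<in> carrier_mat 7 7" "h' \<in> carrier_mat 7 7" "?p \<in> carrier_mat 6 7"
    using assms g h by (auto simp: G2_dim6_def G2_def GL_carrier_iff quotient_projection_def)
  have "g * h * ?p = g * (h * ?p)" using c by simp
  also have "\<dots> = (g * ?p) * h'" unfolding h(2) by (rule assoc_mult_mat[symmetric, OF c(1,5,4)])
  also have "\<dots> = ?p * (g' * h')" unfolding g(2) by (rule assoc_mult_mat[OF c(5,3,4)])
  finally show ?thesis
    using assms g h G2_mult[of g' D h'] GL_closed[of g 6 h] by (auto simp: G2_dim6_def)
qed

lemma G2_dim6_inverse:
  assumes h: "h \<in> G2_dim6 (D :: 'a::field vec \<Rightarrow> _) d"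
  shows "inv\<^bsub>GL TYPE('a) 6\<^esub> h \<in> G2_dim6 D d"
proof -
  let ?p = "quotient_projection d"
  interpret G6: group "GL TYPE('a) 6" by (rule GL_group)
  interpret G7: group "GL TYPE('a) 7" by (rule GL_group)
  obtain g where g: "g \<in> G2 D" "h * ?p = ?p * g" using h by (auto simp: G2_dim6_def)
  have hG: "h \<in> carrier (GL TYPE('a) 6)" and gG: "g \<in> carrier (GL TYPE('a) 7)"
    using h g by (auto simp: G2_dim6_def G2_def)
  define k where "k = inv\<^bsub>GL TYPE('a) 6\<^esub> h"
  define l where "l = inv\<^bsub>GL TYPE('a) 7\<^esub> g"
  have kG: "k \<in> carrier (GL TYPE('a) 6)" and lG: "l \<in> carrier (GL TYPE('a) 7)"
    using hG gG by (auto simp: k_def l_def)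
  have kh: "k * h = 1\<^sub>m 6" and gl: "g * l = 1\<^sub>m 7"
    using G6.l_inv[OF hG] G7.r_inv[OF gG] by (simp_all add: k_def l_def GL_mult GL_one)
  have c: "h \<in> carrier_mat 6 6" "k \<in> carrier_mat 6 6" "g \<in> carrier_mat 7 7" "l \<in> carrier_mat 7 7" "?p \<in> carrier_mat 6 7"
    using hG kG gG lG by (auto simp: GL_carrier_iff quotient_projection_def)
  have "k * ?p = k * (?p * (g * l))" using c by (simp add: gl)
  also have "?p * (g * l) = (h * ?p) * l" unfolding g(2) by (rule assoc_mult_mat[symmetric, OF c(5,3,4)])
  also have "k * (h * ?p * l) = (k * h) * (?p * l)"
    using c by (simp add: assoc_mult_mat[OF c(1,5,4)] assoc_mult_mat[OF c(2,1), of "?p * l" 7])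
  also have "\<dots> = ?p * l" using c by (simp add: kh)
  finally have kp: "k * ?p = ?p * l" .
  have "l \<in> G2 D" unfolding G2_def
  proof (intro CollectI conjI lG ballI)
    fix x y z :: "'a vec" assume xyz: "x \<in> carrier_vec 7" "y \<in> carrier_vec 7" "z \<in> carrier_vec 7"
    have "g *\<^sub>v (l *\<^sub>v t) = t" if "t \<in> carrier_vec 7" for t
      using that c gl by (metis assoc_mult_mat_vec one_mult_mat_vec)
    moreover have "D (g *\<^sub>v (l *\<^sub>v x)) (g *\<^sub>v (l *\<^sub>v y)) (g *\<^sub>v (l *\<^sub>v z)) = D (l *\<^sub>v x) (l *\<^sub>v y) (l *\<^sub>v z)"
      using g(1) c(4) xyz unfolding G2_def by auto
    ultimately show "D (l *\<^sub>v x) (l *\<^sub>v y) (l *\<^sub>v z) = D x y z" using xyz by simp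
  qed
  thus ?thesis using kp kG by (auto simp: G2_dim6_def k_def)
qed

lemma generate_contained_in_G2_dim6:
  assumes D: "dickson_basis D v d" and c: "c \<in> carrier (GL TYPE('a::field) 6)"
    and S: "S \<noteq> {}" "S \<subseteq> carrier (GL TYPE('a) 6)"
    and mem: "\<And>x. x \<in> S \<Longrightarrow> c * x * inv\<^bsub>GL TYPE('a) 6\<^esub> c \<in> G2_dim6 D d"
  shows "contained_in_G2_dim6 (generate (GL TYPE('a) 6) S)"
proof -
  interpret group "GL TYPE('a) 6" by (rule GL_group)
  let ?G = "GL TYPE('a) 6"
  let ?\<phi> = "\<lambda>h. c \<otimes>\<^bsub>?G\<^esub> h \<otimes>\<^bsub>?G\<^esub> inv\<^bsub>?G\<^esub> c"
  have mult: "g \<otimes>\<^bsub>?G\<^esub> h \<in> G2_dim6 D d" if "g \<in> G2_dim6 D d" "h \<in> G2_dim6 D d" for g h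
    using G2_dim6_mult[OF that] by (simp add: GL_mult)
  have mem': "?\<phi> x \<in> G2_dim6 D d" if "x \<in> S" for x using mem[OF that] by (simp add: GL_mult)
  have ic: "inv\<^bsub>?G\<^esub> c \<in> carrier ?G" using c by simp
  have cc: "inv\<^bsub>?G\<^esub> c \<otimes>\<^bsub>?G\<^esub> (c \<otimes>\<^bsub>?G\<^esub> t) = t" if "t \<in> carrier ?G" for t
    using that c by (simp add: m_assoc[symmetric])
  have "?\<phi> h \<in> G2_dim6 D d" if "h \<in> generate ?G S" for h
    using that
  proof induction
    case one
    \<comment> \<open>The identity is reached as the product of a conjugated generator and its
      inverse.\<close>
    obtain x where x: "x \<in> S" using S by auto
    have "?\<phi> \<one>\<^bsub>?G\<^esub> = \<one>\<^bsub>?G\<^esub>" using c by simp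
    also have "\<dots> = ?\<phi> x \<otimes>\<^bsub>?G\<^esub> inv\<^bsub>?G\<^esub> (?\<phi> x)"
      using x S c ic by (intro r_inv[symmetric] m_closed) auto
    finally show ?case using mult[OF mem'[OF x] G2_dim6_inverse[OF mem'[OF x]]] by simp
  next
    case (incl h)
    thus ?case by (rule mem')
  next
    case (inv h)
    have h: "h \<in> carrier ?G" using inv S by auto
    have "inv\<^bsub>?G\<^esub> (?\<phi> h) = ?\<phi> (inv\<^bsub>?G\<^esub> h)"
      using c ic h by (simp add: inv_mult_group m_assoc)
    thus ?case using G2_dim6_inverse[OF mem'[OF inv]] by simp
  next
    case (eng h1 h2)
    have h: "h1 \<in> carrier ?G" "h2 \<in> carrier ?G" using eng generate_in_carrier[OF S(2)] by auto
    have "?\<phi> h1 \<otimes>\<^bsub>?G\<^esub> ?\<phi> h2 = ?\<phi> (h1 \<otimes>\<^bsub>?G\<^esub> h2)"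
      using c ic h by (simp add: m_assoc cc)
    thus ?case using mult[OF eng.IH] by simp
  qed
  hence "c * h * inv\<^bsub>?G\<^esub> c \<in> G2_dim6 D d" if "h \<in> generate ?G S" for h
    using that by (simp add: GL_mult)
  thus ?thesis unfolding contained_in_G2_dim6_def using D c by blast
qed

section \<open>Membership in the standard group\<close>

context char_two begin

text \<open>\<open>cone_mat h r\<close> adds \<open>dot r\<close> to the last coordinate. The terms
  which this adds to the \<open>v 0\<close> part of the form equal the shift of
  \<open>three_form\<close>, and equal terms cancel in characteristic 2.\<close>

lemma std_G2_dim6_intro:
  assumes h: "symplectic h" "h \<in> carrier (GL TYPE('a) 6)"
    and r: "\<And>u v w. u \<in> carrier_vec 6 \<Longrightarrow> v \<in> carrier_vec 6 \<Longrightarrow> w \<in> carrier_vec 6 \<Longrightarrow>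
      three_form 1 1 (h *\<^sub>v u) (h *\<^sub>v v) (h *\<^sub>v w) = three_form 1 1 u v w
      + (dot r (vec_index u) * om v w + dot r (vec_index v) * om u w + dot r (vec_index w) * om u v)"
  shows "h \<in> G2_dim6 std_dickson std_basis"
proof -
  have h6: "h \<in> carrier_mat 6 6" using h by (simp add: symplectic_def)
  define g where "g = cone_mat h r"
  define low where "low x = vec 6 (\<lambda>i. x $ i)" for x :: "'a vec"
  have lowc: "low x \<in> carrier_vec 6" for x by (simp add: low_def)
  have omlow: "om (low x) (low y) = om x y" for x y by (simp add: low_def omega_def)
  have tlow: "three_form 1 1 (low x) (low y) (low z) = three_form 1 1 x y z" for x y z
    by (simp add: low_def three_form_def minor_def)
  have gl: "low (g *\<^sub>v x) = h *\<^sub>v low x" if "x \<in> carrier_vec 7" for x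
  proof (rule eq_vecI)
    fix i assume "i < dim_vec (h *\<^sub>v low x)"
    hence i: "i < 6" using h6 by simp
    have "low (g *\<^sub>v x) $ i = (\<Sum>k = 0..<7. g $$ (i,k) * x $ k)"
      using i that by (auto simp: low_def g_def cone_mat_def scalar_prod_def)
    also have "\<dots> = (\<Sum>k<6. h $$ (i,k) * x $ k)" unfolding sum7 using i by (simp add: g_def cone_mat_def)
    also have "\<dots> = (h *\<^sub>v low x) $ i"
      using i h6 by (simp add: low_def scalar_prod_def lessThan_atLeast0)
    finally show "low (g *\<^sub>v x) $ i = (h *\<^sub>v low x) $ i" .
  qed (use h6 in \<open>simp add: low_def\<close>)
  have g6: "(g *\<^sub>v x) $ 6 = dot r (vec_index (low x)) + x $ 6" if "x \<in> carrier_vec 7" for x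
  proof -
    have "(g *\<^sub>v x) $ 6 = (\<Sum>k = 0..<7. g $$ (6,k) * x $ k)"
      using that by (auto simp: g_def cone_mat_def scalar_prod_def)
    thus ?thesis unfolding sum7 sum6 by (simp add: g_def cone_mat_def dot_def low_def)
  qed
  have gG: "g \<in> carrier (GL TYPE('a) 7)" unfolding g_def by (rule cone_mat_GL[OF h(2)])
  hence gc: "g *\<^sub>v x \<in> carrier_vec 7" if "x \<in> carrier_vec 7" for x
    using that by (auto simp: GL_carrier_iff)
  have "g \<in> G2 std_dickson" unfolding G2_def
  proof (intro CollectI conjI gG ballI)
    fix x y z :: "'a vec" assume xyz: "x \<in> carrier_vec 7" "y \<in> carrier_vec 7" "z \<in> carrier_vec 7"
    have o: "om (g *\<^sub>v s) (g *\<^sub>v t) = om s t" if "s \<in> carrier_vec 7" "t \<in> carrier_vec 7" for s t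
    proof -
      have "om (g *\<^sub>v s) (g *\<^sub>v t) = om (h *\<^sub>v low s) (h *\<^sub>v low t)"
        using omlow[of "g *\<^sub>v s" "g *\<^sub>v t"] that by (simp add: gl)
      also have "\<dots> = om s t" using h(1) lowc omlow by (simp add: symplectic_def)
      finally show ?thesis .
    qed
    have t: "three_form 1 1 (g *\<^sub>v x) (g *\<^sub>v y) (g *\<^sub>v z) = three_form 1 1 x y z
      + (dot r (vec_index (low x)) * om y z + dot r (vec_index (low y)) * om x z + dot r (vec_index (low z)) * om x y)"
      using r[OF lowc lowc lowc, of x y z] tlow[of "g *\<^sub>v x" "g *\<^sub>v y" "g *\<^sub>v z"]
      by (simp add: gl xyz tlow omlow)
    show "std_dickson (g *\<^sub>v x) (g *\<^sub>v y) (g *\<^sub>v z) = std_dickson x y z"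
      unfolding std_dickson_eq[OF gc[OF xyz(1)] gc[OF xyz(2)] gc[OF xyz(3)]] std_dickson_eq[OF xyz]
        o[OF xyz(2,3)] o[OF xyz(1,3)] o[OF xyz(1,2)] t g6[OF xyz(1)] g6[OF xyz(2)] g6[OF xyz(3)]
      by (simp add: distrib_right two_simps add_ac)
  qed
  thus ?thesis using h(2) quotient_projection_cone[OF h6, of r] unfolding G2_dim6_def g_def by blast
qed

text \<open>The symplectic matrix \<open>E\<close> multiplies the minors 2 3 4 and 0 1 5 by
  \<open>1/s\<close> and \<open>s\<close>. With \<open>a * s^2 = b\<close>, it therefore carries
  \<open>a * s\<close> times \<open>three_form 1 1\<close> to \<open>three_form a b\<close>.\<close>

lemma scaled_in_G2_dim6:
  assumes X: "symplectic X" "X \<in> carrier (GL TYPE('a) 6)"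
    and r: "\<And>u v w. u \<in> carrier_vec 6 \<Longrightarrow> v \<in> carrier_vec 6 \<Longrightarrow> w \<in> carrier_vec 6 \<Longrightarrow>
      three_form a b (X *\<^sub>v u) (X *\<^sub>v v) (X *\<^sub>v w) = three_form a b u v w
      + (dot r (vec_index u) * om v w + dot r (vec_index v) * om u w + dot r (vec_index w) * om u v)"
    and s: "s \<noteq> 0" "a * s^2 = b" "a \<noteq> 0"
  defines "E \<equiv> diag6 (\<lambda>i. [s,1,1,1/s,1,1] ! i)" and "E' \<equiv> diag6 (\<lambda>i. [1/s,1,1,s,1,1] ! i)"
  shows "E * X * E' \<in> G2_dim6 std_dickson std_basis"
proof -
  have E: "E \<in> carrier_mat 6 6" "E' \<in> carrier_mat 6 6" by (auto simp: E_def E'_def diag6_carrier)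
  have EE: "E * E' = 1\<^sub>m 6" "E' * E = 1\<^sub>m 6"
    unfolding E_def E'_def diag6_left[OF diag6_carrier]
    by (rule eq_matI; use s(1) in \<open>auto simp: diag6_def less6\<close>)+
  have X6: "X \<in> carrier_mat 6 6" using X by (simp add: symplectic_def)
  note d = diag6_mult_vec
  have es: "(E *\<^sub>v u) $ 0 = s * u $ 0" "(E *\<^sub>v u) $ 1 = u $ 1" "(E *\<^sub>v u) $ 2 = u $ 2" "(E *\<^sub>v u) $ 3 = u $ 3 / s"
    "(E *\<^sub>v u) $ 4 = u $ 4" "(E *\<^sub>v u) $ 5 = u $ 5" if "u \<in> carrier_vec 6" for u
    using that unfolding E_def by (simp_all add: d)
  have omE: "om (E *\<^sub>v u) (E *\<^sub>v v) = om u v" if "u \<in> carrier_vec 6" "v \<in> carrier_vec 6" for u v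
    unfolding omega_def es[OF that(1)] es[OF that(2)] using s(1) by simp
  have tE: "a * s * three_form 1 1 (E *\<^sub>v u) (E *\<^sub>v v) (E *\<^sub>v w) = three_form a b u v w"
    if "u \<in> carrier_vec 6" "v \<in> carrier_vec 6" "w \<in> carrier_vec 6" for u v w
    unfolding three_form_def minor_def es[OF that(1)] es[OF that(2)] es[OF that(3)] s(2)[symmetric]
    using s(1) by (simp add: field_simps power2_eq_square)
  have E'c: "E' *\<^sub>v u \<in> carrier_vec 6" "X *\<^sub>v (E' *\<^sub>v u) \<in> carrier_vec 6" if "u \<in> carrier_vec 6" for u
    using that E X6 by auto
  have EXE: "(E * X * E') *\<^sub>v u = E *\<^sub>v (X *\<^sub>v (E' *\<^sub>v u))" if "u \<in> carrier_vec 6" for u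
    using that E X6 by (simp add: assoc_mult_mat_vec[where n\<^sub>1 = 6 and n\<^sub>2 = 6 and n\<^sub>3 = 6])
  have EE'u: "E *\<^sub>v (E' *\<^sub>v u) = u" if "u \<in> carrier_vec 6" for u
    using that E EE by (metis assoc_mult_mat_vec one_mult_mat_vec)
  have sy: "symplectic (E * X * E')" unfolding symplectic_def
  proof (intro conjI ballI)
    show "E * X * E' \<in> carrier_mat 6 6" using E X6 by auto
    fix u v :: "'a vec" assume uv: "u \<in> carrier_vec 6" "v \<in> carrier_vec 6"
    have "om ((E * X * E') *\<^sub>v u) ((E * X * E') *\<^sub>v v) = om (X *\<^sub>v (E' *\<^sub>v u)) (X *\<^sub>v (E' *\<^sub>v v))"
      unfolding EXE[OF uv(1)] EXE[OF uv(2)] by (rule omE) (use uv E'c in auto)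
    also have "\<dots> = om (E' *\<^sub>v u) (E' *\<^sub>v v)" using X(1) uv E'c by (simp add: symplectic_def)
    also have "\<dots> = om (E *\<^sub>v (E' *\<^sub>v u)) (E *\<^sub>v (E' *\<^sub>v v))" using omE uv E'c by simp
    finally show "om ((E * X * E') *\<^sub>v u) ((E * X * E') *\<^sub>v v) = om u v" using EE'u uv by simp
  qed
  have EG: "E \<in> carrier (GL TYPE('a) 6)" "E' \<in> carrier (GL TYPE('a) 6)"
    using E EE by (auto simp: GL_carrier_iff)
  \<comment> \<open>The functional \<open>r\<close> transported by \<open>E'\<close> and divided by
    the factor \<open>a * s\<close> between the two forms.\<close>
  define r' where "r' i = (1 / (a * s)) * (r i * [1/s,1,1,s,1,1] ! i)" for i
  have r': "dot r' (vec_index u) = (1 / (a * s)) * dot r (vec_index (E' *\<^sub>v u))" if "u \<in> carrier_vec 6" for u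
    using that unfolding E'_def dot_def by (simp add: d r'_def distrib_left)
  show ?thesis
  proof (rule std_G2_dim6_intro[OF sy, of r'])
    show "E * X * E' \<in> carrier (GL TYPE('a) 6)" using EG X(2) by (intro GL_closed)
    fix u v w :: "'a vec" assume uvw: "u \<in> carrier_vec 6" "v \<in> carrier_vec 6" "w \<in> carrier_vec 6"
    let ?u = "E' *\<^sub>v u" and ?v = "E' *\<^sub>v v" and ?w = "E' *\<^sub>v w"
    have as: "a * s \<noteq> 0" using s by simp
    have omE': "om (E' *\<^sub>v p) (E' *\<^sub>v q) = om p q" if "p \<in> carrier_vec 6" "q \<in> carrier_vec 6" for p q
      using omE[OF E'c(1)[OF that(1)] E'c(1)[OF that(2)]] EE'u that by simp
    have "a * s * three_form 1 1 ((E * X * E') *\<^sub>v u) ((E * X * E') *\<^sub>v v) ((E * X * E') *\<^sub>v w)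
      = three_form a b (X *\<^sub>v ?u) (X *\<^sub>v ?v) (X *\<^sub>v ?w)"
      unfolding EXE[OF uvw(1)] EXE[OF uvw(2)] EXE[OF uvw(3)] by (rule tE) (use uvw E'c in auto)
    also have "\<dots> = three_form a b ?u ?v ?w
      + (dot r (vec_index ?u) * om v w + dot r (vec_index ?v) * om u w + dot r (vec_index ?w) * om u v)"
      using r[OF E'c(1)[OF uvw(1)] E'c(1)[OF uvw(2)] E'c(1)[OF uvw(3)]] uvw by (simp add: omE')
    also have "three_form a b ?u ?v ?w = a * s * three_form 1 1 u v w"
      using tE[OF E'c(1)[OF uvw(1)] E'c(1)[OF uvw(2)] E'c(1)[OF uvw(3)]] EE'u uvw by simp
    also have "a * s * three_form 1 1 u v w
      + (dot r (vec_index ?u) * om v w + dot r (vec_index ?v) * om u w + dot r (vec_index ?w) * om u v)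
      = a * s * (three_form 1 1 u v w
      + (dot r' (vec_index u) * om v w + dot r' (vec_index v) * om u w + dot r' (vec_index w) * om u v))"
      unfolding r'[OF uvw(1)] r'[OF uvw(2)] r'[OF uvw(3)] using as by (simp add: field_simps)
    finally show "three_form 1 1 ((E * X * E') *\<^sub>v u) ((E * X * E') *\<^sub>v v) ((E * X * E') *\<^sub>v w) = three_form 1 1 u v w
      + (dot r' (vec_index u) * om v w + dot r' (vec_index v) * om u w + dot r' (vec_index w) * om u v)"
      using as by (simp only: mult_cancel_left) simp
  qed
qed

end

section \<open>Eigenvectors from the Smith form\<close>

lemma invertible_mat_obtain:
  assumes "invertible_mat A" "A \<in> carrier_mat n n"
  obtains B where "B \<in> carrier_mat n n" "A * B = 1\<^sub>m n" "B * A = 1\<^sub>m n"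
proof -
  obtain B where B: "A * B = 1\<^sub>m (dim_row A)" "B * A = 1\<^sub>m (dim_row B)"
    using assms(1) by (auto simp: invertible_mat_def inverts_mat_def)
  have "dim_col B = n" using arg_cong[OF B(1), of dim_col] assms(2) by simp
  moreover have "dim_row B = n" using arg_cong[OF B(2), of dim_col] assms(2) by simp
  ultimately show thesis using that[of B] B assms(2) by auto
qed

lemma smith_obtain:
  fixes A :: "'a::field mat"
  assumes "similarity_invariants A fs" "A \<in> carrier_mat n n"
  obtains P P' Q Q' where "P \<in> carrier_mat n n" "P' \<in> carrier_mat n n" "Q \<in> carrier_mat n n" "Q' \<in> carrier_mat n n"
    "P * P' = 1\<^sub>m n" "P' * P = 1\<^sub>m n" "Q * Q' = 1\<^sub>m n" "Q' * Q = 1\<^sub>m n"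
    "P * char_poly_matrix A * Q = mat n n (\<lambda>(i,j). if i = j then (replicate (n - length fs) 1 @ fs) ! i else 0)"
proof -
  obtain P Q where PQ: "P \<in> carrier_mat n n" "Q \<in> carrier_mat n n" "invertible_mat P" "invertible_mat Q"
    and e: "P * char_poly_matrix A * Q = mat n n (\<lambda>(i,j). if i = j then (replicate (n - length fs) 1 @ fs) ! i else 0)"
    using assms unfolding similarity_invariants_def Let_def by auto
  obtain P' where "P' \<in> carrier_mat n n" "P * P' = 1\<^sub>m n" "P' * P = 1\<^sub>m n"
    using invertible_mat_obtain[OF PQ(3,1)] by blast
  moreover obtain Q' where "Q' \<in> carrier_mat n n" "Q * Q' = 1\<^sub>m n" "Q' * Q = 1\<^sub>m n"
    using invertible_mat_obtain[OF PQ(4,2)] by blast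
  ultimately show thesis using that PQ(1,2) e by blast
qed

text \<open>Evaluation at \<open>a\<close> is a ring homomorphism and keeps inverse pairs inverse.
  Moving the right factor of the Smith identity to the other side frees \<open>a - A\<close>; the
  \<open>Q\<close> obtained here is thus the evaluated inverse of the original right factor.\<close>

lemma smith_eval:
  fixes A :: "'a::field mat"
  assumes A: "similarity_invariants A fs" "A \<in> carrier_mat n n"
  obtains P P' Q Q' where "P \<in> carrier_mat n n" "P' \<in> carrier_mat n n" "Q \<in> carrier_mat n n" "Q' \<in> carrier_mat n n"
    "P * P' = 1\<^sub>m n" "P' * P = 1\<^sub>m n" "Q * Q' = 1\<^sub>m n" "Q' * Q = 1\<^sub>m n"
    "P * (a \<cdot>\<^sub>m 1\<^sub>m n - A) = mat n n (\<lambda>(i,j). poly ((replicate (n - length fs) 1 @ fs) ! i) a * Q $$ (i,j))"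
proof -
  obtain P P' Q Q' where c: "P \<in> carrier_mat n n" "P' \<in> carrier_mat n n" "Q \<in> carrier_mat n n" "Q' \<in> carrier_mat n n"
    and i: "P * P' = 1\<^sub>m n" "P' * P = 1\<^sub>m n" "Q * Q' = 1\<^sub>m n" "Q' * Q = 1\<^sub>m n"
    and e: "P * char_poly_matrix A * Q = mat n n (\<lambda>(i,j). if i = j then (replicate (n - length fs) 1 @ fs) ! i else 0)"
    by (rule smith_obtain[OF A])
  have hom: "semiring_hom (\<lambda>p. poly p a)" by unfold_locales auto
  note mat_hom_mult = semiring_hom.mat_hom_mult[OF hom] and mat_hom_one = semiring_hom.mat_hom_one[OF hom]
  let ?h = "map_mat (\<lambda>p. poly p a)"
  let ?s = "\<lambda>i. (replicate (n - length fs) 1 @ fs) ! i" and ?M = "a \<cdot>\<^sub>m 1\<^sub>m n - A"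
  have M: "?h (char_poly_matrix A) = ?M"
    using A(2) by (intro eq_matI) (auto simp: char_poly_matrix_def)
  have MC: "?M \<in> carrier_mat n n" using A(2) by (auto simp: minus_carrier_mat)
  have h: "?h P * ?h P' = 1\<^sub>m n" "?h P' * ?h P = 1\<^sub>m n" "?h Q * ?h Q' = 1\<^sub>m n" "?h Q' * ?h Q = 1\<^sub>m n"
    using c i by (simp_all add: mat_hom_mult[symmetric] mat_hom_one)
  have D: "?h (mat n n (\<lambda>(i,j). if i = j then ?s i else 0)) = mat n n (\<lambda>(i,j). if i = j then poly (?s i) a else 0)"
    by (intro eq_matI) auto
  have "?h (P * char_poly_matrix A * Q) = ?h P * ?M * ?h Q"
    using c A(2) by (simp add: mat_hom_mult[where n = n and nr = n and nc = n] M)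
  hence "?h P * ?M * ?h Q = mat n n (\<lambda>(i,j). if i = j then poly (?s i) a else 0)"
    unfolding e D by (rule sym)
  hence "?h P * ?M * ?h Q * ?h Q' = mat n n (\<lambda>(i,j). if i = j then poly (?s i) a else 0) * ?h Q'" by simp
  also have "\<dots> = mat n n (\<lambda>(i,j). poly (?s i) a * ?h Q' $$ (i,j))"
    using c by (intro eq_matI) (auto simp: scalar_prod_def if_distrib[of "\<lambda>t. t * _"] sum.delta cong: if_cong)
  also have "?h P * ?M * ?h Q * ?h Q' = ?h P * ?M"
    using c MC by (subst assoc_mult_square_mat) (auto simp: h)
  finally show thesis
    by (intro that[of "?h P" "?h P'" "?h Q'" "?h Q"]) (use c h in auto)
qed

lemma transpose_kernel:
  fixes P :: "'a::field mat"
  assumes "P \<in> carrier_mat n n" "P' \<in> carrier_mat n n" "P * P' = 1\<^sub>m n" "v \<in> carrier_vec n" "P\<^sup>T *\<^sub>v v = 0\<^sub>v n"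
  shows "v = 0\<^sub>v n"
proof -
  have "P'\<^sup>T *\<^sub>v (P\<^sup>T *\<^sub>v v) = (P * P')\<^sup>T *\<^sub>v v"
    using assms(1,2,4) by (simp add: transpose_mult[OF assms(1,2)] assoc_mult_mat_vec[where n\<^sub>1 = n and n\<^sub>2 = n and n\<^sub>3 = n])
  thus ?thesis using assms by auto
qed

lemma invertible_of_transpose_kernel:
  fixes W :: "'a::field mat"
  assumes W: "W \<in> carrier_mat n n" and ker: "\<And>v. v \<in> carrier_vec n \<Longrightarrow> W\<^sup>T *\<^sub>v v = 0\<^sub>v n \<Longrightarrow> v = 0\<^sub>v n"
  obtains W' where "W' \<in> carrier_mat n n" "W * W' = 1\<^sub>m n" "W' * W = 1\<^sub>m n"
proof -
  have "det (W\<^sup>T) \<noteq> 0" using det_0_iff_vec_prod_zero_field[of "W\<^sup>T" n] W ker by auto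
  hence "det W \<noteq> 0" by (simp add: det_transpose[OF W])
  from det_non_zero_imp_unit[OF W this, of "()"] show thesis
    using that by (auto simp: Units_def ring_mat_simps)
qed

lemma transpose_mult_vec_index:
  fixes W :: "'a::field mat"
  assumes "W \<in> carrier_mat n n" "v \<in> carrier_vec n" "j < n"
  shows "(W\<^sup>T *\<^sub>v v) $ j = (\<Sum>i<n. v $ i * W $$ (i,j))"
  using assms by (auto simp: scalar_prod_def lessThan_atLeast0 mult.commute intro!: sum.cong)

text \<open>Multiplying the relation by powers of \<open>A\<close> weights its terms by powers of
  the eigenvalues, hence by any polynomial in them. One that vanishes at all eigenvalues except
  \<open>l\<close> isolates the part for \<open>l\<close>.\<close>

lemma eigenrows_separate:
  fixes W A :: "'a::field mat"
  assumes W: "W \<in> carrier_mat n n" and A: "A \<in> carrier_mat n n"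
    and eig: "\<And>i j. i < n \<Longrightarrow> j < n \<Longrightarrow> (W * A) $$ (i,j) = \<mu> i * W $$ (i,j)"
    and v: "v \<in> carrier_vec n" "W\<^sup>T *\<^sub>v v = 0\<^sub>v n" and j: "j < n"
  shows "(\<Sum>i\<in>{i. i < n \<and> \<mu> i = l}. v $ i * W $$ (i,j)) = 0"
proof -
  have pow: "(\<Sum>i<n. \<mu> i ^ k * (v $ i * W $$ (i,j))) = 0" if "j < n" for k j
    using that
  proof (induction k arbitrary: j)
    case 0
    thus ?case using transpose_mult_vec_index[OF W v(1) 0] v(2) by simp
  next
    case (Suc k)
    have "(\<Sum>i<n. \<mu> i ^ Suc k * (v $ i * W $$ (i,j))) = (\<Sum>i<n. \<mu> i ^ k * v $ i * (W * A) $$ (i,j))"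
      by (intro sum.cong) (use eig Suc.prems in \<open>auto simp: mult_ac\<close>)
    also have "\<dots> = (\<Sum>i<n. \<Sum>m<n. \<mu> i ^ k * (v $ i * W $$ (i,m)) * A $$ (m,j))"
      using W A Suc.prems by (intro sum.cong) (auto simp: scalar_prod_def lessThan_atLeast0 sum_distrib_left mult.assoc)
    also have "\<dots> = (\<Sum>m<n. (\<Sum>i<n. \<mu> i ^ k * (v $ i * W $$ (i,m))) * A $$ (m,j))"
      by (subst sum.swap) (simp add: sum_distrib_right)
    also have "\<dots> = 0" using Suc.IH by simp
    finally show ?case .
  qed
  have pol: "(\<Sum>i<n. poly p (\<mu> i) * (v $ i * W $$ (i,j))) = 0" for p
  proof -
    have "(\<Sum>i<n. poly p (\<mu> i) * (v $ i * W $$ (i,j))) = (\<Sum>k\<le>degree p. coeff p k * (\<Sum>i<n. \<mu> i ^ k * (v $ i * W $$ (i,j))))"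
      unfolding poly_altdef sum_distrib_left sum_distrib_right by (subst sum.swap) (simp add: mult.assoc)
    thus ?thesis using pow[OF j] by simp
  qed
  define S where "S = \<mu> ` {..<n} - {l}"
  define p where "p = (\<Prod>m\<in>S. [:-m, 1:])"
  have pl: "poly p l \<noteq> 0" by (auto simp: p_def poly_prod S_def)
  have ps: "poly p (\<mu> i) = 0" if "i < n" "\<mu> i \<noteq> l" for i
    using that by (auto simp: p_def poly_prod S_def)
  have "0 = (\<Sum>i<n. poly p (\<mu> i) * (v $ i * W $$ (i,j)))" using pol by simp
  also have "\<dots> = (\<Sum>i\<in>{i. i < n \<and> \<mu> i = l}. poly p l * (v $ i * W $$ (i,j)))"
    by (rule sum.mono_neutral_cong_right) (auto simp: ps)
  finally show ?thesis using pl by (simp add: sum_distrib_left[symmetric])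
qed

lemma smith_left_eigen:
  fixes A :: "'a::field mat"
  assumes A: "similarity_invariants A fs" "A \<in> carrier_mat n n"
  obtains P P' where "P \<in> carrier_mat n n" "P' \<in> carrier_mat n n" "P * P' = 1\<^sub>m n"
    "\<And>i j. i < n \<Longrightarrow> poly ((replicate (n - length fs) 1 @ fs) ! i) a = 0 \<Longrightarrow> j < n \<Longrightarrow> (P * A) $$ (i,j) = a * P $$ (i,j)"
proof -
  obtain P P' Q Q' where P: "P \<in> carrier_mat n n" "P' \<in> carrier_mat n n" "P * P' = 1\<^sub>m n" and Q: "Q \<in> carrier_mat n n"
    and e: "P * (a \<cdot>\<^sub>m 1\<^sub>m n - A) = mat n n (\<lambda>(i,j). poly ((replicate (n - length fs) 1 @ fs) ! i) a * Q $$ (i,j))"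
    by (rule smith_eval[OF A, of a])
  have "P * (a \<cdot>\<^sub>m 1\<^sub>m n - A) = P * (a \<cdot>\<^sub>m 1\<^sub>m n) - P * A"
    by (rule mult_minus_distrib_mat[OF P(1) _ A(2)]) simp
  also have "P * (a \<cdot>\<^sub>m 1\<^sub>m n) = a \<cdot>\<^sub>m P"
    using P(1) by (simp add: mult_smult_distrib[OF P(1) one_carrier_mat])
  finally have e: "a \<cdot>\<^sub>m P - P * A = mat n n (\<lambda>(i,j). poly ((replicate (n - length fs) 1 @ fs) ! i) a * Q $$ (i,j))"
    using e by simp
  have "(P * A) $$ (i,j) = a * P $$ (i,j)" if "i < n" "poly ((replicate (n - length fs) 1 @ fs) ! i) a = 0" "j < n" for i j
  proof -
    have "(a \<cdot>\<^sub>m P - P * A) $$ (i,j) = a * P $$ (i,j) - (P * A) $$ (i,j)" using P A that by simp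
    thus ?thesis unfolding e using that by simp
  qed
  thus thesis using that P by blast
qed

text \<open>
  If \<open>P(t) (t - A) Q(t)\<close> is the Smith form, then the rows of \<open>P(\<mu>)\<close> at the invariant factors
  vanishing at \<open>\<mu>\<close> are independent left eigenvectors of \<open>A\<close> for \<open>\<mu>\<close>.
\<close>

lemma eigenrow_basis:
  fixes A :: "'a::field mat"
  assumes A: "similarity_invariants A fs" "A \<in> carrier_mat n n"
    and \<rho>: "\<And>i. i < n \<Longrightarrow> \<rho> i < n" "\<And>i. i < n \<Longrightarrow> poly ((replicate (n - length fs) 1 @ fs) ! \<rho> i) (\<mu> i) = 0"
      "\<And>i j. i < n \<Longrightarrow> j < n \<Longrightarrow> \<mu> i = \<mu> j \<Longrightarrow> \<rho> i = \<rho> j \<Longrightarrow> i = j"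
  obtains W W' where "W \<in> carrier_mat n n" "W' \<in> carrier_mat n n" "W * W' = 1\<^sub>m n" "W' * W = 1\<^sub>m n"
    "\<And>i j. i < n \<Longrightarrow> j < n \<Longrightarrow> (W * A) $$ (i,j) = \<mu> i * W $$ (i,j)"
proof -
  let ?\<phi> = "\<lambda>a P P'. P \<in> carrier_mat n n \<and> P' \<in> carrier_mat n n \<and> P * P' = 1\<^sub>m n \<and>
    (\<forall>i<n. poly ((replicate (n - length fs) 1 @ fs) ! i) a = 0 \<longrightarrow> (\<forall>j<n. (P * A) $$ (i,j) = a * P $$ (i,j)))"
  have ex: "\<exists>P P'. ?\<phi> a P P'" for a by (rule smith_left_eigen[OF A]) blast
  \<comment> \<open>One matrix is fixed for each value \<open>a\<close>, so that rows with equal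
    eigenvalues come from the same invertible matrix and are independent.\<close>
  define P where "P a = (SOME P. \<exists>P'. ?\<phi> a P P')" for a
  define P' where "P' a = (SOME P'. ?\<phi> a (P a) P')" for a
  have \<phi>: "?\<phi> a (P a) (P' a)" for a
    unfolding P'_def by (rule someI_ex) (unfold P_def, rule someI_ex[OF ex])
  have P: "P a \<in> carrier_mat n n" "P' a \<in> carrier_mat n n" "P a * P' a = 1\<^sub>m n" for a using \<phi>[of a] by blast+
  have Pe: "(P a * A) $$ (i,j) = a * P a $$ (i,j)"
    if "i < n" "poly ((replicate (n - length fs) 1 @ fs) ! i) a = 0" "j < n" for a i j using \<phi>[of a] that by blast
  define W where "W = mat n n (\<lambda>(i,j). P (\<mu> i) $$ (\<rho> i, j))"
  have W: "W \<in> carrier_mat n n" by (simp add: W_def)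
  have eig: "(W * A) $$ (i,j) = \<mu> i * W $$ (i,j)" if "i < n" "j < n" for i j
  proof -
    have "(W * A) $$ (i,j) = (P (\<mu> i) * A) $$ (\<rho> i, j)"
      using that A(2) P(1)[of "\<mu> i"] \<rho>(1)[OF that(1)] by (auto simp: W_def scalar_prod_def intro!: sum.cong)
    thus ?thesis using Pe[OF \<rho>(1,2)] that by (simp add: W_def)
  qed
  have ker: "v = 0\<^sub>v n" if v: "v \<in> carrier_vec n" "W\<^sup>T *\<^sub>v v = 0\<^sub>v n" for v
  proof (rule eq_vecI)
    fix k assume "k < dim_vec (0\<^sub>v n :: 'a vec)"
    hence k: "k < n" by simp
    \<comment> \<open>The coefficients belonging to the eigenvalue \<open>\<mu> k\<close>, sorted by
      row number in \<open>P (\<mu> k)\<close>. As \<open>\<rho>\<close> is injective on them, no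
      two are merged.\<close>
    define s where "s = vec n (\<lambda>m. \<Sum>i\<in>{i. i < n \<and> \<mu> i = \<mu> k \<and> \<rho> i = m}. v $ i)"
    have sc: "s \<in> carrier_vec n" by (simp add: s_def)
    have Ps: "(P (\<mu> k))\<^sup>T *\<^sub>v s = 0\<^sub>v n"
    proof (rule eq_vecI)
      fix j assume "j < dim_vec (0\<^sub>v n :: 'a vec)"
      hence j: "j < n" by simp
      have "((P (\<mu> k))\<^sup>T *\<^sub>v s) $ j = (\<Sum>m<n. s $ m * P (\<mu> k) $$ (m,j))"
        by (rule transpose_mult_vec_index[OF P(1) _ j]) (simp add: s_def)
      also have "\<dots> = (\<Sum>m<n. \<Sum>i\<in>{i. i < n \<and> \<mu> i = \<mu> k \<and> \<rho> i = m}. v $ i * W $$ (i,j))"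
        using j by (intro sum.cong refl) (auto simp: s_def sum_distrib_right W_def intro!: sum.cong)
      also have "\<dots> = (\<Sum>m<n. \<Sum>i\<in>{i \<in> {i. i < n \<and> \<mu> i = \<mu> k}. \<rho> i = m}. v $ i * W $$ (i,j))"
        by (intro sum.cong refl) auto
      also have "\<dots> = (\<Sum>i\<in>{i. i < n \<and> \<mu> i = \<mu> k}. v $ i * W $$ (i,j))"
        by (rule sum.group) (use \<rho>(1) in auto)
      also have "\<dots> = 0" by (rule eigenrows_separate[OF W A(2) eig v j])
      finally show "((P (\<mu> k))\<^sup>T *\<^sub>v s) $ j = 0\<^sub>v n $ j" using j by simp
    qed (use P(1)[of "\<mu> k"] in auto)
    have "s = 0\<^sub>v n" by (rule transpose_kernel[OF P sc Ps])
    hence "s $ \<rho> k = 0" using \<rho>(1)[OF k] by simp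
    moreover have "{i. i < n \<and> \<mu> i = \<mu> k \<and> \<rho> i = \<rho> k} = {k}" using \<rho>(3) k by auto
    ultimately show "v $ k = 0\<^sub>v n $ k" using \<rho>(1)[OF k] k by (simp add: s_def)
  qed (use v in simp)
  obtain W' where "W' \<in> carrier_mat n n" "W * W' = 1\<^sub>m n" "W' * W = 1\<^sub>m n"
    by (rule invertible_of_transpose_kernel[OF W ker])
  thus thesis by (rule that[OF W _ _ _ eig])
qed

section \<open>Polynomial relations from the Smith form\<close>

lemma mult_mat_index_sum:
  fixes A :: "'a::comm_ring_1 mat"
  assumes "A \<in> carrier_mat m n" "B \<in> carrier_mat n p" "i < m" "j < p"
  shows "(A * B) $$ (i,j) = (\<Sum>k<n. A $$ (i,k) * B $$ (k,j))"
  using assms by (simp add: scalar_prod_def lessThan_atLeast0)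

text \<open>The diagonal matrix \<open>E\<close> of the quotients of \<open>f\<close> by the
  invariant factors completes the Smith form to \<open>f\<close> times the identity; then
  \<open>Q * E * P\<close> is the required factor.\<close>

lemma smith_multiple:
  fixes A :: "'a::field mat"
  assumes A: "similarity_invariants A fs" "A \<in> carrier_mat n n"
    and f: "\<And>i. i < n \<Longrightarrow> (replicate (n - length fs) 1 @ fs) ! i dvd f"
  obtains R where "R \<in> carrier_mat n n" "R * char_poly_matrix A = f \<cdot>\<^sub>m 1\<^sub>m n"
proof -
  let ?s = "\<lambda>i. (replicate (n - length fs) 1 @ fs) ! i" and ?M = "char_poly_matrix A"
  obtain P P' Q Q' where c: "P \<in> carrier_mat n n" "P' \<in> carrier_mat n n" "Q \<in> carrier_mat n n" "Q' \<in> carrier_mat n n"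
    and i: "P * P' = 1\<^sub>m n" "P' * P = 1\<^sub>m n" "Q * Q' = 1\<^sub>m n" "Q' * Q = 1\<^sub>m n"
    and e: "P * ?M * Q = mat n n (\<lambda>(i,j). if i = j then ?s i else 0)"
    by (rule smith_obtain[OF A])
  have M: "?M \<in> carrier_mat n n" using A(2) by simp
  define E where "E = mat n n (\<lambda>(i,j). if i = j then f div ?s i else 0)"
  have E: "E \<in> carrier_mat n n" by (simp add: E_def)
  have ED: "E * (P * ?M * Q) = f \<cdot>\<^sub>m 1\<^sub>m n" unfolding e
  proof (rule eq_matI)
    fix i j assume "i < dim_row (f \<cdot>\<^sub>m 1\<^sub>m n)" "j < dim_col (f \<cdot>\<^sub>m 1\<^sub>m n)"
    hence ij: "i < n" "j < n" by auto
    have "(E * mat n n (\<lambda>(i,j). if i = j then ?s i else 0)) $$ (i,j)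
      = (\<Sum>k\<in>{0..<n}. E $$ (i,k) * (if k = j then ?s k else 0))"
      using ij E by (simp add: scalar_prod_def)
    also have "\<dots> = (\<Sum>k\<in>{0..<n}. if k = j then E $$ (i,j) * ?s j else 0)" by (intro sum.cong) auto
    also have "\<dots> = (f \<cdot>\<^sub>m 1\<^sub>m n) $$ (i,j)" using ij f[OF ij(1)] by (auto simp: E_def)
    finally show "(E * mat n n (\<lambda>(i,j). if i = j then ?s i else 0)) $$ (i,j) = (f \<cdot>\<^sub>m 1\<^sub>m n) $$ (i,j)" .
  qed (auto simp: E_def)
  have "Q * E * P * ?M = Q * (E * (P * ?M * Q)) * Q'"
  proof -
    have "Q * (E * (P * ?M * Q)) * Q' = Q * E * P * ?M * (Q * Q')"
      using c E M by (simp only: assoc_mult_square_mat mult_carrier_mat[where nr = n and n = n and nc = n])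
    thus ?thesis using i(3) c E M by simp
  qed
  also have "\<dots> = f \<cdot>\<^sub>m 1\<^sub>m n" unfolding ED
  proof -
    have "Q * (f \<cdot>\<^sub>m 1\<^sub>m n) * Q' = f \<cdot>\<^sub>m (Q * Q')"
      using c by (simp add: mult_smult_distrib[OF c(3) one_carrier_mat] mult_smult_assoc_mat[OF c(3,4)])
    thus "Q * (f \<cdot>\<^sub>m 1\<^sub>m n) * Q' = f \<cdot>\<^sub>m 1\<^sub>m n" by (simp add: i)
  qed
  finally show thesis using that[of "Q * E * P"] c E by auto
qed

text \<open>Compare coefficients in \<open>R (t - A) = t^2 + a\<close>, as for Cayley-Hamilton.
  Descending from a degree beyond all entries, the coefficient matrices of \<open>R\<close> vanish
  down to degree 2, and then are the identity and \<open>A\<close>; the constant term gives the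
  claim.\<close>

lemma smith_square:
  fixes A :: "'a::field mat"
  assumes A: "similarity_invariants A fs" "A \<in> carrier_mat n n"
    and f: "\<And>i. i < n \<Longrightarrow> (replicate (n - length fs) 1 @ fs) ! i dvd [:a, 0, 1:]"
  shows "A * A = (- a) \<cdot>\<^sub>m 1\<^sub>m n"
proof -
  obtain R where R: "R \<in> carrier_mat n n" "R * char_poly_matrix A = [:a, 0, 1:] \<cdot>\<^sub>m 1\<^sub>m n"
    using smith_multiple[OF A f] by blast
  define C where "C m = mat n n (\<lambda>(i,j). coeff (R $$ (i,j)) m)" for m
  have C: "C m \<in> carrier_mat n n" for m by (simp add: C_def)
  have CA: "(C m * A) $$ (i,j) = (\<Sum>k\<in>{0..<n}. coeff (R $$ (i,k)) m * A $$ (k,j))" if "i < n" "j < n" for m i j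
    using that A(2) by (auto simp: C_def scalar_prod_def)
  have e: "pCons 0 (R $$ (i,j)) - (\<Sum>k\<in>{0..<n}. smult (A $$ (k,j)) (R $$ (i,k))) = (if i = j then [:a, 0, 1:] else 0)"
    if ij: "i < n" "j < n" for i j
  proof -
    have "(R * char_poly_matrix A) $$ (i,j) = (\<Sum>k\<in>{0..<n}. R $$ (i,k) * char_poly_matrix A $$ (k,j))"
      using ij R(1) char_poly_matrix_closed[OF A(2)] by (simp add: scalar_prod_def)
    also have "\<dots> = (\<Sum>k\<in>{0..<n}. (if k = j then pCons 0 (R $$ (i,j)) else 0) - smult (A $$ (k,j)) (R $$ (i,k)))"
      using ij A(2) by (intro sum.cong) (auto simp: char_poly_matrix_def algebra_simps)
    also have "\<dots> = pCons 0 (R $$ (i,j)) - (\<Sum>k\<in>{0..<n}. smult (A $$ (k,j)) (R $$ (i,k)))"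
      using ij by (simp add: sum_subtractf)
    finally have *: "([:a, 0, 1:] \<cdot>\<^sub>m 1\<^sub>m n) $$ (i,j) = pCons 0 (R $$ (i,j)) - (\<Sum>k\<in>{0..<n}. smult (A $$ (k,j)) (R $$ (i,k)))"
      unfolding R(2) .
    show ?thesis unfolding *[symmetric] using ij by simp
  qed
  have c0: "- (C 0 * A) $$ (i,j) = (if i = j then a else 0)" if "i < n" "j < n" for i j
    using arg_cong[OF e[OF that], of "\<lambda>p. coeff p 0"] by (auto simp: CA[OF that] coeff_sum mult.commute)
  have cS: "C m $$ (i,j) - (C (Suc m) * A) $$ (i,j) = (if i = j \<and> m = 1 then 1 else 0)" if "i < n" "j < n" for m i j
  proof -
    have "coeff [:a, 0, 1:] (Suc m) = (if m = 1 then 1 else 0)" by (cases m) (auto simp: coeff_pCons split: nat.splits)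
    moreover have "coeff (R $$ (i,j)) m - (\<Sum>k\<in>{0..<n}. A $$ (k,j) * coeff (R $$ (i,k)) (Suc m))
      = coeff (if i = j then [:a, 0, 1:] else 0) (Suc m)"
      using arg_cong[OF e[OF that], of "\<lambda>p. coeff p (Suc m)"] by (simp add: coeff_sum)
    ultimately show ?thesis unfolding CA[OF that] using that by (auto simp: C_def mult.commute)
  qed
  define N where "N = Suc (Suc (Max (insert 0 ((\<lambda>(i,j). degree (R $$ (i,j))) ` ({..<n} \<times> {..<n})))))"
  have "C N = 0\<^sub>m n n"
  proof (rule eq_matI)
    fix i j assume "i < dim_row (0\<^sub>m n n :: 'a mat)" "j < dim_col (0\<^sub>m n n :: 'a mat)"
    hence ij: "i < n" "j < n" by auto
    have "degree (R $$ (i,j)) \<le> Max (insert 0 ((\<lambda>(i,j). degree (R $$ (i,j))) ` ({..<n} \<times> {..<n})))"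
      using ij by (intro Max_ge) auto
    hence "degree (R $$ (i,j)) < N" unfolding N_def by linarith
    thus "C N $$ (i,j) = 0\<^sub>m n n $$ (i,j)" using ij by (simp add: C_def coeff_eq_0)
  qed (auto simp: C_def)
  moreover have down: "C m = 0\<^sub>m n n" if "C (Suc m) = 0\<^sub>m n n" "m \<ge> 2" for m
  proof (rule eq_matI)
    fix i j assume "i < dim_row (0\<^sub>m n n :: 'a mat)" "j < dim_col (0\<^sub>m n n :: 'a mat)"
    hence ij: "i < n" "j < n" by auto
    have "0\<^sub>m n n * A = 0\<^sub>m n n" using A(2) by simp
    thus "C m $$ (i,j) = 0\<^sub>m n n $$ (i,j)" using cS[OF ij, of m] that ij by simp
  qed (auto simp: C_def)
  have "m \<le> N \<Longrightarrow> m \<ge> 2 \<Longrightarrow> C m = 0\<^sub>m n n" for m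
    by (induction m rule: inc_induct) (use \<open>C N = 0\<^sub>m n n\<close> down in auto)
  hence C2: "C 2 = 0\<^sub>m n n" by (simp add: N_def)
  have C1: "C 1 = 1\<^sub>m n"
  proof (rule eq_matI)
    fix i j assume "i < dim_row (1\<^sub>m n :: 'a mat)" "j < dim_col (1\<^sub>m n :: 'a mat)"
    hence ij: "i < n" "j < n" by auto
    have "0\<^sub>m n n * A = 0\<^sub>m n n" using A(2) by simp
    thus "C 1 $$ (i,j) = 1\<^sub>m n $$ (i,j)" using cS[OF ij, of 1] C2 ij by (simp add: numeral_2_eq_2)
  qed (auto simp: C_def)
  have C0: "C 0 = A"
  proof (rule eq_matI)
    fix i j assume "i < dim_row A" "j < dim_col A"
    hence ij: "i < n" "j < n" using A(2) by auto
    have "1\<^sub>m n * A = A" using A(2) by simp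
    thus "C 0 $$ (i,j) = A $$ (i,j)" using cS[OF ij, of 0] C1 by simp
  qed (use A(2) in \<open>auto simp: C_def\<close>)
  show ?thesis
  proof (rule eq_matI)
    fix i j assume "i < dim_row ((- a) \<cdot>\<^sub>m 1\<^sub>m n)" "j < dim_col ((- a) \<cdot>\<^sub>m 1\<^sub>m n)"
    hence ij: "i < n" "j < n" by auto
    have "(A * A) $$ (i,j) = - (if i = j then a else 0)" using c0[OF ij] unfolding C0 by (metis minus_minus)
    thus "(A * A) $$ (i,j) = ((- a) \<cdot>\<^sub>m 1\<^sub>m n) $$ (i,j)" using ij by simp
  qed (use A(2) in auto)
qed

context char_two begin

text \<open>
  The first three rows \<open>p\<close> of \<open>P(1)\<close> satisfy \<open>p (1 - X) = q\<close> with independent \<open>q\<close>, and \<open>1 - X\<close> squares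
  to zero; hence the rows \<open>p\<close> and \<open>p X\<close> form a basis that \<open>X\<close> permutes.
\<close>

lemma involution_rows:
  fixes X :: "'a mat"
  assumes A: "similarity_invariants X [[:1,0,1:],[:1,0,1:],[:1,0,1:]]" "X \<in> carrier_mat 6 6" and XX: "X * X = 1\<^sub>m 6"
  obtains R R' where "R \<in> carrier_mat 6 6" "R' \<in> carrier_mat 6 6" "R * R' = 1\<^sub>m 6" "R' * R = 1\<^sub>m 6" "R * X = J6 * R"
proof -
  let ?fs = "[[:1,0,1:],[:1,0,1:],[:1,0,1:]] :: 'a poly list"
  let ?ss = "replicate (6 - length ?fs) 1 @ ?fs"
  obtain P P' Q Q' where c: "P \<in> carrier_mat 6 6" "Q \<in> carrier_mat 6 6" "Q' \<in> carrier_mat 6 6"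
    and i: "Q * Q' = 1\<^sub>m 6"
    and e: "P * (1 \<cdot>\<^sub>m 1\<^sub>m 6 - X) = mat 6 6 (\<lambda>(i,j). poly (?ss ! i) 1 * Q $$ (i,j))"
    by (rule smith_eval[OF A, of 1])
  have "P * (1 \<cdot>\<^sub>m 1\<^sub>m 6 - X) = P - P * X"
  proof -
    have "1 \<cdot>\<^sub>m 1\<^sub>m 6 = (1\<^sub>m 6 :: 'a mat)" by (intro eq_matI) auto
    thus ?thesis using mult_minus_distrib_mat[OF c(1) one_carrier_mat A(2)] c(1) by simp
  qed
  hence PX: "P - P * X = mat 6 6 (\<lambda>(i,j). poly (?ss ! i) 1 * Q $$ (i,j))" using e by simp
  \<comment> \<open>Three of the six invariant factors are constant, and they stand at the rows 0 to
    2, where the diagonal value is 1.\<close>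
  have b: "P $$ (r,j) + (P * X) $$ (r,j) = Q $$ (r,j)" if "r < 3" "j < 6" for r j
  proof -
    have r: "r = 0 \<or> r = 1 \<or> r = 2" using that by auto
    have "(P - P * X) $$ (r,j) = P $$ (r,j) + (P * X) $$ (r,j)" using c A(2) that by (simp add: diff_eq)
    thus ?thesis unfolding PX using that r by (auto simp: eval_nat_numeral)
  qed
  define R where "R = mat 6 6 (\<lambda>(i,j). if i < 3 then P $$ (i,j) else (P * X) $$ (i - 3,j))"
  have R: "R \<in> carrier_mat 6 6" by (simp add: R_def)
  have PXX: "P * X * X = P" using c A(2) XX by (simp add: assoc_mult_mat[OF c(1) A(2) A(2)])
  have PXc: "P * X \<in> carrier_mat 6 6" using c A(2) by simp
  have RX: "(R * X) $$ (i,j) = R $$ ((i + 3) mod 6, j)" if ij: "i < 6" "j < 6" for i j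
  proof (cases "i < 3")
    case True
    hence "(R * X) $$ (i,j) = (P * X) $$ (i,j)"
      using ij c A(2) by (auto simp: R_def scalar_prod_def intro!: sum.cong)
    moreover have "(i + 3) mod 6 = i + 3" using True by simp
    ultimately show ?thesis using True ij by (simp add: R_def del: index_mult_mat)
  next
    case False
    hence i3: "i - 3 < 6" "(i + 3) mod 6 = i - 3" "i - 3 < 3" using ij by (auto simp: less6)
    have "(R * X) $$ (i,j) = (\<Sum>k\<in>{0..<6}. R $$ (i,k) * X $$ (k,j))"
      using ij A(2) R by (auto simp: scalar_prod_def)
    also have "\<dots> = (\<Sum>k\<in>{0..<6}. (P * X) $$ (i - 3,k) * X $$ (k,j))"
      using ij False by (intro sum.cong) (auto simp: R_def simp del: index_mult_mat)
    also have "\<dots> = (P * X * X) $$ (i - 3,j)"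
      using ij A(2) PXc i3 by (subst index_mult_mat(1)) (auto simp: scalar_prod_def simp del: index_mult_mat(1))
    finally show ?thesis unfolding PXX using i3 ij by (simp add: R_def)
  qed
  have RJ: "R * X = J6 * R"
  proof (rule eq_matI)
    fix i j assume "i < dim_row (J6 * R)" "j < dim_col (J6 * R)"
    hence ij: "i < 6" "j < 6" using R by (auto simp: J6_def)
    have "(J6 * R) $$ (i,j) = (\<Sum>k\<in>{0..<6}. (if k = (i + 3) mod 6 then 1 else 0) * R $$ (k,j))"
      using ij R by (auto simp: J6_def scalar_prod_def intro!: sum.cong)
    also have "\<dots> = (\<Sum>k\<in>{0..<6}. if k = (i + 3) mod 6 then R $$ (k,j) else 0)" by (intro sum.cong) auto
    also have "\<dots> = R $$ ((i + 3) mod 6, j)" by simp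
    finally show "(R * X) $$ (i,j) = (J6 * R) $$ (i,j)" using RX[OF ij] by simp
  qed (use R A(2) in \<open>auto simp: J6_def\<close>)
  have sum3: "(\<Sum>i<6. t i) = (\<Sum>i<3. t i + t (i + 3))" for t :: "nat \<Rightarrow> 'a"
    by (simp add: eval_nat_numeral ac_simps)
  have Qker: "\<forall>r<3. s r = 0" if "\<And>j. j < 6 \<Longrightarrow> (\<Sum>r<3. s r * Q $$ (r,j)) = 0" for s
  proof -
    define w where "w = vec 6 (\<lambda>r. if r < 3 then s r else 0)"
    have wc: "w \<in> carrier_vec 6" by (simp add: w_def)
    have "Q\<^sup>T *\<^sub>v w = 0\<^sub>v 6"
    proof (rule eq_vecI)
      fix j assume "j < dim_vec (0\<^sub>v 6 :: 'a vec)"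
      hence j: "j < 6" by simp
      show "(Q\<^sup>T *\<^sub>v w) $ j = 0\<^sub>v 6 $ j"
        unfolding transpose_mult_vec_index[OF c(2) wc j] sum3 using that[OF j] j by (simp add: w_def)
    qed (use c in auto)
    hence "w = 0\<^sub>v 6" by (rule transpose_kernel[OF c(2,3) i wc])
    hence "w $ r = 0" if "r < 3" for r using that by simp
    thus ?thesis by (simp add: w_def)
  qed
  \<comment> \<open>Adding a relation between the rows \<open>p\<close> and \<open>p X\<close> to
    its image under \<open>X\<close> gives one among the independent rows \<open>q\<close>, so the
    coefficients of \<open>p\<close> and \<open>p X\<close> agree. The relation is then itself one
    among the rows \<open>q\<close>.\<close>
  have ker: "v = 0\<^sub>v 6" if v: "v \<in> carrier_vec 6" "R\<^sup>T *\<^sub>v v = 0\<^sub>v 6" for v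
  proof -
    have rel: "(\<Sum>r<3. v $ r * P $$ (r,j) + v $ (r + 3) * (P * X) $$ (r,j)) = 0" if j: "j < 6" for j
    proof -
      have "(R\<^sup>T *\<^sub>v v) $ j = (\<Sum>r<3. v $ r * P $$ (r,j) + v $ (r + 3) * (P * X) $$ (r,j))"
        unfolding transpose_mult_vec_index[OF R v(1) j] sum3 using j
        by (intro sum.cong refl) (simp add: R_def del: index_mult_mat)
      thus ?thesis using v(2) j by simp
    qed
    have rel': "(\<Sum>r<3. v $ r * (P * X) $$ (r,j) + v $ (r + 3) * P $$ (r,j)) = 0" if j: "j < 6" for j
    proof -
      have PXi: "(P * X) $$ (r,j) = (\<Sum>k<6. P $$ (r,k) * X $$ (k,j))" if "r < 3" for r
        using c A(2) that j by (auto simp: scalar_prod_def lessThan_atLeast0)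
      have Pi: "P $$ (r,j) = (\<Sum>k<6. (P * X) $$ (r,k) * X $$ (k,j))" if "r < 3" for r
      proof -
        have "(P * X * X) $$ (r,j) = (\<Sum>k<6. (P * X) $$ (r,k) * X $$ (k,j))"
          using that j by (intro mult_mat_index_sum[OF PXc A(2)]) auto
        thus ?thesis unfolding PXX .
      qed
      have "(\<Sum>r<3. v $ r * (P * X) $$ (r,j) + v $ (r + 3) * P $$ (r,j)) =
        (\<Sum>r<3. \<Sum>k<6. (v $ r * P $$ (r,k) + v $ (r + 3) * (P * X) $$ (r,k)) * X $$ (k,j))"
        by (intro sum.cong refl, subst PXi, simp, subst Pi, simp)
          (simp add: sum_distrib_left sum.distrib distrib_right mult.assoc del: index_mult_mat)
      also have "\<dots> = (\<Sum>k<6. (\<Sum>r<3. v $ r * P $$ (r,k) + v $ (r + 3) * (P * X) $$ (r,k)) * X $$ (k,j))"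
        unfolding sum_distrib_right by (rule sum.swap)
      also have "\<dots> = 0" using rel by simp
      finally show ?thesis .
    qed
    have "(\<Sum>r<3. (v $ r + v $ (r + 3)) * Q $$ (r,j)) = 0" if j: "j < 6" for j
    proof -
      have "(\<Sum>r<3. (v $ r + v $ (r + 3)) * Q $$ (r,j)) = (\<Sum>r<3. v $ r * P $$ (r,j) + v $ (r + 3) * (P * X) $$ (r,j))
        + (\<Sum>r<3. v $ r * (P * X) $$ (r,j) + v $ (r + 3) * P $$ (r,j))"
        unfolding sum.distrib[symmetric] using j
        by (intro sum.cong refl) (simp add: b[symmetric] algebra_simps del: index_mult_mat)
      thus ?thesis using rel[OF j] rel'[OF j] by simp
    qed
    from Qker[OF this] have eq: "v $ r = v $ (r + 3)" if "r < 3" for r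
      using that by (simp add: add_eq_zero_iff)
    have "(\<Sum>r<3. v $ r * Q $$ (r,j)) = 0" if j: "j < 6" for j
    proof -
      have "(\<Sum>r<3. v $ r * Q $$ (r,j)) = (\<Sum>r<3. v $ r * P $$ (r,j) + v $ (r + 3) * (P * X) $$ (r,j))"
        using j by (intro sum.cong refl) (simp add: b[symmetric] eq[symmetric] distrib_left del: index_mult_mat)
      thus ?thesis using rel[OF j] by simp
    qed
    from Qker[OF this] have z: "v $ r = 0" if "r < 3" for r using that by simp
    show ?thesis
    proof (rule eq_vecI)
      fix k assume "k < dim_vec (0\<^sub>v 6 :: 'a vec)"
      hence k: "k < 6" by simp
      show "v $ k = 0\<^sub>v 6 $ k"
      proof (cases "k < 3")
        case False
        hence "k - 3 < 3" "k - 3 + 3 = k" using k by auto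
        thus ?thesis using eq[of "k - 3"] z[of "k - 3"] k by simp
      qed (use z k in simp)
    qed (use v in simp)
  qed
  obtain R' where "R' \<in> carrier_mat 6 6" "R * R' = 1\<^sub>m 6" "R' * R = 1\<^sub>m 6"
    by (rule invertible_of_transpose_kernel[OF R ker])
  thus thesis using that[OF R _ _ _ RJ] by blast
qed

end

section \<open>Conjugation to normal form\<close>

lemma irreducible_pair_conj:
  fixes C :: "'a::field mat"
  assumes irr: "irreducible_pair X Z" and c: "X \<in> carrier_mat 6 6" "Z \<in> carrier_mat 6 6" "C \<in> carrier_mat 6 6" "C' \<in> carrier_mat 6 6"
    and CC: "C * C' = 1\<^sub>m 6" "C' * C = 1\<^sub>m 6"
  shows "irreducible_pair (C * X * C') (C * Z * C')"
  unfolding irreducible_pair_def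
proof (intro allI impI)
  fix W :: "'a vec set"
  assume W: "W \<subseteq> carrier_vec 6" "0\<^sub>v 6 \<in> W" "\<forall>u\<in>W. \<forall>v\<in>W. u + v \<in> W" "\<forall>c. \<forall>u\<in>W. c \<cdot>\<^sub>v u \<in> W"
    and inv: "\<forall>u\<in>W. (C * X * C') *\<^sub>v u \<in> W \<and> (C * Z * C') *\<^sub>v u \<in> W"
  define V where "V = {v \<in> carrier_vec 6. C *\<^sub>v v \<in> W}"
  have CCv: "C *\<^sub>v (C' *\<^sub>v v) = v" "C' *\<^sub>v (C *\<^sub>v v) = v" if "v \<in> carrier_vec 6" for v
    using that c CC by (metis assoc_mult_mat_vec one_mult_mat_vec)+
  have conj: "(C * A * C') *\<^sub>v (C *\<^sub>v v) = C *\<^sub>v (A *\<^sub>v v)" if "v \<in> carrier_vec 6" "A \<in> carrier_mat 6 6" for v A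
  proof -
    have "(C * A * C') *\<^sub>v (C *\<^sub>v v) = C *\<^sub>v (A *\<^sub>v (C' *\<^sub>v (C *\<^sub>v v)))"
      using that c by (simp add: assoc_mult_mat_vec[where n\<^sub>1 = 6 and n\<^sub>2 = 6 and n\<^sub>3 = 6])
    thus ?thesis using CCv(2)[OF that(1)] by simp
  qed
  have "V = {0\<^sub>v 6} \<or> V = carrier_vec 6"
  proof (rule irr[unfolded irreducible_pair_def, rule_format])
    have "C *\<^sub>v 0\<^sub>v 6 = 0\<^sub>v 6" using c(3) by (intro eq_vecI) auto
    thus "0\<^sub>v 6 \<in> V" using W(2) by (simp add: V_def)
    show "u + v \<in> V" if "u \<in> V" "v \<in> V" for u v
      using that W(3) c by (auto simp: V_def mult_add_distrib_mat_vec[where nr = 6 and nc = 6])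
    show "k \<cdot>\<^sub>v u \<in> V" if "u \<in> V" for k u
      using that W(4) c by (auto simp: V_def mult_mat_vec[where nr = 6 and nc = 6])
    show "X *\<^sub>v u \<in> V \<and> Z *\<^sub>v u \<in> V" if "u \<in> V" for u
      using that inv c conj[of u X] conj[of u Z] by (auto simp: V_def)
  qed (auto simp: V_def)
  moreover have WV: "C' *\<^sub>v w \<in> V" if "w \<in> W" for w
  proof -
    have "w \<in> carrier_vec 6" using that W(1) by blast
    thus ?thesis using that c(4) CCv(1)[of w] by (simp add: V_def)
  qed
  ultimately show "W = {0\<^sub>v 6} \<or> W = carrier_vec 6"
  proof (elim disjE)
    assume V0: "V = {0\<^sub>v 6}"
    have "w = 0\<^sub>v 6" if "w \<in> W" for w
    proof -
      have "C' *\<^sub>v w = 0\<^sub>v 6" using WV[OF that] V0 by simp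
      moreover have "C *\<^sub>v 0\<^sub>v 6 = 0\<^sub>v 6" using c(3) by (intro eq_vecI) auto
      ultimately have "C *\<^sub>v (C' *\<^sub>v w) = 0\<^sub>v 6" by simp
      moreover have "w \<in> carrier_vec 6" using that W(1) by blast
      ultimately show ?thesis using CCv(1)[of w] by simp
    qed
    thus ?thesis using W(2) by blast
  next
    assume V: "V = carrier_vec 6"
    have "w \<in> W" if "w \<in> carrier_vec 6" for w
    proof -
      have "C' *\<^sub>v w \<in> V" unfolding V using that c by simp
      thus ?thesis using CCv(1)[OF that] by (simp add: V_def)
    qed
    thus ?thesis using W(1) by blast
  qed
qed

text \<open>A subspace stable under \<open>x\<close> and \<open>x * y\<close> is stable under
  \<open>y = x * (x * y)\<close>, and under the inverses \<open>x\<close> and \<open>y * y\<close>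
  of the generators; hence under the whole group.\<close>

lemma irreducible_pair_of_acts_irreducibly:
  fixes x y :: "'a::field mat"
  assumes irr: "acts_irreducibly 6 (generate (GL TYPE('a) 6) {x, y})"
    and x: "x \<in> carrier (GL TYPE('a) 6)" "x * x = 1\<^sub>m 6" and y: "y \<in> carrier (GL TYPE('a) 6)" "y * y * y = 1\<^sub>m 6"
  shows "irreducible_pair x (x * y)"
  unfolding irreducible_pair_def
proof (intro allI impI)
  fix W :: "'a vec set"
  assume W: "W \<subseteq> carrier_vec 6" "0\<^sub>v 6 \<in> W" "\<forall>u\<in>W. \<forall>v\<in>W. u + v \<in> W" "\<forall>c. \<forall>u\<in>W. c \<cdot>\<^sub>v u \<in> W"
    and inv': "\<forall>u\<in>W. x *\<^sub>v u \<in> W \<and> (x * y) *\<^sub>v u \<in> W"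
  interpret group "GL TYPE('a) 6" by (rule GL_group)
  have c: "x \<in> carrier_mat 6 6" "y \<in> carrier_mat 6 6" using x y by (auto simp: GL_carrier_iff)
  have yx: "y = x * (x * y)"
    unfolding assoc_mult_mat[OF c(1) c(1) c(2), symmetric] x(2) using c(2) by simp
  have xW: "x *\<^sub>v w \<in> W" if "w \<in> W" for w using inv' that by blast
  have yW: "y *\<^sub>v w \<in> W" if "w \<in> W" for w
  proof -
    have "w \<in> carrier_vec 6" using that W(1) by blast
    hence "(x * (x * y)) *\<^sub>v w = x *\<^sub>v ((x * y) *\<^sub>v w)"
      using c by (intro assoc_mult_mat_vec) auto
    hence "y *\<^sub>v w = x *\<^sub>v ((x * y) *\<^sub>v w)" using yx by metis
    thus ?thesis using inv' that by auto
  qed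
  have ix: "inv\<^bsub>GL TYPE('a) 6\<^esub> x = x" by (rule inv_equality) (use x in \<open>auto simp: GL_mult GL_one\<close>)
  have iy: "inv\<^bsub>GL TYPE('a) 6\<^esub> y = y * y"
    by (rule inv_equality) (use y in \<open>auto simp: GL_mult GL_one GL_closed\<close>)
  have hW: "\<forall>w\<in>W. h *\<^sub>v w \<in> W" if "h \<in> generate (GL TYPE('a) 6) {x, y}" for h
    using that
  proof induction
    case one
    show ?case using W(1) by (auto simp: GL_one)
  next
    case (incl h)
    thus ?case using xW yW by auto
  next
    case (inv h)
    have yyW: "(y * y) *\<^sub>v w \<in> W" if "w \<in> W" for w
    proof -
      have "w \<in> carrier_vec 6" using that W(1) by blast
      hence "(y * y) *\<^sub>v w = y *\<^sub>v (y *\<^sub>v w)" by (rule assoc_mult_mat_vec[OF c(2) c(2)])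
      thus ?thesis using yW[OF yW[OF that]] by simp
    qed
    have "h = x \<or> h = y" using inv.hyps by simp
    thus ?case
    proof
      assume h: "h = x"
      show ?case unfolding h ix using xW by blast
    next
      assume h: "h = y"
      show ?case unfolding h iy using yyW by blast
    qed
  next
    case (eng h1 h2)
    have sub: "{x, y} \<subseteq> carrier (GL TYPE('a) 6)" using x(1) y(1) by simp
    have h: "h1 \<in> carrier_mat 6 6" "h2 \<in> carrier_mat 6 6"
      using generate_in_carrier[OF sub eng.hyps(1)] generate_in_carrier[OF sub eng.hyps(2)]
      unfolding GL_carrier_iff by blast+
    show ?case
    proof
      fix w assume w: "w \<in> W"
      hence "w \<in> carrier_vec 6" using W(1) by blast
      hence "(h1 * h2) *\<^sub>v w = h1 *\<^sub>v (h2 *\<^sub>v w)" by (rule assoc_mult_mat_vec[OF h])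
      moreover have "h1 *\<^sub>v (h2 *\<^sub>v w) \<in> W" using eng.IH w by blast
      ultimately show "(h1 \<otimes>\<^bsub>GL TYPE('a) 6\<^esub> h2) *\<^sub>v w \<in> W" by (simp add: GL_mult)
    qed
  qed
  have "VectorSpace.subspace class_ring W (module_vec TYPE('a) 6)"
  proof -
    interpret vec_space "TYPE('a)" 6 .
    have "submodule class_ring W V"
      using W by unfold_locales (auto simp: module_vec_simps class_ring_simps)
    thus ?thesis using vectorspace_axioms by (simp add: VectorSpace.subspace_def)
  qed
  thus "W = {0\<^sub>v 6} \<or> W = carrier_vec 6"
    using irr hW unfolding acts_irreducibly_def by blast
qed

section \<open>From the invariant form to the standard Dickson form\<close>

context char_two begin

text \<open>Invariance under the diagonal matrix kills each entry whose two eigenvalues do not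
  multiply to 1. As \<open>B\<close> intertwines \<open>X\<close> with its transpose and the
  diagonal matrix with its inverse, its kernel is zero, so the remaining entries cannot
  vanish.\<close>

lemma antidiagonal_form:
  fixes X B :: "'a mat"
  assumes X: "X \<in> carrier_mat 6 6" and Y: "Y \<in> carrier_mat 6 6" and XX: "X * X = 1\<^sub>m 6" and XY: "X * Y = diag6 z"
    and z: "\<And>i. i < 6 \<Longrightarrow> z i * z ((i + 3) mod 6) = 1"
      "\<And>i j. i < 6 \<Longrightarrow> j < 6 \<Longrightarrow> j \<noteq> (i + 3) mod 6 \<Longrightarrow> z i * z j \<noteq> 1"
    and irr: "irreducible_pair X (diag6 z)"
    and B: "alternating_mat B" "B \<noteq> 0\<^sub>m 6 6" "X\<^sup>T * B * X = B" "Y\<^sup>T * B * Y = B"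
  shows "\<And>i j. i < 6 \<Longrightarrow> j < 6 \<Longrightarrow> j \<noteq> (i + 3) mod 6 \<Longrightarrow> B $$ (i,j) = 0"
    and "\<And>i. i < 6 \<Longrightarrow> B $$ (i, (i + 3) mod 6) \<noteq> 0"
proof -
  let ?Z = "diag6 z"
  have Bc: "B \<in> carrier_mat 6 6" using B(1) by (simp add: alternating_mat_def)
  have Zc: "?Z \<in> carrier_mat 6 6" by (rule diag6_carrier)
  have "?Z\<^sup>T * B * ?Z = Y\<^sup>T * (X\<^sup>T * B * X) * Y"
    unfolding XY[symmetric] using X Y Bc
    by (simp add: transpose_mult[of X 6 6 Y 6] mult6_assoc)
  hence ZBZ: "?Z\<^sup>T * B * ?Z = B" using B by simp
  show zero: "B $$ (i,j) = 0" if "i < 6" "j < 6" "j \<noteq> (i + 3) mod 6" for i j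
  proof -
    have "(?Z\<^sup>T * B * ?Z) $$ (i,j) = z i * B $$ (i,j) * z j" unfolding diag6_congruence[OF Bc] using that by simp
    hence "z i * z j * B $$ (i,j) = B $$ (i,j)" unfolding ZBZ by (simp add: mult_ac)
    thus ?thesis using z(2)[OF that] by (metis mult_cancel_right1)
  qed
  have BX: "B * X = X\<^sup>T * B"
  proof -
    have "X\<^sup>T * B * X * X = X\<^sup>T * B * (X * X)"
      using X Bc by (simp add: mult6_assoc)
    thus ?thesis unfolding B(3) XX using X Bc by simp
  qed
  have BZ: "B * ?Z = diag6 (\<lambda>i. z ((i + 3) mod 6)) * B"
    unfolding diag6_left[OF Bc] diag6_right[OF Bc]
  proof (rule cong_mat)
    fix i j :: nat assume ij: "i < 6" "j < 6"
    show "(case (i,j) of (i,j) \<Rightarrow> B $$ (i,j) * z j) = (case (i,j) of (i,j) \<Rightarrow> z ((i + 3) mod 6) * B $$ (i,j))"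
      using zero[OF ij] by (cases "j = (i + 3) mod 6") auto
  qed auto
  show "B $$ (i, (i + 3) mod 6) \<noteq> 0" if i: "i < 6" for i
  proof
    assume b0: "B $$ (i, (i + 3) mod 6) = 0"
    have j: "(i + 3) mod 6 < 6" by simp
    have "B *\<^sub>v unit_vec 6 ((i + 3) mod 6) = 0\<^sub>v 6"
    proof (rule eq_vecI)
      fix k assume "k < dim_vec (0\<^sub>v 6 :: 'a vec)"
      hence k: "k < 6" by simp
      have "B $$ (k, (i + 3) mod 6) = 0"
      proof (cases "k = i")
        case False
        hence "(i + 3) mod 6 \<noteq> (k + 3) mod 6" using i k unfolding less6 by auto
        thus ?thesis using zero[OF k j] by simp
      qed (use b0 in simp)
      thus "(B *\<^sub>v unit_vec 6 ((i + 3) mod 6)) $ k = 0\<^sub>v 6 $ k" using Bc k by (simp add: scalar_prod_right_unit)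
    qed (use Bc in auto)
    hence "unit_vec 6 ((i + 3) mod 6) = (0\<^sub>v 6 :: 'a vec)"
      using irreducible_pair_kernel[OF irr X Zc _ diag6_carrier Bc B(2) BX BZ, of "unit_vec 6 ((i + 3) mod 6)"] X by auto
    thus False using j by (metis index_unit_vec(2) index_zero_vec(1) one_neq_zero)
  qed
qed


lemma om_scalar_prod:
  assumes "u \<in> carrier_vec 6" "v \<in> carrier_vec 6"
  shows "om u v = u \<bullet> (J6 *\<^sub>v v)"
proof -
  have "u \<bullet> (J6 *\<^sub>v v) = (\<Sum>i<6. u $ i * (\<Sum>j<6. J6 $$ (i,j) * v $ j))"
    using assms J6_carrier by (auto simp: scalar_prod_def J6_def lessThan_atLeast0 intro!: sum.cong)
  also have "\<dots> = om u v" by (simp add: sum6 J6_def omega_def)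
  finally show ?thesis by simp
qed

lemma symplecticI:
  assumes A: "(A :: 'a mat) \<in> carrier_mat 6 6" "A\<^sup>T * J6 * A = J6"
  shows "symplectic A"
  unfolding symplectic_def
proof (intro conjI ballI A)
  have J6c: "(J6 :: 'a mat) \<in> carrier_mat 6 6" by (rule J6_carrier)
  fix u v :: "'a vec" assume uv: "u \<in> carrier_vec 6" "v \<in> carrier_vec 6"
  have c: "A *\<^sub>v u \<in> carrier_vec 6" "A *\<^sub>v v \<in> carrier_vec 6" "J6 *\<^sub>v (A *\<^sub>v v) \<in> carrier_vec 6"
    using A(1) uv mult_mat_vec_carrier[OF J6c] by auto
  have "om (A *\<^sub>v u) (A *\<^sub>v v) = (A *\<^sub>v u) \<bullet> (J6 *\<^sub>v (A *\<^sub>v v))" by (rule om_scalar_prod[OF c(1,2)])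
  also have "\<dots> = (J6 *\<^sub>v (A *\<^sub>v v)) \<bullet> (A *\<^sub>v u)" by (rule comm_scalar_prod[OF c(1,3)])
  also have "\<dots> = (A\<^sup>T *\<^sub>v (J6 *\<^sub>v (A *\<^sub>v v))) \<bullet> u"
    using transpose_vec_mult_scalar[OF A(1) uv(1) c(3)] by simp
  also have "A\<^sup>T *\<^sub>v (J6 *\<^sub>v (A *\<^sub>v v)) = (A\<^sup>T * J6 * A) *\<^sub>v v"
    using A(1) uv J6c by (simp add: assoc_mult_mat_vec[where n\<^sub>1 = 6 and n\<^sub>2 = 6 and n\<^sub>3 = 6])
  also have "\<dots> \<bullet> u = u \<bullet> (J6 *\<^sub>v v)" unfolding A(2)
    using uv mult_mat_vec_carrier[OF J6c] by (intro comm_scalar_prod[where n = 6]) auto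
  also have "\<dots> = om u v" by (rule om_scalar_prod[OF uv, symmetric])
  finally show "om (A *\<^sub>v u) (A *\<^sub>v v) = om u v" .
qed

lemma diag6_one: "diag6 (\<lambda>_. 1) = (1\<^sub>m 6 :: 'a mat)"
  by (rule eq_matI) (auto simp: diag6_def)

lemma diag6_diag6: "diag6 f * diag6 g = (diag6 (\<lambda>i. f i * g i) :: 'a mat)"
  unfolding diag6_left[OF diag6_carrier] by (rule eq_matI) (auto simp: diag6_def)

lemma diag6_cong: "(\<And>i. i < 6 \<Longrightarrow> f i = g i) \<Longrightarrow> diag6 f = (diag6 g :: 'a mat)"
  by (rule eq_matI) (auto simp: diag6_def)

lemma diag6_symplectic:
  assumes "\<And>i. i < 6 \<Longrightarrow> z i * z ((i + 3) mod 6) = (1::'a)"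
  shows "symplectic (diag6 z)"
proof (rule symplecticI[OF diag6_carrier])
  show "(diag6 z)\<^sup>T * J6 * diag6 z = J6"
    unfolding diag6_congruence[OF J6_carrier] by (rule eq_matI) (use assms in \<open>auto simp: J6_def\<close>)
qed

lemma conj_mult:
  fixes C :: "'a mat"
  assumes "A \<in> carrier_mat 6 6" "B \<in> carrier_mat 6 6" "C \<in> carrier_mat 6 6" "C' \<in> carrier_mat 6 6" "C' * C = 1\<^sub>m 6"
  shows "(C * A * C') * (C * B * C') = C * (A * B) * C'"
proof -
  have "(C * A * C') * (C * B * C') = C * (A * (C' * C) * B) * C'"
    using assms(1-4) by (simp only: mult6_assoc mult6_carrier)
  thus ?thesis using assms by simp
qed

text \<open>The conjugating matrix is \<open>E * D\<close>, where \<open>D\<close> normalises the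
  invariant form and \<open>E\<close> the coefficients of the spin vector. Both are diagonal, so
  \<open>diag6 z\<close> stays as it is.\<close>

lemma normal_form_in_G2_dim6:
  fixes X Y :: "'a mat"
  assumes sqrt: "\<And>t::'a. \<exists>s. s^2 = t"
    and X: "X \<in> carrier_mat 6 6" and Y: "Y \<in> carrier_mat 6 6" and XX: "X * X = 1\<^sub>m 6" and XY: "X * Y = diag6 z"
    and R: "R \<in> carrier_mat 6 6" "R' \<in> carrier_mat 6 6" "R * R' = 1\<^sub>m 6" and RX: "R * X = J6 * R"
    and U: "U \<in> carrier_mat 6 6" "U' \<in> carrier_mat 6 6" "U * U' = 1\<^sub>m 6" "U' * U = 1\<^sub>m 6"
    and UY: "U * Y = diag6 (\<lambda>i. [1,1,w,w,w^2,w^2] ! i) * U" and w: "w^3 = 1" "w \<noteq> 1"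
    and irr: "irreducible_pair X (diag6 z)"
    and z: "\<And>i. i < 6 \<Longrightarrow> z i * z ((i + 3) mod 6) = 1"
      "\<And>i j. i < 6 \<Longrightarrow> j < 6 \<Longrightarrow> j \<noteq> (i + 3) mod 6 \<Longrightarrow> z i * z j \<noteq> 1"
      "z 0 * z 1 * z 5 = 1" "z 2 * z 3 * z 4 = 1"
      "z 0 * z 1 * z 2 \<noteq> 1" "z 3 * z 1 * z 2 \<noteq> 1" "z 0 * z 4 * z 2 \<noteq> 1"
      "z 3 * z 1 * z 5 \<noteq> 1" "z 0 * z 4 * z 5 \<noteq> 1" "z 3 * z 4 * z 5 \<noteq> 1"
  shows "\<exists>C\<in>carrier_mat 6 6. \<exists>C'\<in>carrier_mat 6 6. C * C' = 1\<^sub>m 6 \<and> C' * C = 1\<^sub>m 6 \<and>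
    C * X * C' \<in> G2_dim6 std_dickson std_basis \<and> C * diag6 z * C' \<in> G2_dim6 std_dickson std_basis"
proof -
  have J6c: "(J6 :: 'a mat) \<in> carrier_mat 6 6" by (rule J6_carrier)
  let ?Z = "diag6 z" and ?l = "\<lambda>i::nat. [1,1,w,w,w^2,w^2] ! i"
  have Zc: "?Z \<in> carrier_mat 6 6" by (rule diag6_carrier)
  have w2: "w * w^2 = 1" "w^2 * w = 1" using w(1) by (simp_all add: power2_eq_square power3_eq_cube mult.assoc)
  have l: "?l a * ?l b = 1" if "a < 6" "b < 6" "idx_y a b < 14" for a b
    using that w2 unfolding less6 idx_y_def by (elim disjE) simp_all
  have z3: "z i * z (i + 3) = 1" if "i < 3" for i using z(1)[of i] that by simp
  obtain B where B: "alternating_mat B" "B \<noteq> 0\<^sub>m 6 6" "X\<^sup>T * B * X = B" "Y\<^sup>T * B * Y = B"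
    using invariant_form[OF X Y XX XY z3 R RX U(1-3) UY l irr] by blast
  have anti: "B $$ (i,j) = 0" if "i < 6" "j < 6" "j \<noteq> (i + 3) mod 6" for i j
    by (rule antidiagonal_form(1)[OF X Y XX XY _ _ irr B that]) (rule z; assumption)+
  have anti': "B $$ (i, (i + 3) mod 6) \<noteq> 0" if "i < 6" for i
    by (rule antidiagonal_form(2)[OF X Y XX XY _ _ irr B that]) (rule z; assumption)+
  have Bc: "B \<in> carrier_mat 6 6" and Bsym: "\<And>i j. i < 6 \<Longrightarrow> j < 6 \<Longrightarrow> B $$ (i,j) = B $$ (j,i)"
    using B(1) by (auto simp: alternating_mat_def)
  \<comment> \<open>The product \<open>d i * d (i + 3)\<close> has to be the entry of
    \<open>B\<close> at \<open>(i, i + 3)\<close>; the first factor takes all of it.\<close>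
  define d where "d i = (if i < 3 then B $$ (i, i + 3) else 1)" for i :: nat
  have d0: "d i \<noteq> 0" for i using anti'[of i] by (auto simp: d_def)
  define D where "D = diag6 d"
  define D' where "D' = diag6 (\<lambda>i. 1 / d i)"
  have Dc: "D \<in> carrier_mat 6 6" "D' \<in> carrier_mat 6 6" by (simp_all add: D_def D'_def diag6_carrier)
  have DD: "D * D' = 1\<^sub>m 6" "D' * D = 1\<^sub>m 6"
    unfolding D_def D'_def diag6_diag6 diag6_one[symmetric] by (rule diag6_cong; simp add: d0)+
  have DJD: "D\<^sup>T * J6 * D = B"
    unfolding D_def diag6_congruence[OF J6_carrier]
  proof (rule eq_matI)
    fix i j assume "i < dim_row B" "j < dim_col B"
    hence ij: "i < 6" "j < 6" using Bc by auto
    show "mat 6 6 (\<lambda>(i,j). d i * J6 $$ (i,j) * d j) $$ (i,j) = B $$ (i,j)"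
    proof (cases "j = (i + 3) mod 6")
      case True
      hence "i < 3 \<and> j = i + 3 \<or> j < 3 \<and> i = j + 3" using ij unfolding less6 by auto
      thus ?thesis using ij True Bsym[OF ij] by (auto simp: J6_def d_def)
    next
      case False
      thus ?thesis using anti[OF ij] ij by (simp add: J6_def)
    qed
  qed (use Bc in auto)
  define X2 where "X2 = D * X * D'"
  define Y2 where "Y2 = D * Y * D'"
  have c2: "X2 \<in> carrier_mat 6 6" "Y2 \<in> carrier_mat 6 6" using Dc X Y by (auto simp: X2_def Y2_def)
  have DZD: "D * ?Z * D' = ?Z"
    unfolding D_def D'_def diag6_diag6 by (rule diag6_cong) (simp add: d0)
  have XX2: "X2 * X2 = 1\<^sub>m 6" unfolding X2_def conj_mult[OF X X Dc DD(2)] XX using Dc DD by simp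
  have XY2: "X2 * Y2 = ?Z" unfolding X2_def Y2_def conj_mult[OF X Y Dc DD(2)] XY DZD ..
  have sX2: "symplectic X2"
  proof (rule symplecticI[OF c2(1)])
    have X2D: "X2 * D = D * X"
      using Dc X DD by (simp add: X2_def mult6_assoc)
    have "D\<^sup>T * (X2\<^sup>T * J6 * X2) * D = X\<^sup>T * (D\<^sup>T * J6 * D) * X"
    proof -
      have "D\<^sup>T * (X2\<^sup>T * J6 * X2) * D = (D\<^sup>T * X2\<^sup>T) * J6 * (X2 * D)"
        using Dc c2 J6c by (simp add: mult6_assoc)
      also have "D\<^sup>T * X2\<^sup>T = X\<^sup>T * D\<^sup>T" using X2D transpose_mult[OF c2(1) Dc(1)] transpose_mult[OF Dc(1) X] by simp
      finally show ?thesis unfolding X2D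
        using Dc X J6c by (simp add: mult6_assoc)
    qed
    also have "\<dots> = D\<^sup>T * J6 * D" unfolding DJD B(3) ..
    finally have e: "D\<^sup>T * (X2\<^sup>T * J6 * X2) * D = D\<^sup>T * J6 * D" .
    have cancel: "D'\<^sup>T * (D\<^sup>T * M * D) * D' = M" if "M \<in> carrier_mat 6 6" for M
    proof -
      have "D'\<^sup>T * (D\<^sup>T * M * D) * D' = (D'\<^sup>T * D\<^sup>T) * M * (D * D')"
        using Dc that by (simp add: mult6_assoc)
      also have "D'\<^sup>T * D\<^sup>T = 1\<^sub>m 6" using transpose_mult[OF Dc] DD by simp
      finally show ?thesis using that DD by simp
    qed
    have "X2\<^sup>T * J6 * X2 \<in> carrier_mat 6 6" using c2 J6c by auto
    from cancel[OF this] cancel[OF J6_carrier] show "X2\<^sup>T * J6 * X2 = J6" unfolding e by simp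
  qed
  have sZ: "symplectic ?Z" by (rule diag6_symplectic) (rule z(1))
  have irr2: "irreducible_pair X2 ?Z"
    using irreducible_pair_conj[OF irr X Zc Dc DD] unfolding DZD X2_def .
  \<comment> \<open>The columns of \<open>U'\<close> are right eigenvectors of \<open>Y\<close>, and
    \<open>D\<close> carries them to eigenvectors of \<open>Y2\<close>.\<close>
  define V where "V = D * U'"
  define V' where "V' = U * D'"
  have V: "V \<in> carrier_mat 6 6" "V' \<in> carrier_mat 6 6" using Dc U by (auto simp: V_def V'_def)
  have VV: "V * V' = 1\<^sub>m 6"
  proof -
    have "V * V' = D * (U' * U) * D'"
      using Dc U(1,2) by (simp only: V_def V'_def mult6_assoc mult6_carrier)
    thus ?thesis using U DD Dc by simp
  qed
  have VV': "V' * V = 1\<^sub>m 6"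
  proof -
    have "V' * V = U * (D' * D) * U'"
      using Dc U(1,2) by (simp only: V_def V'_def mult6_assoc mult6_carrier)
    thus ?thesis using U DD Dc by simp
  qed
  have YU: "Y * U' = U' * diag6 ?l"
  proof -
    have "U' * (U * Y) * U' = (U' * U) * (Y * U')"
      using Y U(1,2) by (simp only: mult6_assoc mult6_carrier)
    hence "Y * U' = U' * (U * Y) * U'" using U Y by simp
    also have "\<dots> = U' * diag6 ?l * (U * U')" unfolding UY
      using U(1,2) diag6_carrier[of ?l] by (simp only: mult6_assoc mult6_carrier)
    also have "\<dots> = U' * diag6 ?l" unfolding U(3) using U(2) diag6_carrier[of ?l] by (intro right_mult_one_mat) auto
    finally show ?thesis .
  qed
  have YV: "Y2 * V = V * diag6 ?l"
  proof -
    have "Y2 * V = D * (Y * (D' * D)) * U'"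
      using Dc U(2) Y by (simp only: Y2_def V_def mult6_assoc mult6_carrier)
    also have "\<dots> = D * (Y * U')" using DD(2) Dc U(2) Y by simp
    also have "\<dots> = V * diag6 ?l" unfolding YU V_def
      using Dc U(2) diag6_carrier[of ?l] by (simp only: mult6_assoc)
    finally show ?thesis .
  qed
  obtain a b where ab: "a \<noteq> 0 \<or> b \<noteq> 0" and inv: "\<And>P. isotropic P \<Longrightarrow>
      a * pairing (lagr 4) (act_triple X2 P) + b * pairing (lagr 3) (act_triple X2 P) = a * pairing (lagr 4) P + b * pairing (lagr 3) P"
    using spin_fixed_eigen[OF sX2 XX2 sZ XY2 c2(2) V VV VV' YV w z(3-10)] by blast
  have ab0: "a \<noteq> 0" "b \<noteq> 0"
    using spin_coefficients_nonzero[OF sX2 XX2 irr2 ab inv] by blast+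
  obtain r where r: "\<And>u v w. u \<in> carrier_vec 6 \<Longrightarrow> v \<in> carrier_vec 6 \<Longrightarrow> w \<in> carrier_vec 6 \<Longrightarrow>
      three_form a b (X2 *\<^sub>v u) (X2 *\<^sub>v v) (X2 *\<^sub>v w) = three_form a b u v w
      + (dot r (vec_index u) * om v w + dot r (vec_index v) * om u w + dot r (vec_index w) * om u v)"
    using three_form_shift[OF sX2 XX2 inv] by blast
  obtain s where "s^2 = b / a" using sqrt by blast
  hence s: "s \<noteq> 0" "a * s^2 = b" using ab0 by auto
  define E where "E = diag6 (\<lambda>i. [s,1,1,1/s,1,1] ! i)"
  define E' where "E' = diag6 (\<lambda>i. [1/s,1,1,s,1,1] ! i)"
  have Ec: "E \<in> carrier_mat 6 6" "E' \<in> carrier_mat 6 6" by (simp_all add: E_def E'_def diag6_carrier)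
  have EE: "E * E' = 1\<^sub>m 6" "E' * E = 1\<^sub>m 6"
    unfolding E_def E'_def diag6_diag6 diag6_one[symmetric]
    by (rule diag6_cong; use s(1) in \<open>auto simp: less6\<close>)+
  have EZE: "E * ?Z * E' = ?Z"
    unfolding E_def E'_def diag6_diag6 by (rule diag6_cong) (use s(1) in \<open>auto simp: less6\<close>)
  have X2G: "X2 \<in> carrier (GL TYPE('a) 6)" using c2(1) XX2 by (auto simp: GL_carrier_iff)
  have m1: "E * X2 * E' \<in> G2_dim6 std_dickson std_basis"
    unfolding E_def E'_def by (rule scaled_in_G2_dim6[OF sX2 X2G r s ab0(1)])
  have ZG: "?Z \<in> carrier (GL TYPE('a) 6)"
  proof -
    have z0: "z i \<noteq> 0" if "i < 6" for i using z(1)[OF that] by auto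
    have "?Z * diag6 (\<lambda>i. 1 / z i) = 1\<^sub>m 6" "diag6 (\<lambda>i. 1 / z i) * ?Z = 1\<^sub>m 6"
      unfolding diag6_diag6 diag6_one[symmetric] by (rule diag6_cong; simp add: z0)+
    thus ?thesis using diag6_carrier by (auto simp: GL_carrier_iff)
  qed
  \<comment> \<open>The diagonal matrix fixes both minors in \<open>three_form\<close>, so the shift
    is zero.\<close>
  have m2: "?Z \<in> G2_dim6 std_dickson std_basis"
  proof (rule std_G2_dim6_intro[OF sZ ZG, of "\<lambda>_. 0"])
    fix u v w :: "'a vec" assume uvw: "u \<in> carrier_vec 6" "v \<in> carrier_vec 6" "w \<in> carrier_vec 6"
    have "minor (vec_index (?Z *\<^sub>v u)) (vec_index (?Z *\<^sub>v v)) (vec_index (?Z *\<^sub>v w)) i j k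
      = z i * z j * z k * minor (vec_index u) (vec_index v) (vec_index w) i j k" if "i < 6" "j < 6" "k < 6" for i j k
      unfolding minor_def using that uvw by (simp add: diag6_mult_vec algebra_simps)
    thus "three_form 1 1 (?Z *\<^sub>v u) (?Z *\<^sub>v v) (?Z *\<^sub>v w) = three_form 1 1 u v w +
      (dot (\<lambda>_. 0) (vec_index u) * om v w + dot (\<lambda>_. 0) (vec_index v) * om u w + dot (\<lambda>_. 0) (vec_index w) * om u v)"
      using z(3,4) by (simp add: three_form_def dot_def)
  qed
  have EDc: "E * D \<in> carrier_mat 6 6" "D' * E' \<in> carrier_mat 6 6" using Ec Dc by auto
  have prods: "(E * D) * A * (D' * E') = E * (D * A * D') * E'" if "A \<in> carrier_mat 6 6" for A
    using Dc Ec that by (simp only: mult6_assoc mult6_carrier)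
  have "(E * D) * (D' * E') = E * (D * D') * E'" "(D' * E') * (E * D) = D' * (E' * E) * D"
    using Dc Ec by (simp_all only: mult6_assoc mult6_carrier)
  hence "(E * D) * (D' * E') = 1\<^sub>m 6" "(D' * E') * (E * D) = 1\<^sub>m 6" using DD EE Dc Ec by simp_all
  moreover have "(E * D) * X * (D' * E') \<in> G2_dim6 std_dickson std_basis"
    unfolding prods[OF X] using m1 by (simp add: X2_def)
  moreover have "(E * D) * ?Z * (D' * E') \<in> G2_dim6 std_dickson std_basis"
    unfolding prods[OF Zc] DZD EZE by (rule m2)
  ultimately show ?thesis using EDc by blast
qed

end

section \<open>Choice of eigenvalues and assembly\<close>

lemma root_of_unity_power:
  fixes t :: "'a::field"
  assumes "t ^ 7 = 1" "t \<noteq> 1" shows "t ^ m = 1 \<longleftrightarrow> 7 dvd m"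
proof
  assume m: "t ^ m = 1"
  show "7 dvd m"
  proof (rule ccontr)
    assume "\<not> 7 dvd m"
    hence "coprime m 7" using prime_imp_coprime[of 7 m] by (simp add: coprime_commute)
    moreover have "m \<noteq> 0" using \<open>\<not> 7 dvd m\<close> by (intro notI) simp
    ultimately obtain x y where "m * x = 7 * y + 1"
      using coprime_bezout_strong[of m 7] by auto
    hence "t ^ (m * x) = t ^ (7 * y + 1)" by simp
    hence "1 = t" using m assms(1) by (simp add: power_mult power_add)
    thus False using assms(2) by simp
  qed
next
  assume "7 dvd m"
  then obtain k where "m = 7 * k" by blast
  thus "t ^ m = 1" using assms(1) by (simp add: power_mult)
qed

text \<open>The exponents at \<open>i\<close> and \<open>i + 3\<close> add up to 7, so these
  eigenvalues are inverse. The positions 0, 1, 5 carry 1, 2, 4, the nonzero squares modulo 7, and 3,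
  4, 2 carry the nonsquares 6, 5, 3. No other choice of one position from each pair has an exponent
  sum divisible by 7.\<close>

definition zexp :: "nat \<Rightarrow> nat" where "zexp i = [1,2,3,6,5,4] ! i"

theorem theorem1p2:
  fixes x y :: "'a::alg_closed_field mat" and H :: "'a mat set"
  assumes "CHAR('a) = 2"
    and "x \<in> carrier (GL TYPE('a) 6)" and "y \<in> carrier (GL TYPE('a) 6)"
    and "H = generate (GL TYPE('a) 6) {x, y}"
    and "H \<subseteq> SL TYPE('a) 6"
    and "acts_irreducibly 6 H"
    and "similarity_invariants x [[:1, 0, 1:], [:1, 0, 1:], [:1, 0, 1:]]"
    and "similarity_invariants y [[:-1, 0, 0, 1:], [:-1, 0, 0, 1:]]"
    and "similarity_invariants (x * y) [[:1, 1, 1, 1, 1, 1, 1:]]"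
  shows "contained_in_G2_dim6 H"
proof -
  interpret char_two "TYPE('a)" by unfold_locales (rule assms(1))
  have x: "x \<in> carrier_mat 6 6" and y: "y \<in> carrier_mat 6 6" using assms(2,3) by (auto simp: GL_carrier_iff)
  have xy: "x * y \<in> carrier_mat 6 6" using x y by simp
  obtain \<zeta> :: 'a where root: "poly [:1,1,1,1,1,1,1:] \<zeta> = 0"
    using alg_closed_imp_poly_has_root[of "[:1,1,1,1,1,1,1:] :: 'a poly"] by auto
  have poly7: "poly [:1,1,1,1,1,1,1:] t = 1 + t + t^2 + t^3 + t^4 + t^5 + t^6" for t :: 'a
    by (simp add: algebra_simps eval_nat_numeral)
  note phi = root[unfolded poly7]
  have phi7: "(1 + t + t^2 + t^3 + t^4 + t^5 + t^6) * (t + 1) = t^7 + 1" for t :: 'a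
    by (simp add: algebra_simps eval_nat_numeral two_simps)
  have \<zeta>7: "\<zeta>^7 = 1" using phi7[of \<zeta>] unfolding phi by (simp add: add_eq_zero_iff)
  \<comment> \<open>At 1 the cyclotomic sum has seven equal terms and is 1 in characteristic
    2.\<close>
  have \<zeta>1: "\<zeta> \<noteq> 1" using phi by (auto simp: two_simps)
  note pw = root_of_unity_power[OF \<zeta>7 \<zeta>1]
  obtain w :: 'a where "poly [:1,1,1:] w = 0"
    using alg_closed_imp_poly_has_root[of "[:1,1,1:] :: 'a poly"] by auto
  hence wphi: "1 + w + w^2 = 0" by (simp add: algebra_simps power2_eq_square)
  have "(1 + w + w^2) * (w + 1) = w^3 + 1" by (simp add: algebra_simps eval_nat_numeral two_simps)
  hence w3: "w^3 = 1" unfolding wphi by (simp add: add_eq_zero_iff)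
  have w1: "w \<noteq> 1" using wphi by (auto simp: two_simps)
  define z where "z i = \<zeta> ^ zexp i" for i
  have zi: "z i * z j = 1 \<longleftrightarrow> 7 dvd (zexp i + zexp j)" for i j unfolding z_def power_add[symmetric] by (rule pw)
  have zijk: "z i * z j * z k = 1 \<longleftrightarrow> 7 dvd (zexp i + zexp j + zexp k)" for i j k unfolding z_def power_add[symmetric] by (rule pw)
  note Sucs = numeral_2_eq_2[symmetric] numeral_3_eq_3[symmetric]
  have zeq: "i = j" if "i < 6" "j < 6" "z i = z j" for i j
  proof -
    have "z i * z ((j + 3) mod 6) = 1"
      using zi[of j "(j + 3) mod 6"] that unfolding less6 zexp_def by (elim disjE) simp_all
    hence "7 dvd (zexp i + zexp ((j + 3) mod 6))" by (simp add: zi)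
    thus ?thesis using that(1,2) unfolding less6 zexp_def by (elim disjE) (simp_all add: Sucs)
  qed
  have zroot: "poly [:1,1,1,1,1,1,1:] (z i) = 0" if "i < 6" for i
  proof -
    have "z i ^ 7 = 1" using \<zeta>7 unfolding z_def by (metis power_mult mult.commute power_one)
    hence "(1 + z i + z i^2 + z i^3 + z i^4 + z i^5 + z i^6) * (z i + 1) = 0" unfolding phi7 by (simp add: add_self)
    moreover have "z i \<noteq> 1" using pw[of "zexp i"] that unfolding z_def less6 zexp_def by (elim disjE) simp_all
    ultimately show ?thesis unfolding poly7 by (auto simp: add_eq_zero_iff[of "z i"])
  qed
  \<comment> \<open>The only non-constant invariant factor of \<open>x * y\<close> stands at
    position 5. Its six roots are distinct, and row 5 of the matrix for each root supplies an
    eigenvector.\<close>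
  obtain W W' where W: "W \<in> carrier_mat 6 6" "W' \<in> carrier_mat 6 6" "W * W' = 1\<^sub>m 6" "W' * W = 1\<^sub>m 6"
    and Weig: "\<And>i j. i < 6 \<Longrightarrow> j < 6 \<Longrightarrow> (W * (x * y)) $$ (i,j) = z i * W $$ (i,j)"
    by (rule eigenrow_basis[OF assms(9) xy, of "\<lambda>_. 5" z]) (use zroot zeq in \<open>auto simp: nth_append\<close>)
  have Wxy: "W * (x * y) = diag6 z * W"
    unfolding diag6_left[OF W(1)] by (rule eq_matI) (use Weig W xy in auto)
  \<comment> \<open>The non-constant invariant factors of \<open>y\<close> stand at positions 4 and
    5, and each supplies one eigenvector for every cube root of unity.\<close>
  let ?l = "\<lambda>i::nat. [1,1,w,w,w^2,w^2] ! i" and ?\<rho> = "\<lambda>i::nat. [4,5,4,5,4,5] ! i :: nat"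
  have w22: "w^2 \<noteq> 1" "w^2 \<noteq> w"
  proof -
    show "w^2 \<noteq> 1" using w3 w1 by (metis mult_1 power2_eq_square power3_eq_cube)
    show "w^2 \<noteq> w" using w3 w1 by (metis mult_cancel_right1 power2_eq_square power_zero_numeral zero_neq_one)
  qed
  obtain U U' where U: "U \<in> carrier_mat 6 6" "U' \<in> carrier_mat 6 6" "U * U' = 1\<^sub>m 6" "U' * U = 1\<^sub>m 6"
    and Ueig: "\<And>i j. i < 6 \<Longrightarrow> j < 6 \<Longrightarrow> (U * y) $$ (i,j) = ?l i * U $$ (i,j)"
  proof (rule eigenrow_basis[OF assms(8) y, of ?\<rho> ?l])
    have "w ^ (3 * 2) = 1" unfolding power_mult w3 by simp
    hence l3: "?l i ^ 3 = 1" if "i < 6" for i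
      using that w3 unfolding less6 by (elim disjE) (simp_all flip: power_mult)
    show "poly ((replicate (6 - length [[:- 1, 0, 0, 1:], [:- 1, 0, 0, 1:]]) 1 @ [[:- 1, 0, 0, 1:], [:- 1, 0, 0, 1:]]) ! ?\<rho> i) (?l i) = 0"
      if "i < 6" for i
    proof -
      have "?\<rho> i = 4 \<or> ?\<rho> i = 5" using that unfolding less6 by auto
      thus ?thesis using l3[OF that] by (auto simp: nth_append power3_eq_cube mult.assoc)
    qed
    show "i = j" if "i < 6" "j < 6" "?l i = ?l j" "?\<rho> i = ?\<rho> j" for i j
      using that w1 w22 unfolding less6 by (elim disjE) simp_all
  qed (auto simp: less6)
  have Uy: "U * y = diag6 ?l * U"
    unfolding diag6_left[OF U(1)] by (rule eq_matI) (use Ueig U y in auto)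
  have xx: "x * x = 1\<^sub>m 6"
  proof -
    have "x * x = (- 1) \<cdot>\<^sub>m 1\<^sub>m 6"
    proof (rule smith_square[OF assms(7) x])
      fix i :: nat assume "i < 6"
      thus "(replicate (6 - length [[:1, 0, 1:], [:1, 0, 1:], [:1, 0, 1:]]) 1 @ [[:1, 0, 1:], [:1, 0, 1:], [:1, 0, 1:]]) ! i dvd [:1, 0, 1:]"
        unfolding less6 by (elim disjE) (simp_all add: nth_append nth_Cons_numeral)
    qed
    also have "\<dots> = 1\<^sub>m 6" by (rule eq_matI) (auto simp: minus_eq)
    finally show ?thesis .
  qed
  have yyy: "y * y * y = 1\<^sub>m 6"
  proof -
    let ?L = "diag6 ?l :: 'a mat"
    note as = mult6_assoc mult6_carrier
    have L: "?L \<in> carrier_mat 6 6" by (rule diag6_carrier)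
    have LLL: "?L * (?L * ?L) = 1\<^sub>m 6" unfolding diag6_diag6 diag6_one[symmetric]
      by (rule diag6_cong) (use w3 in \<open>auto simp: less6 power2_eq_square power3_eq_cube mult.assoc\<close>)
    have "U * (y * y * y) = (U * y) * y * y" using U y by (simp only: as)
    also have "\<dots> = ?L * U * y * y" unfolding Uy ..
    also have "\<dots> = ?L * (U * y) * y" using U y L by (simp only: as)
    also have "\<dots> = ?L * (?L * U) * y" unfolding Uy ..
    also have "\<dots> = ?L * ?L * (U * y)" using U y L by (simp only: as)
    also have "\<dots> = ?L * ?L * (?L * U)" unfolding Uy ..
    also have "\<dots> = ?L * (?L * ?L) * U" using U L by (simp only: as)
    also have "\<dots> = U" unfolding LLL using U by simp
    finally have "U' * (U * (y * y * y)) = U' * U" by simp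
    moreover have "U' * (U * (y * y * y)) = (U' * U) * (y * y * y)" using U(1,2) y by (simp only: as)
    ultimately show ?thesis unfolding U(4) using y by simp
  qed
  obtain R R' where R: "R \<in> carrier_mat 6 6" "R' \<in> carrier_mat 6 6" "R * R' = 1\<^sub>m 6" "R' * R = 1\<^sub>m 6" and Rx: "R * x = J6 * R"
    by (rule involution_rows[OF assms(7) x xx])
  have irr: "irreducible_pair x (x * y)"
    using assms(6) unfolding assms(4) by (rule irreducible_pair_of_acts_irreducibly[OF _ assms(2) xx assms(3) yyy])
  note as = mult6_assoc mult6_carrier
  define X where "X = W * x * W'"
  define Y where "Y = W * y * W'"
  have X: "X \<in> carrier_mat 6 6" and Y: "Y \<in> carrier_mat 6 6" using W x y by (auto simp: X_def Y_def)
  have XX: "X * X = 1\<^sub>m 6" unfolding X_def conj_mult[OF x x W(1,2,4)] xx using W by simp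
  have Wz: "W * (x * y) * W' = diag6 z"
  proof -
    have "diag6 z * W * W' = diag6 z * (W * W')" using W diag6_carrier[of z] by (intro assoc_mult_mat) auto
    thus ?thesis unfolding Wxy W(3) using diag6_carrier[of z] by simp
  qed
  have XY: "X * Y = diag6 z" unfolding X_def Y_def conj_mult[OF x y W(1,2,4)] Wz ..
  have irr': "irreducible_pair X (diag6 z)"
    using irreducible_pair_conj[OF irr x xy W] unfolding Wz X_def .
  have RW: "R * W' \<in> carrier_mat 6 6" "W * R' \<in> carrier_mat 6 6" "R * W' * (W * R') = 1\<^sub>m 6"
  proof -
    have "R * W' * (W * R') = R * (W' * W) * R'" using R(1,2) W(1,2) by (simp only: as)
    thus "R * W' * (W * R') = 1\<^sub>m 6" unfolding W(4) using R by simp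
  qed (use R W in auto)
  have J6c: "(J6 :: 'a mat) \<in> carrier_mat 6 6" by (rule J6_carrier)
  have RWX: "R * W' * X = J6 * (R * W')"
  proof -
    have "R * W' * X = R * (W' * W) * x * W'" unfolding X_def using R(1) W(1,2) x by (simp only: as)
    also have "\<dots> = (R * x) * W'" unfolding W(4) using R(1) by simp
    also have "\<dots> = J6 * (R * W')" unfolding Rx using R(1) W(2) J6c by (simp only: as)
    finally show ?thesis .
  qed
  have UW: "U * W' \<in> carrier_mat 6 6" "W * U' \<in> carrier_mat 6 6" "U * W' * (W * U') = 1\<^sub>m 6" "W * U' * (U * W') = 1\<^sub>m 6"
  proof -
    have "U * W' * (W * U') = U * (W' * W) * U'" using U(1,2) W(1,2) by (simp only: as)
    thus "U * W' * (W * U') = 1\<^sub>m 6" unfolding W(4) using U by simp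
    have "W * U' * (U * W') = W * (U' * U) * W'" using U(1,2) W(1,2) by (simp only: as)
    thus "W * U' * (U * W') = 1\<^sub>m 6" unfolding U(4) using W by simp
  qed (use U W in auto)
  have UWY: "U * W' * Y = diag6 ?l * (U * W')"
  proof -
    have "U * W' * Y = U * (W' * W) * y * W'" unfolding Y_def using U(1) W(1,2) y by (simp only: as)
    also have "\<dots> = (U * y) * W'" unfolding W(4) using U(1) by simp
    also have "\<dots> = diag6 ?l * (U * W')" unfolding Uy using U(1) W(2) diag6_carrier[of ?l] by (simp only: as)
    finally show ?thesis .
  qed
  have sqrt: "\<exists>s. s^2 = t" for t :: 'a by (rule nth_root_exists) simp
  have z1: "z i * z ((i + 3) mod 6) = 1" if "i < 6" for i
    using that unfolding zi less6 zexp_def by (elim disjE) (simp_all add: Sucs)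
  have z2: "z i * z j \<noteq> 1" if "i < 6" "j < 6" "j \<noteq> (i + 3) mod 6" for i j
    using that unfolding zi less6 zexp_def by (elim disjE) (simp_all add: Sucs)
  have "\<exists>C\<in>carrier_mat 6 6. \<exists>C'\<in>carrier_mat 6 6. C * C' = 1\<^sub>m 6 \<and> C' * C = 1\<^sub>m 6 \<and>
    C * X * C' \<in> G2_dim6 std_dickson std_basis \<and> C * diag6 z * C' \<in> G2_dim6 std_dickson std_basis"
    by (rule normal_form_in_G2_dim6[OF sqrt X Y XX XY RW RWX UW UWY w3 w1 irr' z1 z2])
      (assumption | simp add: zijk zexp_def Sucs)+
  then obtain C C' where C: "C \<in> carrier_mat 6 6" "C' \<in> carrier_mat 6 6" "C * C' = 1\<^sub>m 6" "C' * C = 1\<^sub>m 6"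
    and CX: "C * X * C' \<in> G2_dim6 std_dickson std_basis" and CZ: "C * diag6 z * C' \<in> G2_dim6 std_dickson std_basis"
    by blast
  define c where "c = C * W"
  define c' where "c' = W' * C'"
  have cc: "c \<in> carrier_mat 6 6" "c' \<in> carrier_mat 6 6" using C W by (auto simp: c_def c'_def)
  have "c * c' = C * (W * W') * C'" "c' * c = W' * (C' * C) * W"
    unfolding c_def c'_def using C(1,2) W(1,2) by (simp_all only: as)
  hence cci: "c * c' = 1\<^sub>m 6" "c' * c = 1\<^sub>m 6" unfolding W(3) C(4) using C W by simp_all
  have cG: "c \<in> carrier (GL TYPE('a) 6)" "c' \<in> carrier (GL TYPE('a) 6)" using cc cci by (auto simp: GL_carrier_iff)
  have ic: "inv\<^bsub>GL TYPE('a) 6\<^esub> c = c'"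
    by (rule group.inv_equality[OF GL_group]) (use cci cG in \<open>simp_all add: GL_mult GL_one\<close>)
  have "c * A * c' = C * (W * A * W') * C'" if "A \<in> carrier_mat 6 6" for A
    unfolding c_def c'_def using C(1,2) W(1,2) that by (simp only: as)
  hence mx: "c * x * c' \<in> G2_dim6 std_dickson std_basis" and mxy: "c * (x * y) * c' \<in> G2_dim6 std_dickson std_basis"
    using CX CZ x xy by (simp_all add: X_def Wz)
  \<comment> \<open>Membership was shown for \<open>x\<close> and \<open>x * y\<close>; as
    \<open>x\<close> is an involution, it follows for \<open>y\<close>.\<close>
  have "y = x * (x * y)" unfolding assoc_mult_mat[OF x x y, symmetric] xx using y by simp
  hence "c * y * c' = (c * x * c') * (c * (x * y) * c')" using conj_mult[OF x xy cc cci(2)] by simp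
  hence my: "c * y * c' \<in> G2_dim6 std_dickson std_basis" using G2_dim6_mult[OF mx mxy] by simp
  show ?thesis unfolding assms(4)
    by (rule generate_contained_in_G2_dim6[OF std_dickson_basis cG(1)]) (use assms(2,3) mx my ic in auto)
qed

end
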